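(* Let $R$ be a Mori domain, and let $R^{*}$ denote its complete integral closure. (1) The following are equivalent: (i) $R$ is a one-dimensional Clifford regular domain and $R^{*}$ is Mori; (ii) $R$ is stable. (2) The following are equivalent: (i) $R$ is a one-dimensional Boole regular domain and $R^{*}$ is Mori; (ii) $R$ is strongly stable.
   Context: For an integral domain $R$ with quotient field $K$, the class semigroup $\mathcal{S}(R)$ is the commutative multiplicative semigroup of nonzero fractional ideals of $R$ modulo its subsemigroup of nonzero principal fractional ideals. A commutative semigroup $S$ is Clifford if for every $x\in S$ there is $a\in S$ with $x^2a=x$, and Boolean if $x=x^2$ for all $x\in S$. $R$ is Clifford (resp., Boole) regular if $\mathcal{S}(R)$ is Clifford (resp., Boolean). For $R$-submodules $I,J$ of $K$, $(I:J)=\{x\in K: xJ\subseteq I\}$. A nonzero ideal $I$ is stable if it is invertible as an ideal of the ring $(I:I)$; $R$ is stable if every nonzero ideal is stable. $R$ is strongly stable if each nonzero ideal $I$ of $R$ is principal in its endomorphism ring $(I:I)$, i.e. there is $c\in K$ with $I=c(I:I)$. A nonzero fractional ideal $I$ is divisorial if $I=I_v$, where $I_v=(R:(R:I))$. $R$ is a Mori domain if it satisfies the ascending chain condition on divisorial (integral) ideals. The complete integral closure $R^{*}$ is the set of $x\in K$ for which there is $0\neq d\in R$ with $dx^n\in R$ for all $n\geq 1$.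
   Formalization: The formal theorem additionally assumes that R is not a field; a field is a Mori domain that is stable and strongly stable but has Krull dimension 0, so both equivalences fail for it. *)

theory Defs
  imports "HOL-Algebra.Algebra" "HOL-Library.Extended_Nat"
begin

text \<open>
  An integral domain is a subring \<open>R\<close> of a field \<open>K\<close> in which every element of \<open>K\<close> is a fraction
  with numerator and denominator in \<open>R\<close>. The overrings of \<open>R\<close> that occur below (the endomorphism
  rings \<open>(I:I)\<close> and the complete integral closure) are subsets of \<open>K\<close> as well and have the same
  quotient field.
\<close>

locale quotient_field = field K + subdomain R K for K (structure) and R +
  assumes fractions: "carrier K = {a \<otimes> inv b | a b. a \<in> R \<and> b \<in> R - {\<zero>}}"

definition krull_dim :: "('a, 'b) ring_scheme \<Rightarrow> enat" where
  "krull_dim A = Sup {enat n | n.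
     \<exists>P. (\<forall>i\<le>n. primeideal (P i) A) \<and> (\<forall>i<n. P i \<subset> P (Suc i))}"

definition colon :: "('a, 'b) ring_scheme \<Rightarrow> 'a set \<Rightarrow> 'a set \<Rightarrow> 'a set" where
  "colon K I J = {x \<in> carrier K. \<forall>y\<in>J. x \<otimes>\<^bsub>K\<^esub> y \<in> I}"

definition fractional_ideal :: "('a, 'b) ring_scheme \<Rightarrow> 'a set \<Rightarrow> 'a set \<Rightarrow> bool" where
  "fractional_ideal K R I \<longleftrightarrow>
     additive_subgroup I K \<and>
     (\<forall>r\<in>R. \<forall>x\<in>I. r \<otimes>\<^bsub>K\<^esub> x \<in> I) \<and>
     (\<exists>d\<in>R - {\<zero>\<^bsub>K\<^esub>}. \<forall>x\<in>I. d \<otimes>\<^bsub>K\<^esub> x \<in> R)"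

definition fractional_ideals :: "('a, 'b) ring_scheme \<Rightarrow> 'a set \<Rightarrow> 'a set monoid" where
  "fractional_ideals K R =
     \<lparr>carrier = {I. fractional_ideal K R I \<and> I \<noteq> {\<zero>\<^bsub>K\<^esub>}}, monoid.mult = ideal_prod K, one = R\<rparr>"

definition principal_fractional_ideals :: "('a, 'b) ring_scheme \<Rightarrow> 'a set \<Rightarrow> 'a set set" where
  "principal_fractional_ideals K R = {c <#\<^bsub>K\<^esub> R | c. c \<in> carrier K - {\<zero>\<^bsub>K\<^esub>}}"

text \<open>
  The library's \<open>Mod\<close> is designed for groups, but it makes sense here: the principal fractional
  ideals form a subgroup of the units of the commutative monoid of nonzero fractional ideals. The
  coset of \<open>I\<close> is \<open>{c I | c \<noteq> 0}\<close>, and the complex product of the cosets of \<open>I\<close> and \<open>J\<close> is the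
  coset of \<open>I J\<close>.
\<close>

definition class_semigroup :: "('a, 'b) ring_scheme \<Rightarrow> 'a set \<Rightarrow> 'a set set monoid" where
  "class_semigroup K R = fractional_ideals K R Mod principal_fractional_ideals K R"

definition clifford_semigroup :: "('a, 'b) monoid_scheme \<Rightarrow> bool" where
  "clifford_semigroup S \<longleftrightarrow>
     (\<forall>x\<in>carrier S. \<exists>a\<in>carrier S. (x \<otimes>\<^bsub>S\<^esub> x) \<otimes>\<^bsub>S\<^esub> a = x)"

definition boolean_semigroup :: "('a, 'b) monoid_scheme \<Rightarrow> bool" where
  "boolean_semigroup S \<longleftrightarrow> (\<forall>x\<in>carrier S. x = x \<otimes>\<^bsub>S\<^esub> x)"

definition clifford_regular :: "('a, 'b) ring_scheme \<Rightarrow> 'a set \<Rightarrow> bool" where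
  "clifford_regular K R \<longleftrightarrow> clifford_semigroup (class_semigroup K R)"

definition boole_regular :: "('a, 'b) ring_scheme \<Rightarrow> 'a set \<Rightarrow> bool" where
  "boole_regular K R \<longleftrightarrow> boolean_semigroup (class_semigroup K R)"

text \<open>
  An ideal of a domain is invertible if it is a unit of the monoid of nonzero fractional ideals of
  that domain; stability of \<open>I\<close> refers to the domain \<open>(I:I)\<close>.
\<close>

definition stable_ideal :: "('a, 'b) ring_scheme \<Rightarrow> 'a set \<Rightarrow> bool" where
  "stable_ideal K I \<longleftrightarrow> I \<in> Units (fractional_ideals K (colon K I I))"

definition stable_domain :: "('a, 'b) ring_scheme \<Rightarrow> 'a set \<Rightarrow> bool" where
  "stable_domain K R \<longleftrightarrow>
     (\<forall>I. ideal I (K\<lparr>carrier := R\<rparr>) \<and> I \<noteq> {\<zero>\<^bsub>K\<^esub>} \<longrightarrow> stable_ideal K I)"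

definition strongly_stable_domain :: "('a, 'b) ring_scheme \<Rightarrow> 'a set \<Rightarrow> bool" where
  "strongly_stable_domain K R \<longleftrightarrow>
     (\<forall>I. ideal I (K\<lparr>carrier := R\<rparr>) \<and> I \<noteq> {\<zero>\<^bsub>K\<^esub>} \<longrightarrow>
        (\<exists>c\<in>carrier K. I = c <#\<^bsub>K\<^esub> colon K I I))"

definition v_closure :: "('a, 'b) ring_scheme \<Rightarrow> 'a set \<Rightarrow> 'a set \<Rightarrow> 'a set" where
  "v_closure K R I = colon K R (colon K R I)"

definition divisorial :: "('a, 'b) ring_scheme \<Rightarrow> 'a set \<Rightarrow> 'a set \<Rightarrow> bool" where
  "divisorial K R I \<longleftrightarrow>
     fractional_ideal K R I \<and> I \<noteq> {\<zero>\<^bsub>K\<^esub>} \<and> I = v_closure K R I"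

definition mori :: "('a, 'b) ring_scheme \<Rightarrow> 'a set \<Rightarrow> bool" where
  "mori K R \<longleftrightarrow>
     (\<forall>I :: nat \<Rightarrow> 'a set.
        (\<forall>n. ideal (I n) (K\<lparr>carrier := R\<rparr>) \<and> divisorial K R (I n) \<and> I n \<subseteq> I (Suc n)) \<longrightarrow>
        (\<exists>N. \<forall>n\<ge>N. I n = I N))"

definition complete_integral_closure :: "('a, 'b) ring_scheme \<Rightarrow> 'a set \<Rightarrow> 'a set" where
  "complete_integral_closure K R =
     {x \<in> carrier K. \<exists>d\<in>R - {\<zero>\<^bsub>K\<^esub>}. \<forall>n::nat. n \<ge> 1 \<longrightarrow> d \<otimes>\<^bsub>K\<^esub> (x [^]\<^bsub>K\<^esub> n) \<in> R}"

end

theory Submission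
  imports Defs
begin

text \<open>
  Write \<open>D\<close> for the complete integral closure of \<open>R\<close>, \<open>E = (I:I)\<close> for the endomorphism ring of a
  nonzero fractional ideal \<open>I\<close>, and \<open>T = I(E:I)\<close> for its trace ideal in \<open>E\<close>. Stability of \<open>I\<close> says
  \<open>1 \<in> T\<close>; Clifford regularity says \<open>IT = I\<close> for all \<open>I\<close>, because any \<open>A\<close> with \<open>I\<^sup>2A = I\<close> lies in
  \<open>(E:I)\<close>. So stable domains are Clifford regular, and in a Clifford regular domain every trace ideal
  is idempotent. The second equivalence follows from the first: \<open>I = cI\<^sup>2\<close> makes \<open>cI\<close> idempotent, and
  an idempotent invertible ideal of \<open>E\<close> is \<open>E\<close>.

  From Clifford regular to stable. By Nakayama's lemma, \<open>IT = I\<close> with \<open>I\<close> finitely generated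
  forces \<open>1 \<in> T\<close>; finitely generated ideals are therefore stable. In dimension one this makes \<open>D\<close>
  quadratic over \<open>R\<close>: for \<open>x \<in> D\<close> the module \<open>R + Rx\<close> is a ring. The reason is that an invertible
  module \<open>I\<close> containing \<open>1\<close> over a one-dimensional ring \<open>E\<close>, whose powers have a common denominator,
  equals \<open>E\<close> (\<open>invertible_module_is_ring\<close>). Now let \<open>T\<close> be an idempotent trace ideal. If \<open>D\<close> is Mori,
  some finite \<open>G \<subseteq> T\<close> satisfies \<open>(D:G) = (D:T)\<close>; as \<open>RG\<close> is stable, \<open>GD\<close> is invertible in \<open>D\<close>, and
  idempotency gives \<open>TD = D\<close>. Only finitely many elements of \<open>D\<close> occur in an equation that witnesses
  this, and they lie in a ring that is finitely generated as an \<open>R\<close>-module. Nakayama's lemma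
  applied to this ring yields \<open>1 \<in> T\<close> (\<open>stable_if_trace_fixes\<close>).

  From stable to dimension one. For primes \<open>0 \<noteq> P \<subset> N\<close> and \<open>x \<in> N - P\<close>, look at the ideals
  \<open>I\<^sub>k = P + Rx\<^sup>k\<close> with inverses \<open>J\<^sub>k\<close> over their endomorphism rings. The Mori property bounds the
  denominators of all \<open>J\<^sub>k\<close> at once: one power \<open>x\<^sup>n\<close> multiplies every \<open>J\<^sub>k\<close> into \<open>R\<close>, which puts \<open>x\<^sup>n\<close>
  into \<open>P + Rx\<^bsup>n+1\<^esup>\<close> and so \<open>1\<close> into \<open>N\<close> (\<open>stable_mori_dimension\<close>).

  From stable to \<open>D\<close> Mori. It is enough that every nonzero prime \<open>Q\<close> of \<open>D\<close> is invertible
  (\<open>invertible_if_primes_invertible\<close>, \<open>mori_if_ideals_invertible\<close>). Every fractional ideal \<open>N\<close> of \<open>R\<close>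
  is stable, so \<open>ND\<close> is invertible, and \<open>Q\<close> has the form \<open>ND\<close> with \<open>N = (Q \<inter> R) + Rx + Re\<close>: the
  element \<open>x\<close> generates \<open>Q\<close> modulo \<open>Q \<inter> R\<close> locally at \<open>Q\<close>, and \<open>e\<close> lies in no other prime above
  \<open>Q \<inter> R\<close>. Both exist because all products satisfy \<open>xy \<in> R + Rx + Ry\<close> in \<open>D\<close>
  (\<open>exists_local_generator\<close>, \<open>exists_separator\<close>).
\<close>

text \<open>
  Overrings vary throughout the argument, so the basic facts fix only the field and take the ring
  of scalars as an argument.
\<close>

section \<open>Products and residuals of subgroups of a field\<close>

locale ambient_field = field K for K (structure)
begin

abbreviation residual :: "'a set \<Rightarrow> 'a set \<Rightarrow> 'a set" (infixl "\<oslash>" 75)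
  where "I \<oslash> J \<equiv> colon K I J"

abbreviation group_in :: "'a set \<Rightarrow> bool"
  where "group_in A \<equiv> additive_subgroup A K"

definition module_over :: "'a set \<Rightarrow> 'a set \<Rightarrow> bool" where
  "module_over E M \<longleftrightarrow> group_in M \<and> (\<forall>e\<in>E. \<forall>m\<in>M. e \<otimes> m \<in> M)"

lemma group_inI:
  assumes "A \<subseteq> carrier K" "\<zero> \<in> A" "\<And>x y. x \<in> A \<Longrightarrow> y \<in> A \<Longrightarrow> x \<oplus> y \<in> A"
    "\<And>x. x \<in> A \<Longrightarrow> \<ominus> x \<in> A"
  shows "group_in A"
  unfolding additive_subgroup_def using assms
  by (auto intro!: add.subgroupI simp: a_inv_def)

lemma group_inD:
  assumes "group_in A"
  shows "A \<subseteq> carrier K" "\<zero> \<in> A" "\<And>x y. x \<in> A \<Longrightarrow> y \<in> A \<Longrightarrow> x \<oplus> y \<in> A"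
    "\<And>x. x \<in> A \<Longrightarrow> \<ominus> x \<in> A" "\<And>x y. x \<in> A \<Longrightarrow> y \<in> A \<Longrightarrow> x \<ominus> y \<in> A" "A \<noteq> {}"
proof -
  interpret additive_subgroup A K by (rule assms)
  show 1: "A \<subseteq> carrier K" "\<zero> \<in> A" "\<And>x y. x \<in> A \<Longrightarrow> y \<in> A \<Longrightarrow> x \<oplus> y \<in> A"
    by (auto simp: a_subset)
  show 2: "\<And>x. x \<in> A \<Longrightarrow> \<ominus> x \<in> A" by (rule a_inv_closed)
  show "\<And>x y. x \<in> A \<Longrightarrow> y \<in> A \<Longrightarrow> x \<ominus> y \<in> A" using 1 2 by (simp add: a_minus_def)
  show "A \<noteq> {}" using 1(2) by blast
qed

lemma module_overI:
  assumes "A \<subseteq> carrier K" "\<zero> \<in> A" "\<And>x y. x \<in> A \<Longrightarrow> y \<in> A \<Longrightarrow> x \<oplus> y \<in> A"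
    "\<And>x e. x \<in> A \<Longrightarrow> e \<in> E \<Longrightarrow> e \<otimes> x \<in> A" and E: "subring E K"
  shows "module_over E A"
proof -
  have "\<ominus> x \<in> A" if "x \<in> A" for x
  proof -
    have "(\<ominus> \<one>) \<otimes> x \<in> A" using assms(4) that subringE[OF E] by blast
    thus ?thesis using that assms(1) by (auto simp: l_minus)
  qed
  thus ?thesis unfolding module_over_def using assms by (auto intro!: group_inI)
qed

lemma module_overD:
  assumes "module_over E A"
  shows "group_in A" "A \<subseteq> carrier K" "\<zero> \<in> A" "\<And>x y. x \<in> A \<Longrightarrow> y \<in> A \<Longrightarrow> x \<oplus> y \<in> A"
    "\<And>x. x \<in> A \<Longrightarrow> \<ominus> x \<in> A" "\<And>x y. x \<in> A \<Longrightarrow> y \<in> A \<Longrightarrow> x \<ominus> y \<in> A"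
    "\<And>e x. e \<in> E \<Longrightarrow> x \<in> A \<Longrightarrow> e \<otimes> x \<in> A"
    "\<And>e x. e \<in> E \<Longrightarrow> x \<in> A \<Longrightarrow> E \<subseteq> carrier K \<Longrightarrow> x \<otimes> e \<in> A"
proof -
  show 1: "group_in A" "\<And>e x. e \<in> E \<Longrightarrow> x \<in> A \<Longrightarrow> e \<otimes> x \<in> A"
    using assms by (auto simp: module_over_def)
  note 2 = group_inD[OF 1(1)]
  show "A \<subseteq> carrier K" "\<zero> \<in> A" "\<And>x y. x \<in> A \<Longrightarrow> y \<in> A \<Longrightarrow> x \<oplus> y \<in> A"
    "\<And>x. x \<in> A \<Longrightarrow> \<ominus> x \<in> A" "\<And>x y. x \<in> A \<Longrightarrow> y \<in> A \<Longrightarrow> x \<ominus> y \<in> A"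
    using 2 by auto
  show "\<And>e x. e \<in> E \<Longrightarrow> x \<in> A \<Longrightarrow> E \<subseteq> carrier K \<Longrightarrow> x \<otimes> e \<in> A"
    using 1 2(1) by (metis m_comm subsetD)
qed

lemma module_over_mono: "module_over E A \<Longrightarrow> F \<subseteq> E \<Longrightarrow> module_over F A"
  by (auto simp: module_over_def)

lemma subring_group_in: "subring E K \<Longrightarrow> group_in E"
  by (rule group_inI) (auto dest: subringE)

lemma subring_module: "subring E K \<Longrightarrow> F \<subseteq> E \<Longrightarrow> module_over F E"
  unfolding module_over_def by (auto intro: subring_group_in subringE(6))

lemma ideal_prod_le:
  assumes "group_in C" "\<And>a b. a \<in> A \<Longrightarrow> b \<in> B \<Longrightarrow> a \<otimes> b \<in> C"
  shows "A \<cdot> B \<subseteq> C"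
proof
  fix x assume "x \<in> A \<cdot> B"
  thus "x \<in> C" by induct (auto intro: assms group_inD[OF assms(1)])
qed

lemma ideal_prod_subset_carrier:
  assumes "A \<subseteq> carrier K" "B \<subseteq> carrier K" shows "A \<cdot> B \<subseteq> carrier K"
proof
  fix x assume "x \<in> A \<cdot> B"
  thus "x \<in> carrier K" by induct (use assms in auto)
qed

lemma ideal_prod_mono:
  assumes "A \<subseteq> A'" "B \<subseteq> B'" shows "A \<cdot> B \<subseteq> A' \<cdot> B'"
proof
  fix x assume "x \<in> A \<cdot> B"
  thus "x \<in> A' \<cdot> B'" by induct (use assms in \<open>auto intro: ideal_prod.intros\<close>)
qed

lemma ideal_prod_comm:
  assumes "A \<subseteq> carrier K" "B \<subseteq> carrier K" shows "A \<cdot> B = B \<cdot> A"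
proof -
  have "A \<cdot> B \<subseteq> B \<cdot> A" if "A \<subseteq> carrier K" "B \<subseteq> carrier K" for A B
  proof
    fix x assume "x \<in> A \<cdot> B"
    thus "x \<in> B \<cdot> A"
    proof induct
      case (prod i j)
      hence "i \<otimes> j = j \<otimes> i" using that m_comm by blast
      thus ?case using prod by (simp add: ideal_prod.prod)
    qed (rule ideal_prod.sum)
  qed
  thus ?thesis using assms by blast
qed

lemma ideal_prod_group_left:
  assumes A: "group_in A" and B: "B \<subseteq> carrier K" "B \<noteq> {}" shows "group_in (A \<cdot> B)"
proof (rule group_inI)
  note a = group_inD[OF A]
  show c: "A \<cdot> B \<subseteq> carrier K" using a B by (intro ideal_prod_subset_carrier) auto
  obtain b where b: "b \<in> B" using B by auto
  have "\<zero> \<otimes> b = \<zero>" using b B by auto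
  thus "\<zero> \<in> A \<cdot> B" using ideal_prod.prod[of \<zero> A b B K] a b by auto
  show "x \<oplus> y \<in> A \<cdot> B" if "x \<in> A \<cdot> B" "y \<in> A \<cdot> B" for x y using that by (rule ideal_prod.sum)
  show "\<ominus> x \<in> A \<cdot> B" if "x \<in> A \<cdot> B" for x using that
  proof induct
    case (prod i j)
    have "\<ominus> (i \<otimes> j) = (\<ominus> i) \<otimes> j" using prod a B by (metis l_minus subsetD)
    thus ?case using prod a by (simp add: ideal_prod.prod)
  next
    case (sum x y)
    thus ?case using c by (metis (no_types, lifting) ideal_prod.sum minus_add subsetD)
  qed
qed

lemma ideal_prod_assoc:
  assumes A: "A \<subseteq> carrier K" and B: "B \<subseteq> carrier K" and C: "C \<subseteq> carrier K"
  shows "(A \<cdot> B) \<cdot> C = A \<cdot> (B \<cdot> C)"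
proof -
  have 1: "(A \<cdot> B) \<cdot> C \<subseteq> A \<cdot> (B \<cdot> C)"
    if c: "A \<subseteq> carrier K" "B \<subseteq> carrier K" "C \<subseteq> carrier K" for A B C
  proof
    note AB = ideal_prod_subset_carrier[OF c(1,2)]
    fix x assume "x \<in> (A \<cdot> B) \<cdot> C"
    thus "x \<in> A \<cdot> (B \<cdot> C)"
    proof induct
      case (prod i j)
      from prod(1) show ?case
      proof induct
        case (prod a b)
        have "(a \<otimes> b) \<otimes> j = a \<otimes> (b \<otimes> j)" using prod \<open>j \<in> C\<close> c by (auto intro!: m_assoc)
        thus ?case using prod \<open>j \<in> C\<close> by (simp add: ideal_prod.prod)
      next
        case (sum u v)
        have "(u \<oplus> v) \<otimes> j = u \<otimes> j \<oplus> v \<otimes> j" using sum \<open>j \<in> C\<close> c AB by (auto intro!: l_distr)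
        thus ?case using sum by (simp add: ideal_prod.sum)
      qed
    qed (rule ideal_prod.sum)
  qed
  have "A \<cdot> (B \<cdot> C) = (C \<cdot> B) \<cdot> A"
    using A B C by (metis ideal_prod_comm ideal_prod_subset_carrier)
  also have "\<dots> \<subseteq> C \<cdot> (B \<cdot> A)" by (rule 1[OF C B A])
  also have "\<dots> = (A \<cdot> B) \<cdot> C"
    using A B C by (metis ideal_prod_comm ideal_prod_subset_carrier)
  finally show ?thesis using 1[OF A B C] by blast
qed

lemma ideal_prod_left_comm:
  assumes "A \<subseteq> carrier K" "B \<subseteq> carrier K" "C \<subseteq> carrier K"
  shows "A \<cdot> (B \<cdot> C) = B \<cdot> (A \<cdot> C)"
  using assms by (metis ideal_prod_assoc ideal_prod_comm)

lemma colon_subset: "C \<oslash> B \<subseteq> carrier K" by (auto simp: colon_def)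

lemma colon_group:
  assumes C: "group_in C" and B: "B \<subseteq> carrier K" shows "group_in (C \<oslash> B)"
proof (rule group_inI)
  note c = group_inD[OF C]
  show "C \<oslash> B \<subseteq> carrier K" by (rule colon_subset)
  show "\<zero> \<in> C \<oslash> B" using c B by (auto simp: colon_def)
  show "x \<oplus> y \<in> C \<oslash> B" if "x \<in> C \<oslash> B" "y \<in> C \<oslash> B" for x y
    using that c(3) B by (auto simp: colon_def l_distr subset_iff)
  show "\<ominus> x \<in> C \<oslash> B" if "x \<in> C \<oslash> B" for x
    using that c(4) B by (auto simp: colon_def l_minus subset_iff)
qed

text \<open>
  Products and colons form a residuated pair; nearly all inclusions between ideals below are
  moved from one side to the other by this adjunction.
\<close>

lemma le_colon_iff:
  assumes "group_in C" "A \<subseteq> carrier K"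
  shows "A \<subseteq> C \<oslash> B \<longleftrightarrow> A \<cdot> B \<subseteq> C"
proof
  assume "A \<subseteq> C \<oslash> B"
  thus "A \<cdot> B \<subseteq> C" by (intro ideal_prod_le assms) (auto simp: colon_def)
next
  assume "A \<cdot> B \<subseteq> C"
  thus "A \<subseteq> C \<oslash> B" using assms by (auto simp: colon_def intro: ideal_prod.prod)
qed

lemma colon_prod_le:
  assumes "group_in C" shows "(C \<oslash> B) \<cdot> B \<subseteq> C"
  using le_colon_iff[OF assms colon_subset] by blast

lemma prod_colon_le:
  assumes "group_in C" "B \<subseteq> carrier K" shows "B \<cdot> (C \<oslash> B) \<subseteq> C"
  using colon_prod_le[OF assms(1)] ideal_prod_comm[OF assms(2) colon_subset] by metis

lemma subset_prod_left:
  assumes "A \<subseteq> carrier K" "\<one> \<in> B" shows "A \<subseteq> A \<cdot> B"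
proof
  fix x assume x: "x \<in> A"
  show "x \<in> A \<cdot> B" using ideal_prod.prod[OF x assms(2), of K] x assms(1) by auto
qed

lemma subset_prod_right:
  assumes "B \<subseteq> carrier K" "\<one> \<in> A" shows "B \<subseteq> A \<cdot> B"
proof
  fix x assume x: "x \<in> B"
  show "x \<in> A \<cdot> B" using ideal_prod.prod[OF assms(2) x, of K] x assms(1) by auto
qed

lemma subset_module_if_one:
  assumes "module_over E A" "\<one> \<in> A" "E \<subseteq> carrier K" shows "E \<subseteq> A"
proof
  fix x assume x: "x \<in> E"
  have "x \<otimes> \<one> \<in> A" by (rule module_overD(7)[OF assms(1) x assms(2)])
  thus "x \<in> A" using x assms(3) by auto
qed

lemma module_prod_id:
  assumes "module_over E A" "\<one> \<in> E" shows "E \<cdot> A = A"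
proof
  show "E \<cdot> A \<subseteq> A" by (rule ideal_prod_le) (use module_overD[OF assms(1)] in auto)
  show "A \<subseteq> E \<cdot> A" by (rule subset_prod_right[OF module_overD(2)[OF assms(1)] assms(2)])
qed

lemma module_prod_id':
  assumes "module_over E A" "\<one> \<in> E" "E \<subseteq> carrier K" shows "A \<cdot> E = A"
  using module_prod_id[OF assms(1,2)] ideal_prod_comm[OF assms(3), of A] module_overD[OF assms(1)] by metis

lemma module_prod:
  assumes A: "module_over E A" and B: "B \<subseteq> carrier K" "B \<noteq> {}" and E: "E \<subseteq> carrier K"
  shows "module_over E (A \<cdot> B)"
proof -
  note a = module_overD[OF A]
  have "e \<otimes> x \<in> A \<cdot> B" if "e \<in> E" "x \<in> A \<cdot> B" for e x
    using that(2)
  proof induct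
    case (prod i j)
    have "e \<otimes> (i \<otimes> j) = (e \<otimes> i) \<otimes> j" using prod a B E that by (metis m_assoc subsetD)
    thus ?case using prod a that by (simp add: ideal_prod.prod)
  next
    case (sum x y)
    have "x \<in> carrier K" "y \<in> carrier K" "e \<in> carrier K"
      using sum ideal_prod_subset_carrier[OF a(2) B(1)] E that by auto
    thus ?case using sum by (simp add: r_distr ideal_prod.sum)
  qed
  thus ?thesis unfolding module_over_def using ideal_prod_group_left[OF a(1) B] by auto
qed

lemma module_colon:
  assumes "module_over E A" "B \<subseteq> carrier K" "E \<subseteq> carrier K"
  shows "module_over E (A \<oslash> B)"
  unfolding module_over_def
proof (intro conjI ballI)
  note a = module_overD[OF assms(1)]
  show "group_in (A \<oslash> B)" using colon_group a assms by blast
  fix e m assume e: "e \<in> E" and m: "m \<in> A \<oslash> B"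
  have "e \<otimes> m \<otimes> y \<in> A" if "y \<in> B" for y
  proof -
    have "e \<otimes> m \<otimes> y = e \<otimes> (m \<otimes> y)" using e m that assms by (auto simp: colon_def intro!: m_assoc)
    thus ?thesis using e m that a by (auto simp: colon_def)
  qed
  thus "e \<otimes> m \<in> A \<oslash> B" using e m assms by (auto simp: colon_def)
qed

lemma colon_antimono: "B \<subseteq> B' \<Longrightarrow> C \<oslash> B' \<subseteq> C \<oslash> B"
  by (auto simp: colon_def)

lemma colon_mono: "C \<subseteq> C' \<Longrightarrow> C \<oslash> B \<subseteq> C' \<oslash> B"
  by (auto simp: colon_def)

lemma subring_colon:
  assumes "group_in I" shows "subring (I \<oslash> I) K"
proof (rule subringI)
  note i = group_inD[OF assms]
  have g: "group_in (I \<oslash> I)" using colon_group i assms by blast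
  show "I \<oslash> I \<subseteq> carrier K" by (rule colon_subset)
  show "\<one> \<in> I \<oslash> I" using i(1) by (auto simp: colon_def subset_iff)
  show "\<And>h. h \<in> I \<oslash> I \<Longrightarrow> \<ominus> h \<in> I \<oslash> I" using group_inD(4)[OF g] .
  show "\<And>h1 h2. h1 \<in> I \<oslash> I \<Longrightarrow> h2 \<in> I \<oslash> I \<Longrightarrow> h1 \<oplus> h2 \<in> I \<oslash> I" using group_inD(3)[OF g] .
  fix x y assume x: "x \<in> I \<oslash> I" and y: "y \<in> I \<oslash> I"
  have "x \<otimes> y \<otimes> z \<in> I" if "z \<in> I" for z
  proof -
    have "x \<otimes> y \<otimes> z = x \<otimes> (y \<otimes> z)" using x y that i by (auto simp: colon_def intro!: m_assoc)
    thus ?thesis using x y that by (auto simp: colon_def)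
  qed
  thus "x \<otimes> y \<in> I \<oslash> I" using x y by (auto simp: colon_def)
qed

lemma module_colon_self: "group_in I \<Longrightarrow> module_over (I \<oslash> I) I"
  by (auto simp: module_over_def colon_def)

text \<open>
  An element of a product is a finite sum, so finitely many elements of one factor account for it.
  This is the source of all reductions to finitely generated ideals.
\<close>

lemma ideal_prod_finite:
  assumes "x \<in> A \<cdot> B"
  shows "\<exists>F\<subseteq>A. finite F \<and> x \<in> F \<cdot> B"
  using assms
proof induct
  case (prod i j)
  thus ?case by (intro exI[of _ "{i}"]) (auto intro: ideal_prod.prod)
next
  case (sum x y)
  then obtain F G where "F \<subseteq> A" "finite F" "x \<in> F \<cdot> B" "G \<subseteq> A" "finite G" "y \<in> G \<cdot> B" by blast
  moreover have "F \<cdot> B \<subseteq> (F \<union> G) \<cdot> B" "G \<cdot> B \<subseteq> (F \<union> G) \<cdot> B" by (intro ideal_prod_mono; auto)+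
  ultimately show ?case by (intro exI[of _ "F \<union> G"]) (auto intro: ideal_prod.sum)
qed

lemma ideal_prod_insert:
  assumes A: "group_in A" and G: "G \<subseteq> carrier K" "G \<noteq> {}" "x \<in> carrier K" and y: "y \<in> A \<cdot> insert x G"
  shows "\<exists>a\<in>A. \<exists>m\<in>A \<cdot> G. y = a \<otimes> x \<oplus> m"
  using y
proof induct
  note a = group_inD[OF A]
  note g = group_inD[OF ideal_prod_group_left[OF A G(1,2)]]
  case (prod i j)
  show ?case
  proof (cases "j = x")
    case True
    thus ?thesis using prod a g G by (intro bexI[of _ i] bexI[of _ \<zero>]) auto
  next
    case False
    hence ij: "i \<otimes> j \<in> A \<cdot> G" using prod False by (auto intro: ideal_prod.prod)
    hence "i \<otimes> j \<in> carrier K" using g(1) by blast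
    hence "i \<otimes> j = \<zero> \<otimes> x \<oplus> i \<otimes> j" using G(3) by (metis l_null l_zero)
    thus ?thesis using ij a(2) by (intro bexI[of _ \<zero>] bexI[of _ "i \<otimes> j"])
  qed
next
  note a = group_inD[OF A]
  note g = group_inD[OF ideal_prod_group_left[OF A G(1,2)]]
  case (sum u v)
  then obtain a m b n where *: "a \<in> A" "m \<in> A \<cdot> G" "u = a \<otimes> x \<oplus> m" "b \<in> A" "n \<in> A \<cdot> G" "v = b \<otimes> x \<oplus> n"
    by (elim bexE) auto
  hence c: "a \<in> carrier K" "b \<in> carrier K" "m \<in> carrier K" "n \<in> carrier K" using a g by auto
  have "u \<oplus> v = (a \<oplus> b) \<otimes> x \<oplus> (m \<oplus> n)"
    unfolding *(3,6) using c G(3) by (simp add: l_distr a_ac)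
  thus ?case using * a(3) g(3) by (intro bexI[of _ "a \<oplus> b"] bexI[of _ "m \<oplus> n"])
qed

lemma ideal_prod_singleton:
  assumes A: "group_in A" and x: "x \<in> carrier K" and y: "y \<in> A \<cdot> {x}"
  shows "\<exists>a\<in>A. y = a \<otimes> x"
  using y
proof induct
  case (prod i j) thus ?case by auto
next
  case (sum u v)
  then obtain a b where *: "a \<in> A" "b \<in> A" "u = a \<otimes> x" "v = b \<otimes> x" by (elim bexE) auto
  hence "a \<in> carrier K" "b \<in> carrier K" using group_inD(1)[OF A] by auto
  hence "u \<oplus> v = (a \<oplus> b) \<otimes> x" unfolding *(3,4) using x by (simp add: l_distr)
  thus ?case using * group_inD(3)[OF A] by (intro bexI[of _ "a \<oplus> b"])
qed

end

section \<open>Nakayama's lemma\<close>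

context ambient_field
begin

lemma one_minus_mult:
  assumes E: "subring E K" and T: "module_over E T" "T \<subseteq> E"
    and ab: "a \<in> E" "b \<in> E" "\<one> \<ominus> a \<in> T" "\<one> \<ominus> b \<in> T"
  shows "\<one> \<ominus> a \<otimes> b \<in> T"
proof -
  have "a \<in> carrier K" "b \<in> carrier K" using ab subringE(1)[OF E] by auto
  hence "\<one> \<ominus> a \<otimes> b = (\<one> \<ominus> a) \<oplus> a \<otimes> (\<one> \<ominus> b)" by algebra
  thus ?thesis using ab module_overD[OF T(1)] by simp
qed

lemma annihilates_prod:
  assumes u: "u \<in> carrier K" and T: "T \<subseteq> carrier K" and G: "G \<subseteq> carrier K"
    and k: "\<And>g. g \<in> G \<Longrightarrow> u \<otimes> g = \<zero>" and y: "y \<in> T \<cdot> G"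
  shows "u \<otimes> y = \<zero>"
  using y
proof induct
  case (prod i j)
  hence "i \<in> carrier K" "j \<in> carrier K" using T G by auto
  hence "u \<otimes> (i \<otimes> j) = i \<otimes> (u \<otimes> j)" using u by (simp add: m_lcomm)
  thus ?case using k[OF prod(2)] \<open>i \<in> carrier K\<close> by simp
next
  case (sum a b)
  hence "a \<in> carrier K" "b \<in> carrier K" using ideal_prod_subset_carrier[OF T G] by auto
  thus ?case using sum u by (simp add: r_distr)
qed

text \<open>
  The determinant trick without determinants: solving the relation for one generator \<open>x\<close> at a
  time only multiplies the current scalar \<open>s\<close> by another element of \<open>1 + T\<close>. The zero element is
  inserted so that the module generated by no elements is \<open>{0}\<close> rather than empty.
\<close>

lemma nakayama_annihilator:
  assumes E: "subring E K" and T: "module_over E T" "T \<subseteq> E"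
    and "finite F" "F \<subseteq> carrier K" "s \<in> E" "\<one> \<ominus> s \<in> T" "\<forall>f\<in>F. s \<otimes> f \<in> T \<cdot> insert \<zero> F"
  shows "\<exists>u\<in>E. \<one> \<ominus> u \<in> T \<and> (\<forall>f\<in>F. u \<otimes> f = \<zero>)"
  using assms(4-)
proof (induction F arbitrary: s rule: finite_induct)
  case empty
  thus ?case by (intro bexI[of _ s]) auto
next
  case (insert x F)
  note Ec = subringE[OF E] and t = module_overD[OF T(1)]
  let ?G = "insert \<zero> F"
  have G: "?G \<subseteq> carrier K" "?G \<noteq> {}" and x: "x \<in> carrier K" using insert by auto
  note L = module_overD[OF module_prod[OF T(1) G Ec(1)]]
  have split: "\<exists>a\<in>T. \<exists>m\<in>T \<cdot> ?G. s \<otimes> f = a \<otimes> x \<oplus> m" if "f \<in> insert x F" for f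
  proof -
    have "insert \<zero> (insert x F) = insert x ?G" by auto
    hence "s \<otimes> f \<in> T \<cdot> insert x ?G" using insert.prems(4) that by auto
    thus ?thesis by (rule ideal_prod_insert[OF t(1) G x])
  qed
  obtain a m where am: "a \<in> T" "m \<in> T \<cdot> ?G" "s \<otimes> x = a \<otimes> x \<oplus> m" using split[of x] by auto
  \<comment> \<open>The relation for \<open>x\<close> turns into \<open>rx = m\<close>, where \<open>m\<close> no longer involves \<open>x\<close>.\<close>
  define r where "r = s \<ominus> a"
  have aE: "a \<in> E" using am T by auto
  have c: "a \<in> carrier K" "s \<in> carrier K" "m \<in> carrier K"
    using aE insert.prems Ec(1) am L by auto
  have rE: "r \<in> E" unfolding r_def a_minus_def using Ec aE insert.prems by auto
  have rx: "r \<otimes> x = m"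
  proof -
    have "r \<otimes> x = s \<otimes> x \<ominus> a \<otimes> x" unfolding r_def using c x by algebra
    also have "\<dots> = m" unfolding am(3) using c x by algebra
    finally show ?thesis .
  qed
  have r1: "\<one> \<ominus> r \<in> T"
  proof -
    have "\<one> \<ominus> r = (\<one> \<ominus> s) \<oplus> a" unfolding r_def using c by algebra
    thus ?thesis using insert.prems t am by simp
  qed
  have rc: "r \<in> carrier K" using rE Ec by auto
  have rs1: "\<one> \<ominus> r \<otimes> s \<in> T" by (rule one_minus_mult[OF E T rE insert.prems(2) r1 insert.prems(3)])
  have "\<forall>f\<in>F. r \<otimes> s \<otimes> f \<in> T \<cdot> ?G"
  proof
    fix f assume f: "f \<in> F"
    then obtain b n where bn: "b \<in> T" "n \<in> T \<cdot> ?G" "s \<otimes> f = b \<otimes> x \<oplus> n" using split[of f] by auto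
    have c': "b \<in> carrier K" "n \<in> carrier K" "f \<in> carrier K" using bn t L f insert.prems by auto
    have "r \<otimes> s \<otimes> f = r \<otimes> (s \<otimes> f)" using c c' rc by (simp add: m_assoc)
    also have "\<dots> = b \<otimes> (r \<otimes> x) \<oplus> r \<otimes> n" unfolding bn(3) using c c' rc x by algebra
    also have "\<dots> = b \<otimes> m \<oplus> r \<otimes> n" by (simp add: rx)
    finally show "r \<otimes> s \<otimes> f \<in> T \<cdot> ?G" using L(4,7) bn am rE T(2) by auto
  qed
  then obtain u where u: "u \<in> E" "\<one> \<ominus> u \<in> T" "\<forall>f\<in>F. u \<otimes> f = \<zero>"
    using insert.IH[of "r \<otimes> s"] rs1 insert.prems Ec rE by auto
  have uc: "u \<in> carrier K" using u Ec by auto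
  have um: "u \<otimes> m = \<zero>"
    by (rule annihilates_prod[OF uc t(2) G(1) _ am(2)]) (use u uc in auto)
  have "\<forall>f\<in>insert x F. u \<otimes> r \<otimes> f = \<zero>"
  proof
    fix f assume f: "f \<in> insert x F"
    hence fc: "f \<in> carrier K" using insert.prems by auto
    have 1: "u \<otimes> r \<otimes> f = u \<otimes> (r \<otimes> f)" "u \<otimes> r \<otimes> f = r \<otimes> (u \<otimes> f)"
      using uc rc fc by algebra+
    show "u \<otimes> r \<otimes> f = \<zero>"
    proof (cases "f = x")
      case True thus ?thesis using 1(1) rx um by simp
    next
      case False thus ?thesis using 1(2) f u rc by auto
    qed
  qed
  thus ?case using one_minus_mult[OF E T u(1) rE u(2) r1] Ec(6)[OF u(1) rE] by blast
qed

text \<open>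
  An element of \<open>1 + T\<close> that annihilates a nonzero element of a field is zero.
\<close>

lemma nakayama:
  assumes E: "subring E K" and T: "module_over E T" "T \<subseteq> E"
    and G: "finite G" "G \<subseteq> carrier K" "g \<in> G" "g \<noteq> \<zero>" "G \<subseteq> T \<cdot> G"
  shows "\<one> \<in> T"
proof -
  note Ec = subringE[OF E]
  have "T \<cdot> G \<subseteq> T \<cdot> insert \<zero> G" by (rule ideal_prod_mono) auto
  hence "\<forall>f\<in>G. \<one> \<otimes> f \<in> T \<cdot> insert \<zero> G" using G(2,5) by (metis l_one subsetD)
  moreover have "\<one> \<ominus> \<one> \<in> T" using module_overD(3)[OF T(1)] by (simp add: r_neg a_minus_def)
  ultimately obtain u where u: "u \<in> E" "\<one> \<ominus> u \<in> T" "\<forall>f\<in>G. u \<otimes> f = \<zero>"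
    using nakayama_annihilator[OF E T G(1,2) Ec(3)] by blast
  have "u = \<zero>" using u G Ec(1) integral[of u g] by auto
  thus ?thesis using u(2) by (simp add: a_minus_def)
qed

section \<open>Prime ideals and dimension\<close>

definition prime_in :: "'a set \<Rightarrow> 'a set \<Rightarrow> bool" where
  "prime_in E P \<longleftrightarrow> module_over E P \<and> P \<subseteq> E \<and> \<one> \<notin> P \<and>
     (\<forall>a\<in>E. \<forall>b\<in>E. a \<otimes> b \<in> P \<longrightarrow> a \<in> P \<or> b \<in> P)"

lemma prime_inD:
  assumes "prime_in E P"
  shows "module_over E P" "P \<subseteq> E" "\<one> \<notin> P"
    "\<And>a b. a \<in> E \<Longrightarrow> b \<in> E \<Longrightarrow> a \<otimes> b \<in> P \<Longrightarrow> a \<in> P \<or> b \<in> P"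
  using assms by (auto simp: prime_in_def)

text \<open>
  Krull dimension at most one: a chain of three primes has a proper inclusion between its two
  upper members, which are nonzero.
\<close>

definition dimension_le_one :: "'a set \<Rightarrow> bool" where
  "dimension_le_one E \<longleftrightarrow>
     (\<forall>P N. prime_in E P \<and> prime_in E N \<and> P \<noteq> {\<zero>} \<and> P \<subseteq> N \<longrightarrow> P = N)"

lemma module_over_Union_chain:
  assumes E: "subring E K" and C: "C \<noteq> {}" "\<And>A. A \<in> C \<Longrightarrow> module_over E A"
    and ch: "\<And>A B. A \<in> C \<Longrightarrow> B \<in> C \<Longrightarrow> A \<subseteq> B \<or> B \<subseteq> A"
  shows "module_over E (\<Union>C)"
proof (rule module_overI)
  show "\<Union>C \<subseteq> carrier K" using module_overD(2)[OF C(2)] by blast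
  show "\<zero> \<in> \<Union>C" using C module_overD(3)[OF C(2)] by blast
  show "x \<oplus> y \<in> \<Union>C" if xy: "x \<in> \<Union>C" "y \<in> \<Union>C" for x y
  proof -
    obtain A B where AB: "A \<in> C" "B \<in> C" "x \<in> A" "y \<in> B" using xy by auto
    obtain D where "D \<in> C" "x \<in> D" "y \<in> D" using ch[OF AB(1,2)] AB by blast
    thus ?thesis using module_overD(4)[OF C(2)[of D]] by auto
  qed
  show "\<And>x e. x \<in> \<Union>C \<Longrightarrow> e \<in> E \<Longrightarrow> e \<otimes> x \<in> \<Union>C" using module_overD(7)[OF C(2)] by blast
qed (rule E)

definition adjoin :: "'a set \<Rightarrow> 'a set \<Rightarrow> 'a \<Rightarrow> 'a set" where
  "adjoin E P a = {p \<oplus> e \<otimes> a | p e. p \<in> P \<and> e \<in> E}"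

lemma module_adjoin:
  assumes E: "subring E K" and P: "module_over E P" and a: "a \<in> carrier K"
  shows "module_over E (adjoin E P a)" "P \<subseteq> adjoin E P a" "a \<in> adjoin E P a"
proof -
  note e = subringE[OF E] and p = module_overD[OF P]
  have I: "p \<oplus> e \<otimes> a \<in> adjoin E P a" if "p \<in> P" "e \<in> E" for p e using that by (auto simp: adjoin_def)
  show P': "P \<subseteq> adjoin E P a"
  proof
    fix x assume x: "x \<in> P"
    hence "x = x \<oplus> \<zero> \<otimes> a" using a p by auto
    thus "x \<in> adjoin E P a" using I[OF x e(2)] by simp
  qed
  have "a = \<zero> \<oplus> \<one> \<otimes> a" using a by simp
  thus "a \<in> adjoin E P a" using I[OF p(3) e(3)] by simp
  show "module_over E (adjoin E P a)"
  proof (rule module_overI)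
    show "adjoin E P a \<subseteq> carrier K" using e p a by (auto simp: adjoin_def subset_iff)
    show "\<zero> \<in> adjoin E P a" using P' p by auto
    fix x assume "x \<in> adjoin E P a"
    then obtain q c where x: "x = q \<oplus> c \<otimes> a" "q \<in> P" "c \<in> E" by (auto simp: adjoin_def)
    hence xc: "q \<in> carrier K" "c \<in> carrier K" using e p by auto
    { fix y assume "y \<in> adjoin E P a"
      then obtain r d where y: "y = r \<oplus> d \<otimes> a" "r \<in> P" "d \<in> E" by (auto simp: adjoin_def)
      hence yc: "r \<in> carrier K" "d \<in> carrier K" using e p by auto
      have "x \<oplus> y = (q \<oplus> r) \<oplus> (c \<oplus> d) \<otimes> a"
        unfolding x y using xc yc a by algebra
      thus "x \<oplus> y \<in> adjoin E P a" using I[of "q \<oplus> r" "c \<oplus> d"] x y e p by auto }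
    { fix d assume d: "d \<in> E"
      hence dc: "d \<in> carrier K" using e by auto
      have "d \<otimes> x = d \<otimes> q \<oplus> (d \<otimes> c) \<otimes> a" unfolding x using xc dc a by algebra
      thus "d \<otimes> x \<in> adjoin E P a" using I[of "d \<otimes> q" "d \<otimes> c"] x d e p by auto }
  qed (rule E)
qed

lemma adjoin_subset: "subring E K \<Longrightarrow> P \<subseteq> M \<Longrightarrow> module_over E M \<Longrightarrow> a \<in> M \<Longrightarrow> adjoin E P a \<subseteq> M"
  unfolding adjoin_def by (auto intro!: module_overD(4) module_overD(7))

text \<open>
  A submodule of \<open>E\<close> that is maximal among those containing \<open>W\<close> and missing \<open>S\<close> is prime: two larger
  ones would both meet \<open>S\<close>, and the product of the two elements found there would lie in \<open>P\<close>.
\<close>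

lemma exists_prime_avoiding:
  assumes E: "subring E K" and W: "module_over E W" "W \<subseteq> E"
    and S: "S \<subseteq> E" "\<one> \<in> S" "\<And>s t. s \<in> S \<Longrightarrow> t \<in> S \<Longrightarrow> s \<otimes> t \<in> S" "S \<inter> W = {}"
  shows "\<exists>P. prime_in E P \<and> W \<subseteq> P \<and> P \<inter> S = {}"
proof -
  note e = subringE[OF E]
  define F where "F = {A. module_over E A \<and> W \<subseteq> A \<and> A \<subseteq> E \<and> A \<inter> S = {}}"
  have "\<exists>M\<in>F. \<forall>B\<in>F. M \<subseteq> B \<longrightarrow> B = M"
  proof (rule subset_Zorn_nonempty)
    have "W \<in> F" using W S(4) by (auto simp: F_def)
    thus "F \<noteq> {}" by blast
    fix C assume C: "C \<noteq> {}" "subset.chain F C"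
    hence CF: "C \<subseteq> F" by (auto simp: subset.chain_def)
    have "module_over E (\<Union>C)"
      by (rule module_over_Union_chain[OF E C(1)]) (use CF C(2) in \<open>auto simp: F_def subset_chain_def\<close>)
    thus "\<Union>C \<in> F" using CF C(1) unfolding F_def by blast
  qed
  then obtain P where P: "P \<in> F" and max: "\<And>B. B \<in> F \<Longrightarrow> P \<subseteq> B \<Longrightarrow> B = P" by blast
  have Pm: "module_over E P" "W \<subseteq> P" "P \<subseteq> E" "P \<inter> S = {}" using P by (auto simp: F_def)
  note p = module_overD[OF Pm(1)]
  have meets: "\<exists>q\<in>P. \<exists>c\<in>E. q \<oplus> c \<otimes> a \<in> S" if a: "a \<in> E" "a \<notin> P" for a
  proof (rule ccontr)
    assume n: "\<not> ?thesis"
    have ac: "a \<in> carrier K" using a e by auto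
    note ad = module_adjoin[OF E Pm(1) ac]
    have "adjoin E P a \<subseteq> E" by (rule adjoin_subset[OF E Pm(3) subring_module[OF E] a(1)]) auto
    moreover have "adjoin E P a \<inter> S = {}" using n by (auto simp: adjoin_def)
    ultimately have "adjoin E P a \<in> F" using ad Pm by (auto simp: F_def)
    hence "adjoin E P a = P" using max ad by blast
    thus False using ad a by blast
  qed
  have "a \<in> P \<or> b \<in> P" if ab: "a \<in> E" "b \<in> E" "a \<otimes> b \<in> P" for a b
  proof (rule ccontr)
    assume "\<not> ?thesis"
    then obtain q c r d where q: "q \<in> P" "c \<in> E" "q \<oplus> c \<otimes> a \<in> S"
      and r: "r \<in> P" "d \<in> E" "r \<oplus> d \<otimes> b \<in> S" using meets ab by blast
    have cc: "q \<in> carrier K" "c \<in> carrier K" "r \<in> carrier K" "d \<in> carrier K" "a \<in> carrier K" "b \<in> carrier K"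
      using q(1,2) r(1,2) ab e(1) p(2) by auto
    have "(q \<oplus> c \<otimes> a) \<otimes> (r \<oplus> d \<otimes> b) =
      ((r \<oplus> d \<otimes> b) \<otimes> q \<oplus> (c \<otimes> a) \<otimes> r) \<oplus> (c \<otimes> d) \<otimes> (a \<otimes> b)" using cc by algebra
    also have "\<dots> \<in> P"
    proof -
      have "r \<oplus> d \<otimes> b \<in> E" "c \<otimes> a \<in> E" "c \<otimes> d \<in> E" using q(2,3) r(2,3) ab S(1) e(6) by auto
      hence "(r \<oplus> d \<otimes> b) \<otimes> q \<in> P" "(c \<otimes> a) \<otimes> r \<in> P" "(c \<otimes> d) \<otimes> (a \<otimes> b) \<in> P"
        using q(1) r(1) ab(3) p(7) by blast+
      thus ?thesis using p(4) by blast
    qed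
    finally show False using S(3)[OF q(3) r(3)] Pm(4) by blast
  qed
  hence "prime_in E P" unfolding prime_in_def using Pm S(2) by blast
  thus ?thesis using Pm by blast
qed

lemma exists_prime:
  assumes E: "subring E K" and W: "module_over E W" "W \<subseteq> E" "\<one> \<notin> W"
  shows "\<exists>P. prime_in E P \<and> W \<subseteq> P"
  using exists_prime_avoiding[OF E W(1,2), of "{\<one>}"] subringE(3)[OF E] W(3) by auto

text \<open>
  In dimension one a nonzero prime \<open>P\<close> is maximal, since \<open>P + Ex\<close> would otherwise lie in a
  strictly larger prime.
\<close>

lemma inverse_modulo_prime:
  assumes E: "subring E K" "dimension_le_one E" and P: "prime_in E P" "P \<noteq> {\<zero>}"
    and x: "x \<in> E" "x \<notin> P"
  shows "\<exists>y\<in>E. \<one> \<ominus> x \<otimes> y \<in> P"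
proof -
  note e = subringE[OF E(1)] and p = prime_inD[OF P(1)]
  have xc: "x \<in> carrier K" using x e(1) by auto
  note ad = module_adjoin[OF E(1) p(1) xc]
  have sub: "adjoin E P x \<subseteq> E" by (rule adjoin_subset[OF E(1) p(2) subring_module[OF E(1)] x(1)]) auto
  have "\<one> \<in> adjoin E P x"
  proof (rule ccontr)
    assume "\<one> \<notin> adjoin E P x"
    then obtain N where N: "prime_in E N" "adjoin E P x \<subseteq> N"
      using exists_prime[OF E(1) ad(1) sub] by blast
    hence "P = N" using E(2) P ad(2) unfolding dimension_le_one_def by blast
    thus False using N(2) ad(3) x by blast
  qed
  then obtain q y where q: "\<one> = q \<oplus> y \<otimes> x" "q \<in> P" "y \<in> E" by (auto simp: adjoin_def)
  have c: "q \<in> carrier K" "y \<in> carrier K" using q(2,3) p(2) e(1) by auto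
  have "\<one> \<ominus> x \<otimes> y = q" unfolding q(1) using c xc by algebra
  thus ?thesis using q(2,3) by metis
qed

lemma prime_in_power:
  assumes E: "subring E K" and P: "prime_in E P" and x: "x \<in> E" "x \<notin> P"
  shows "x [^] (n::nat) \<in> E \<and> x [^] n \<notin> P"
proof (induction n)
  case 0
  thus ?case using subringE(3)[OF E] prime_inD(3)[OF P] by simp
next
  case (Suc n)
  thus ?case using subringE(6)[OF E] prime_inD(4)[OF P] x by auto
qed

lemma subring_power:
  assumes "subring E K" "x \<in> E" shows "x [^] (n::nat) \<in> E"
  by (induction n) (use subringE[OF assms(1)] assms(2) in auto)

section \<open>Invertible modules that are rings\<close>

text \<open>
  Were \<open>I\<close> not contained in \<open>E\<close>, its inverse \<open>J = (E:I)\<close> would be a proper ideal,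
  inside a prime \<open>N\<close>. Invertibility provides \<open>x \<in> I\<close> and \<open>y \<in> J\<close> with \<open>xy \<notin> N\<close>. As \<open>W\<close> is closed under
  multiplication by \<open>x\<close>, no \<open>sy\<^sup>k\<close> with \<open>s \<notin> N\<close> can lie in \<open>W\<close>: otherwise \<open>s(xy)\<^sup>k \<in> W \<subseteq> J \<subseteq> N\<close>. So
  there is a prime between \<open>W\<close> and \<open>N\<close> without \<open>y\<close>, against dimension one. Typically \<open>W\<close> is the
  conductor into \<open>E\<close> of a ring containing \<open>I\<close>.
\<close>

lemma invertible_module_is_ring:
  assumes E: "subring E K" "dimension_le_one E"
    and I: "module_over E I" "\<one> \<in> I" "\<one> \<in> I \<cdot> (E \<oslash> I)"
    and W: "module_over E W" "W \<subseteq> E" "W \<noteq> {\<zero>}" "\<And>i w. i \<in> I \<Longrightarrow> w \<in> W \<Longrightarrow> w \<otimes> i \<in> W"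
  shows "I \<subseteq> E"
proof (rule ccontr)
  assume notsub: "\<not> I \<subseteq> E"
  note e = subringE[OF E(1)] and i = module_overD[OF I(1)] and w = module_overD[OF W(1)]
  define J where "J = E \<oslash> I"
  have J: "module_over E J" unfolding J_def
    by (rule module_colon[OF subring_module[OF E(1)] i(2) e(1)]) auto
  note j = module_overD[OF J]
  have JE: "J \<subseteq> E"
  proof
    fix x assume "x \<in> J"
    hence "x \<otimes> \<one> \<in> E" "x \<in> carrier K" using I(2) by (auto simp: J_def colon_def)
    thus "x \<in> E" by simp
  qed
  have "\<one> \<notin> J"
  proof
    assume "\<one> \<in> J"
    hence "\<one> \<otimes> x \<in> E" if "x \<in> I" for x using that by (auto simp: J_def colon_def)
    thus False using notsub i(2) by (metis l_one subset_iff)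
  qed
  then obtain N where N: "prime_in E N" "J \<subseteq> N" using exists_prime[OF E(1) J JE] by blast
  note n = prime_inD[OF N(1)]
  have WJ: "W \<subseteq> J" using W(2,4) w(2) by (auto simp: J_def colon_def)
  have "\<exists>x\<in>I. \<exists>y\<in>J. x \<otimes> y \<notin> N"
  proof (rule ccontr)
    assume "\<not> ?thesis"
    hence "I \<cdot> J \<subseteq> N" by (intro ideal_prod_le module_overD(1)[OF n(1)]) auto
    thus False using I(3) n(3) unfolding J_def by blast
  qed
  then obtain x y where xy: "x \<in> I" "y \<in> J" "x \<otimes> y \<notin> N" by blast
  have c: "x \<in> carrier K" "y \<in> carrier K" using xy(1,2) i(2) j(2) by auto
  have yE: "y \<in> E" using xy JE by auto
  have xyE: "x \<otimes> y \<in> E"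
  proof -
    have "y \<otimes> x \<in> E" using xy unfolding J_def colon_def by blast
    thus ?thesis using c by (simp add: m_comm)
  qed
  define S where "S = {s \<otimes> y [^] (k::nat) | s k. s \<in> E \<and> s \<notin> N}"
  have SI: "s \<otimes> y [^] (k::nat) \<in> S" if "s \<in> E" "s \<notin> N" for s k using that by (auto simp: S_def)
  have NS: "s \<in> S" if "s \<in> E" "s \<notin> N" for s
  proof -
    have "s \<in> carrier K" using that e(1) by auto
    thus ?thesis using SI[OF that, of 0] by simp
  qed
  have "\<exists>P. prime_in E P \<and> W \<subseteq> P \<and> P \<inter> S = {}"
  proof (rule exists_prime_avoiding[OF E(1) W(1,2)])
    show "S \<subseteq> E" using e(6) subring_power[OF E(1) yE] by (auto simp: S_def)
    show "\<one> \<in> S" using NS[OF e(3) n(3)] .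
    fix s t assume "s \<in> S" "t \<in> S"
    then obtain a b and k l :: nat where *: "s = a \<otimes> y [^] k" "a \<in> E" "a \<notin> N" "t = b \<otimes> y [^] l" "b \<in> E" "b \<notin> N"
      by (auto simp: S_def)
    have cc: "a \<in> carrier K" "b \<in> carrier K" using *(2,5) e(1) by auto
    have "s \<otimes> t = (a \<otimes> b) \<otimes> (y [^] k \<otimes> y [^] l)"
      unfolding *(1,4) using cc c nat_pow_closed[OF c(2)] by (simp add: m_assoc m_lcomm)
    also have "\<dots> = (a \<otimes> b) \<otimes> y [^] (k + l)" using c by (simp add: nat_pow_mult)
    moreover have "a \<otimes> b \<in> E" "a \<otimes> b \<notin> N" using e(6) n(4) *(2,3,5,6) by blast+
    ultimately show "s \<otimes> t \<in> S" using SI[of "a \<otimes> b" "k + l"] by simp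
  next
    show "S \<inter> W = {}"
    proof (rule ccontr)
      assume "S \<inter> W \<noteq> {}"
      then obtain s and k :: nat where s: "s \<in> E" "s \<notin> N" "s \<otimes> y [^] k \<in> W" by (auto simp: S_def)
      have sc: "s \<in> carrier K" using s(1) e(1) by auto
      have "s \<otimes> y [^] k \<otimes> x [^] (l::nat) \<in> W" for l
      proof (induction l)
        case 0 thus ?case using s w(2) by (auto simp: subset_iff)
      next
        case (Suc l)
        have "s \<otimes> y [^] k \<otimes> x [^] Suc l = s \<otimes> y [^] k \<otimes> x [^] l \<otimes> x"
          using sc c by (simp add: m_assoc)
        thus ?case using W(4)[OF xy(1) Suc] by simp
      qed
      hence "s \<otimes> y [^] k \<otimes> x [^] k \<in> N" using WJ N(2) by blast
      moreover have "s \<otimes> y [^] k \<otimes> x [^] k = s \<otimes> (x \<otimes> y) [^] k"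
        using sc c by (simp add: m_ac nat_pow_distrib)
      ultimately show False
        using n(4)[OF s(1), of "(x \<otimes> y) [^] k"] s prime_in_power[OF E(1) N(1) xyE xy(3), of k] by auto
    qed
  qed
  then obtain P where P: "prime_in E P" "W \<subseteq> P" "P \<inter> S = {}" by blast
  have "P \<subseteq> N" using NS P prime_inD(2)[OF P(1)] by blast
  moreover have "P \<noteq> {\<zero>}" using P(2) W(3) w(3) by blast
  ultimately have "P = N" using E(2) P(1) N(1) unfolding dimension_le_one_def by blast
  hence "y \<in> P" using xy N by auto
  moreover have "y \<in> S" using SI[OF e(3) n(3), of 1] c by simp
  ultimately show False using P(3) by blast
qed

section \<open>Quadratic extensions\<close>

definition quadratic_over :: "'a set \<Rightarrow> 'a set \<Rightarrow> bool" where
  "quadratic_over A E \<longleftrightarrow> (\<forall>y\<in>E. \<exists>a\<in>A. \<exists>b\<in>A. y \<otimes> y = a \<otimes> y \<oplus> b)"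

lemma quadratic_overD:
  "quadratic_over A E \<Longrightarrow> y \<in> E \<Longrightarrow> \<exists>a\<in>A. \<exists>b\<in>A. y \<otimes> y = a \<otimes> y \<oplus> b"
  by (simp add: quadratic_over_def)

lemma prime_in_contract:
  assumes A: "subring A K" "A \<subseteq> E" and P: "prime_in E P" and E: "E \<subseteq> carrier K"
  shows "prime_in A (P \<inter> A)"
proof -
  note a = subringE[OF A(1)] and p = prime_inD[OF P] and m = module_overD[OF prime_inD(1)[OF P]]
  have "module_over A (P \<inter> A)"
    by (rule module_overI[OF _ _ _ _ A(1)]) (use a m A in auto)
  thus ?thesis unfolding prime_in_def using p(3,4) A(2) by blast
qed

text \<open>
  The equation \<open>p\<^sup>2 = sp + r\<close> gives \<open>r = p(p - s) \<in> P\<close>; and if \<open>r = 0\<close>, then \<open>p = s\<close> is itself in \<open>A\<close>.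
\<close>

lemma contract_nonzero:
  assumes A: "subring A K" "A \<subseteq> E" and q: "quadratic_over A E" and E: "subring E K"
    and P: "module_over E P" "P \<subseteq> E" "P \<noteq> {\<zero>}"
  shows "P \<inter> A \<noteq> {\<zero>}"
proof -
  note a = subringE[OF A(1)] and m = module_overD[OF P(1)] and e = subringE[OF E]
  obtain p where p: "p \<in> P" "p \<noteq> \<zero>" using P m by blast
  then obtain s r where sr: "s \<in> A" "r \<in> A" "p \<otimes> p = s \<otimes> p \<oplus> r" using quadratic_overD[OF q] P(2) by blast
  have c: "p \<in> carrier K" "s \<in> carrier K" "r \<in> carrier K" using p(1) sr(1,2) a(1) m(2) by auto
  have "p \<otimes> (p \<ominus> s) = p \<otimes> p \<ominus> s \<otimes> p" using c by algebra
  also have "\<dots> = r" unfolding sr(3) using c by algebra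
  finally have r: "r = p \<otimes> (p \<ominus> s)" by simp
  have "p \<ominus> s \<in> E" using p(1) sr(1) A(2) P(2) group_inD(5)[OF subring_group_in[OF E]] by blast
  hence rP: "r \<in> P \<inter> A" unfolding r using m(8)[OF _ p(1) e(1)] sr(2) r by auto
  show ?thesis
  proof (cases "r = \<zero>")
    case True
    hence "p \<ominus> s = \<zero>" using r integral[of p "p \<ominus> s"] c p(2) by auto
    hence "p = s" using c by simp
    thus ?thesis using p sr(1) by auto
  next
    case False
    thus ?thesis using rP by auto
  qed
qed

text \<open>
  Incomparability for quadratic extensions: primes \<open>P \<subseteq> N\<close> contract to the same prime of \<open>A\<close>. For
  \<open>y \<in> N\<close> with \<open>y\<^sup>2 = sy + r\<close>, the element \<open>r = y(y - s)\<close> is in \<open>N \<inter> A = P \<inter> A\<close>, so \<open>y\<close> or \<open>y - s\<close> is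
  in \<open>P\<close>; in the second case \<open>s \<in> N \<inter> A = P \<inter> A\<close> and again \<open>y \<in> P\<close>.
\<close>

lemma quadratic_dimension:
  assumes A: "subring A K" "A \<subseteq> E" "dimension_le_one A" and q: "quadratic_over A E" and E: "subring E K"
  shows "dimension_le_one E"
  unfolding dimension_le_one_def
proof (intro allI impI)
  fix P N assume *: "prime_in E P \<and> prime_in E N \<and> P \<noteq> {\<zero>} \<and> P \<subseteq> N"
  note a = subringE[OF A(1)] and e = subringE[OF E]
  have PN: "prime_in E P" "prime_in E N" "P \<noteq> {\<zero>}" "P \<subseteq> N" using * by auto
  note p = prime_inD[OF PN(1)] module_overD[OF prime_inD(1)[OF PN(1)]]
  note n = prime_inD[OF PN(2)] module_overD[OF prime_inD(1)[OF PN(2)]]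
  have eq: "P \<inter> A = N \<inter> A"
    using A(3) prime_in_contract[OF A(1,2) PN(1) e(1)] prime_in_contract[OF A(1,2) PN(2) e(1)]
      contract_nonzero[OF A(1,2) q E p(1,2) PN(3)] PN(4) unfolding dimension_le_one_def by blast
  have "N \<subseteq> P"
  proof
    fix y assume y: "y \<in> N"
    then obtain s r where sr: "s \<in> A" "r \<in> A" "y \<otimes> y = s \<otimes> y \<oplus> r" using quadratic_overD[OF q] n(2) by blast
    have yE: "y \<in> E" "s \<in> E" using y n(2) sr(1) A(2) by auto
    have c: "y \<in> carrier K" "s \<in> carrier K" "r \<in> carrier K" using yE sr(2) a(1) e(1) by auto
    have "y \<otimes> (y \<ominus> s) = y \<otimes> y \<ominus> s \<otimes> y" using c by algebra
    also have "\<dots> = r" unfolding sr(3) using c by algebra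
    finally have r: "y \<otimes> (y \<ominus> s) = r" .
    have ys: "y \<ominus> s \<in> E" using yE group_inD(5)[OF subring_group_in[OF E]] by blast
    hence "r \<in> N" using r n(12)[OF ys y e(1)] by simp
    hence "y \<otimes> (y \<ominus> s) \<in> P" using eq sr(2) r by auto
    hence "y \<in> P \<or> y \<ominus> s \<in> P" using p(4)[OF yE(1) ys] by blast
    thus "y \<in> P"
    proof
      assume ysP: "y \<ominus> s \<in> P"
      have "y \<ominus> (y \<ominus> s) = s" using c by algebra
      hence "s \<in> N" using n(10)[OF y] ysP PN(4) by (metis subsetD)
      hence "s \<in> P" using eq sr(1) by auto
      moreover have "y = (y \<ominus> s) \<oplus> s" using c by algebra
      ultimately show "y \<in> P" using p(8)[OF ysP] by metis
    qed
  qed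
  thus "P = N" using PN by blast
qed

end

section \<open>Divisorial ideals in a Mori domain\<close>

context ambient_field
begin

lemma ideal_iff_module_over:
  assumes E: "subring E K"
  shows "ideal I (K\<lparr>carrier := E\<rparr>) \<longleftrightarrow> module_over E I \<and> I \<subseteq> E"
proof
  let ?S = "K\<lparr>carrier := E\<rparr>"
  assume I: "ideal I ?S"
  interpret J: ideal I ?S by (rule I)
  have sub: "I \<subseteq> E" using J.a_subset by simp
  have "module_over E I"
  proof (rule module_overI)
    show "I \<subseteq> carrier K" using sub subringE(1)[OF E] by blast
    show "\<zero> \<in> I" using additive_subgroup.zero_closed[OF ideal.axioms(1)[OF I]] by simp
    show "x \<oplus> y \<in> I" if "x \<in> I" "y \<in> I" for x y using additive_subgroup.a_closed[OF ideal.axioms(1)[OF I] that] by simp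
    show "e \<otimes> x \<in> I" if "x \<in> I" "e \<in> E" for x e using J.I_l_closed[of x e] that by simp
  qed (rule E)
  thus "module_over E I \<and> I \<subseteq> E" using sub by blast
next
  let ?S = "K\<lparr>carrier := E\<rparr>"
  assume I: "module_over E I \<and> I \<subseteq> E"
  note i = module_overD[OF conjunct1[OF I]] and e = subringE[OF E]
  interpret S: ring ?S by (rule subring_is_ring[OF E])
  show "ideal I ?S"
  proof (rule idealI[OF S.ring_axioms])
    show "subgroup I (add_monoid ?S)"
    proof (rule S.add.subgroupI)
      show "I \<subseteq> carrier ?S" using I by simp
      show "I \<noteq> {}" using i(3) by blast
      show "a \<oplus>\<^bsub>?S\<^esub> b \<in> I" if "a \<in> I" "b \<in> I" for a b using i(4)[OF that] by simp
      show "\<ominus>\<^bsub>?S\<^esub> a \<in> I" if a: "a \<in> I" for a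
      proof -
        have aE: "a \<in> carrier ?S" using a I by auto
        have "\<ominus>\<^bsub>?S\<^esub> a = (\<ominus>\<^bsub>?S\<^esub> \<one>\<^bsub>?S\<^esub>) \<otimes>\<^bsub>?S\<^esub> a" using aE by (simp only: S.l_minus S.one_closed S.l_one)
        moreover have "\<ominus>\<^bsub>?S\<^esub> \<one>\<^bsub>?S\<^esub> \<in> E" using S.a_inv_closed[OF S.one_closed] by simp
        ultimately show ?thesis using i(7)[OF _ a] by simp
      qed
    qed
    show "x \<otimes>\<^bsub>?S\<^esub> a \<in> I" if "a \<in> I" "x \<in> carrier ?S" for a x using i(7)[of x a] that by simp
    show "a \<otimes>\<^bsub>?S\<^esub> x \<in> I" if "a \<in> I" "x \<in> carrier ?S" for a x using i(8)[of x a] that e(1) by simp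
  qed
qed

lemma primeideal_iff_prime_in:
  assumes E: "subring E K"
  shows "primeideal P (K\<lparr>carrier := E\<rparr>) \<longleftrightarrow> prime_in E P"
proof
  note e = subringE[OF E]
  assume P: "primeideal P (K\<lparr>carrier := E\<rparr>)"
  interpret P: primeideal P "K\<lparr>carrier := E\<rparr>" by (rule P)
  have m: "module_over E P" "P \<subseteq> E" using ideal_iff_module_over[OF E] P.ideal_axioms by auto
  have "\<one> \<notin> P"
  proof
    assume one: "\<one> \<in> P"
    have "E \<subseteq> P" by (rule subset_module_if_one[OF m(1) one e(1)])
    thus False using P.I_notcarr m(2) by simp
  qed
  thus "prime_in E P" unfolding prime_in_def using m P.I_prime by simp
next
  note e = subringE[OF E]
  assume P: "prime_in E P"
  have "cring (K\<lparr>carrier := E\<rparr>)" using subcring_iff[OF e(1)] subcringI'[OF E] by simp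
  thus "primeideal P (K\<lparr>carrier := E\<rparr>)"
    by (intro primeidealI) (use prime_inD[OF P] e(3) ideal_iff_module_over[OF E] in auto)
qed

lemma le_residual_residual:
  assumes "G \<subseteq> carrier K" shows "G \<subseteq> E \<oslash> (E \<oslash> G)"
  using assms by (auto simp: colon_def m_comm subset_iff)

lemma residual_triple:
  assumes "G \<subseteq> carrier K" shows "E \<oslash> (E \<oslash> (E \<oslash> G)) = E \<oslash> G"
  using le_residual_residual[OF assms, of E] le_residual_residual[OF colon_subset[of E G], of E]
    colon_antimono[of G "E \<oslash> (E \<oslash> G)" E] by blast

text \<open>
  Otherwise elements can be added to a finite subset forever, each time shrinking \<open>(E:G)\<close>, and
  the divisorial closures \<open>(E:(E:G))\<close> form a strictly increasing chain. The element \<open>a\<close> keeps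
  these closures nonzero.
\<close>

lemma mori_finite_subset:
  assumes E: "subring E K" and M: "mori K E" and A: "A \<subseteq> E" "a \<in> A" "a \<noteq> \<zero>"
  shows "\<exists>G\<subseteq>A. finite G \<and> a \<in> G \<and> E \<oslash> G \<subseteq> E \<oslash> A"
proof (rule ccontr)
  assume neg: "\<not> ?thesis"
  note e = subringE[OF E]
  have Ac: "A \<subseteq> carrier K" using A e by blast
  have "\<exists>b\<in>A. \<exists>y\<in>E \<oslash> G. y \<otimes> b \<notin> E" if "G \<subseteq> A" "finite G" "a \<in> G" for G
    using neg that unfolding colon_def by blast
  then obtain f where f: "\<And>G. G \<subseteq> A \<Longrightarrow> finite G \<Longrightarrow> a \<in> G \<Longrightarrow> f G \<in> A \<and> (\<exists>y\<in>E \<oslash> G. y \<otimes> f G \<notin> E)"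
    by metis
  define G where "G = rec_nat {a} (\<lambda>_ H. insert (f H) H)"
  have G: "G n \<subseteq> A \<and> finite (G n) \<and> a \<in> G n" for n
    by (induction n) (use A f in \<open>auto simp: G_def\<close>)
  have GS: "G (Suc n) = insert (f (G n)) (G n)" for n by (simp add: G_def)
  have Gc: "G n \<subseteq> carrier K" for n using G Ac by blast
  \<comment> \<open>The divisorial closure of the module generated by \<open>G n\<close>.\<close>
  define V where "V n = E \<oslash> (E \<oslash> G n)" for n
  have Vm: "module_over E (V n)" for n unfolding V_def
    by (rule module_colon[OF subring_module[OF E] colon_subset e(1)]) auto
  have VE: "V n \<subseteq> E" for n
  proof
    fix x assume "x \<in> V n"
    moreover have "\<one> \<in> E \<oslash> G n" using G[of n] A(1) Gc[of n] by (auto simp: colon_def subset_iff)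
    ultimately have "x \<otimes> \<one> \<in> E" "x \<in> carrier K" by (auto simp: V_def colon_def)
    thus "x \<in> E" by simp
  qed
  have GV: "G n \<subseteq> V n" for n unfolding V_def by (rule le_residual_residual[OF Gc])
  have "\<exists>N. \<forall>n\<ge>N. V n = V N"
  proof (rule M[unfolded mori_def, rule_format], intro conjI)
    fix n
    show "ideal (V n) (K\<lparr>carrier := E\<rparr>)" using ideal_iff_module_over[OF E] Vm VE by blast
    have fr: "fractional_ideal K E (V n)" unfolding fractional_ideal_def
    proof (intro conjI)
      show "group_in (V n)" "\<forall>r\<in>E. \<forall>x\<in>V n. r \<otimes> x \<in> V n"
        using Vm[of n] unfolding module_over_def by blast+
      have "\<one> \<otimes> x \<in> E" if "x \<in> V n" for x using that VE e(1) by (auto simp: subset_iff)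
      thus "\<exists>d\<in>E - {\<zero>}. \<forall>x\<in>V n. d \<otimes> x \<in> E" using e(3) by (intro bexI[of _ \<one>]) auto
    qed
    have "a \<in> V n" using GV G by blast
    hence "V n \<noteq> {\<zero>}" using A(3) by blast
    thus "divisorial K E (V n)" using fr residual_triple[OF colon_subset[of E "G n"], of E]
      unfolding divisorial_def v_closure_def V_def by auto
    show "V n \<subseteq> V (Suc n)" unfolding V_def GS by (intro colon_antimono) auto
  qed
  then obtain N where N: "\<And>n. n \<ge> N \<Longrightarrow> V n = V N" by blast
  have "f (G N) \<in> V (Suc N)" using GV[of "Suc N"] GS by auto
  hence fV: "f (G N) \<in> V N" using N[of "Suc N"] by simp
  obtain y where y: "y \<in> E \<oslash> G N" "y \<otimes> f (G N) \<notin> E" using f[of "G N"] G by blast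
  have "f (G N) \<otimes> y \<in> E" using fV y(1) by (auto simp: V_def colon_def)
  moreover have "f (G N) \<in> carrier K" "y \<in> carrier K" using fV y(1) by (auto simp: V_def colon_def)
  ultimately show False using y(2) by (simp add: m_comm)
qed

end

section \<open>Bounded modules and the complete integral closure\<close>

sublocale quotient_field \<subseteq> ambient_field ..

context quotient_field
begin

lemma R_subring: "subring R K" by (rule subring_axioms)

lemmas R_closed = subringE[OF R_subring]

text \<open>
  A common denominator in \<open>R\<close>: the part of being a fractional ideal that also makes sense for
  subsets and overrings.
\<close>

definition bounded :: "'a set \<Rightarrow> bool" where
  "bounded A \<longleftrightarrow> (\<exists>d\<in>R - {\<zero>}. \<forall>x\<in>A. d \<otimes> x \<in> R)"

lemma fractional_ideal_iff: "fractional_ideal K R I \<longleftrightarrow> module_over R I \<and> bounded I"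
  by (auto simp: fractional_ideal_def module_over_def bounded_def)

lemma bounded_mono: "bounded B \<Longrightarrow> A \<subseteq> B \<Longrightarrow> bounded A"
  unfolding bounded_def by blast

lemma bounded_R: "bounded R"
  unfolding bounded_def using R_closed(1,3) by (intro bexI[of _ \<one>]) (auto simp: subset_iff)

lemma bounded_element:
  assumes "x \<in> carrier K" shows "\<exists>c\<in>R - {\<zero>}. c \<otimes> x \<in> R"
proof -
  obtain a b where ab: "x = a \<otimes> inv b" "a \<in> R" "b \<in> R - {\<zero>}" using assms fractions by blast
  have c: "a \<in> carrier K" "b \<in> carrier K" "b \<in> Units K" using ab R_closed(1) field_Units by auto
  have "b \<otimes> (a \<otimes> inv b) = a \<otimes> (b \<otimes> inv b)" using c by (intro m_lcomm) auto
  also have "\<dots> = a" using c by simp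
  finally have "b \<otimes> x = a" using ab(1) by simp
  thus ?thesis using ab by (intro bexI[of _ b]) auto
qed

lemma bounded_insert:
  assumes "bounded A" "A \<subseteq> carrier K" "x \<in> carrier K" shows "bounded (insert x A)"
proof -
  obtain d where d: "d \<in> R" "d \<noteq> \<zero>" "\<And>y. y \<in> A \<Longrightarrow> d \<otimes> y \<in> R" using assms(1) by (auto simp: bounded_def)
  obtain c where c: "c \<in> R" "c \<noteq> \<zero>" "c \<otimes> x \<in> R" using bounded_element[OF assms(3)] by auto
  have cd: "c \<in> carrier K" "d \<in> carrier K" using c(1) d(1) R_closed(1) by auto
  have "c \<otimes> d \<otimes> y \<in> R" if "y \<in> insert x A" for y
  proof (cases "y = x")
    case True
    have "c \<otimes> d \<otimes> x = d \<otimes> (c \<otimes> x)" using cd assms(3) by (simp add: m_ac)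
    thus ?thesis using True R_closed(6)[OF d(1) c(3)] by simp
  next
    case False
    hence y: "y \<in> A" using that by auto
    hence "c \<otimes> d \<otimes> y = c \<otimes> (d \<otimes> y)" using cd assms(2) by (auto intro!: m_assoc)
    thus ?thesis using R_closed(6)[OF c(1) d(3)[OF y]] by simp
  qed
  moreover have "c \<otimes> d \<in> R - {\<zero>}" using c(1,2) d(1,2) cd integral R_closed(6) by blast
  ultimately show ?thesis unfolding bounded_def by blast
qed

lemma bounded_finite:
  assumes "finite G" "G \<subseteq> carrier K" shows "bounded G"
  using assms
proof (induction rule: finite_induct)
  case empty show ?case using bounded_mono[OF bounded_R] by blast
qed (simp add: bounded_insert)

lemma bounded_prod:
  assumes A: "bounded A" "A \<subseteq> carrier K" and B: "bounded B" "B \<subseteq> carrier K"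
  shows "bounded (A \<cdot> B)"
proof -
  obtain d where d: "d \<in> R" "d \<noteq> \<zero>" "\<And>y. y \<in> A \<Longrightarrow> d \<otimes> y \<in> R" using A by (auto simp: bounded_def)
  obtain c where c: "c \<in> R" "c \<noteq> \<zero>" "\<And>y. y \<in> B \<Longrightarrow> c \<otimes> y \<in> R" using B by (auto simp: bounded_def)
  have cd: "c \<in> carrier K" "d \<in> carrier K" using c(1) d(1) R_closed(1) by auto
  have "d \<otimes> c \<otimes> x \<in> R" if "x \<in> A \<cdot> B" for x
    using that
  proof induct
    case (prod i j)
    have ij: "i \<in> carrier K" "j \<in> carrier K" using prod A B by auto
    have "d \<otimes> c \<otimes> (i \<otimes> j) = (d \<otimes> i) \<otimes> (c \<otimes> j)" using cd ij by (simp add: m_ac)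
    thus ?case using R_closed(6)[OF d(3)[OF prod(1)] c(3)[OF prod(2)]] by simp
  next
    case (sum x y)
    have xy: "x \<in> carrier K" "y \<in> carrier K" using sum ideal_prod_subset_carrier[OF A(2) B(2)] by auto
    thus ?case using sum cd R_closed(7) by (simp add: r_distr)
  qed
  moreover have "d \<otimes> c \<in> R - {\<zero>}" using c(1,2) d(1,2) cd integral R_closed(6) by blast
  ultimately show ?thesis unfolding bounded_def by blast
qed

lemma module_over_span:
  assumes "G \<subseteq> carrier K" "G \<noteq> {}" shows "module_over R (R \<cdot> G)"
  by (rule module_prod[OF subring_module[OF R_subring] assms R_closed(1)]) auto

lemma span_subset: "G \<subseteq> carrier K \<Longrightarrow> G \<subseteq> R \<cdot> G"
  by (rule subset_prod_right[OF _ R_closed(3)])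

lemma span_least:
  assumes "module_over R M" "G \<subseteq> M" shows "R \<cdot> G \<subseteq> M"
  by (rule ideal_prod_le[OF module_overD(1)[OF assms(1)]]) (use assms module_overD(7) in blast)

lemma fractional_ideal_span:
  assumes "finite G" "G \<subseteq> carrier K" "G \<noteq> {}" shows "fractional_ideal K R (R \<cdot> G)"
  unfolding fractional_ideal_iff
  using module_over_span[OF assms(2,3)] bounded_prod[OF bounded_R R_closed(1) bounded_finite[OF assms(1,2)] assms(2)]
  by blast

lemma span_insert_one:
  assumes x: "x \<in> carrier K" and y: "y \<in> R \<cdot> {\<one>, x}"
  shows "\<exists>a\<in>R. \<exists>b\<in>R. y = a \<oplus> b \<otimes> x"
proof -
  note g = subring_group_in[OF R_subring]
  obtain a m where a: "a \<in> R" "m \<in> R \<cdot> {x}" "y = a \<otimes> \<one> \<oplus> m"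
    using ideal_prod_insert[OF g, of "{x}" \<one> y] x y by auto
  obtain b where b: "b \<in> R" "m = b \<otimes> x" using ideal_prod_singleton[OF g x a(2)] by blast
  have "a \<otimes> \<one> = a" using a(1) R_closed(1) by auto
  thus ?thesis using a b by auto
qed

lemma span_insert_one_two:
  assumes x: "x \<in> carrier K" and z: "z \<in> carrier K" and y: "y \<in> R \<cdot> {\<one>, x, z}"
  shows "\<exists>a\<in>R. \<exists>b\<in>R. \<exists>c\<in>R. y = a \<oplus> b \<otimes> x \<oplus> c \<otimes> z"
proof -
  note g = subring_group_in[OF R_subring]
  have "{\<one>, x, z} = insert z {\<one>, x}" by auto
  hence y': "y \<in> R \<cdot> insert z {\<one>, x}" using y by simp
  obtain c m where c: "c \<in> R" "m \<in> R \<cdot> {\<one>, x}" "y = c \<otimes> z \<oplus> m"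
    using ideal_prod_insert[OF g _ _ z y'] x by auto
  obtain a b where ab: "a \<in> R" "b \<in> R" "m = a \<oplus> b \<otimes> x" using span_insert_one[OF x c(2)] by blast
  have cc: "a \<in> carrier K" "b \<in> carrier K" "c \<in> carrier K" using ab c R_closed(1) by auto
  have "y = a \<oplus> b \<otimes> x \<oplus> c \<otimes> z" unfolding c(3) ab(3) using cc x z by algebra
  thus ?thesis using ab c by blast
qed

definition bounded_ring :: "'a set \<Rightarrow> bool" where
  "bounded_ring A \<longleftrightarrow> subring A K \<and> R \<subseteq> A \<and> bounded A"

abbreviation D where "D \<equiv> complete_integral_closure K R"

lemma bounded_ring_subset: assumes "bounded_ring A" shows "A \<subseteq> D"
proof
  fix x assume x: "x \<in> A"
  have A: "subring A K" "bounded A" using assms by (auto simp: bounded_ring_def)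
  obtain d where d: "d \<in> R - {\<zero>}" "\<And>y. y \<in> A \<Longrightarrow> d \<otimes> y \<in> R" using A by (auto simp: bounded_def)
  have "d \<otimes> x [^] (n::nat) \<in> R" for n using d(2) subring_power[OF A(1) x] by blast
  thus "x \<in> D" using x subringE(1)[OF A(1)] d(1) by (auto simp: complete_integral_closure_def)
qed

lemma bounded_ringI:
  assumes "module_over R M" "\<one> \<in> M" "M \<cdot> M \<subseteq> M" "bounded M"
  shows "bounded_ring M"
proof -
  note m = module_overD[OF assms(1)]
  have "subring M K"
    by (rule subringI) (use m(2,4,5) assms(2,3) ideal_prod.prod[of _ M _ M K] in auto)
  moreover have "R \<subseteq> M" by (rule subset_module_if_one[OF assms(1,2) R_closed(1)])
  ultimately show ?thesis using assms(4) by (simp add: bounded_ring_def)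
qed

lemma bounded_ringD:
  assumes "bounded_ring A"
  shows "subring A K" "R \<subseteq> A" "bounded A" "module_over R A" "A \<subseteq> carrier K" "\<one> \<in> A" "A \<cdot> A \<subseteq> A"
proof -
  show *: "subring A K" "R \<subseteq> A" "bounded A" using assms by (auto simp: bounded_ring_def)
  show "module_over R A" by (rule subring_module[OF *(1,2)])
  show "A \<subseteq> carrier K" "\<one> \<in> A" using subringE(1,3)[OF *(1)] by auto
  show "A \<cdot> A \<subseteq> A" by (rule ideal_prod_le[OF subring_group_in[OF *(1)]]) (rule subringE(6)[OF *(1)])
qed

lemma bounded_ring_span:
  assumes G: "G \<subseteq> carrier K" "\<one> \<in> G" "bounded G" "G \<cdot> G \<subseteq> R \<cdot> G"
  shows "bounded_ring (R \<cdot> G)"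
proof (rule bounded_ringI)
  show m: "module_over R (R \<cdot> G)" by (rule module_over_span[OF G(1)]) (use G(2) in auto)
  show "\<one> \<in> R \<cdot> G" using span_subset[OF G(1)] G(2) by blast
  show "bounded (R \<cdot> G)" by (rule bounded_prod[OF bounded_R R_closed(1) G(3,1)])
  have "(R \<cdot> G) \<cdot> (R \<cdot> G) = R \<cdot> (G \<cdot> (R \<cdot> G))"
    by (rule ideal_prod_assoc[OF R_closed(1) G(1) module_overD(2)[OF m]])
  also have "\<dots> = R \<cdot> (R \<cdot> (G \<cdot> G))" by (simp add: ideal_prod_left_comm[OF G(1) R_closed(1) G(1)])
  also have "\<dots> \<subseteq> R \<cdot> G" by (rule span_least[OF m]) (rule span_least[OF m G(4)])
  finally show "(R \<cdot> G) \<cdot> (R \<cdot> G) \<subseteq> R \<cdot> G" .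
qed

lemma bounded_ring_prod:
  assumes A: "bounded_ring A" and B: "bounded_ring B"
  shows "bounded_ring (A \<cdot> B)" "A \<subseteq> A \<cdot> B" "B \<subseteq> A \<cdot> B"
proof -
  note a = bounded_ringD[OF A] and b = bounded_ringD[OF B]
  show "A \<subseteq> A \<cdot> B" by (rule subset_prod_left[OF a(5) b(6)])
  moreover show "B \<subseteq> A \<cdot> B" by (rule subset_prod_right[OF b(5) a(6)])
  ultimately show "bounded_ring (A \<cdot> B)"
  proof (intro bounded_ringI)
    show "module_over R (A \<cdot> B)" by (rule module_prod[OF a(4) b(5) _ R_closed(1)]) (use b(6) in auto)
    have ab: "A \<cdot> B \<subseteq> carrier K" by (rule ideal_prod_subset_carrier[OF a(5) b(5)])
    have "(A \<cdot> B) \<cdot> (A \<cdot> B) = A \<cdot> (B \<cdot> (A \<cdot> B))" by (rule ideal_prod_assoc[OF a(5) b(5) ab])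
    also have "\<dots> = A \<cdot> (A \<cdot> (B \<cdot> B))" by (simp add: ideal_prod_left_comm[OF b(5) a(5) b(5)])
    also have "\<dots> = (A \<cdot> A) \<cdot> (B \<cdot> B)"
      by (rule ideal_prod_assoc[OF a(5) a(5) ideal_prod_subset_carrier[OF b(5) b(5)], symmetric])
    also have "\<dots> \<subseteq> A \<cdot> B" by (rule ideal_prod_mono[OF a(7) b(7)])
    finally show "(A \<cdot> B) \<cdot> (A \<cdot> B) \<subseteq> A \<cdot> B" .
    show "bounded (A \<cdot> B)" by (rule bounded_prod[OF a(3,5) b(3,5)])
  qed (use b(6) in auto)
qed

lemma bounded_ring_R: "bounded_ring R"
  unfolding bounded_ring_def using R_subring bounded_R by blast

text \<open>
  If all powers of \<open>d\<close> have a common denominator, so has the ring \<open>R[d]\<close> that they span.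
\<close>

lemma complete_integral_closureE:
  assumes d: "d \<in> D" obtains A where "bounded_ring A" "d \<in> A"
proof
  obtain c where dc: "d \<in> carrier K" and c: "c \<in> R" "c \<noteq> \<zero>" "\<And>n::nat. n \<ge> 1 \<Longrightarrow> c \<otimes> d [^] n \<in> R"
    using d by (auto simp: complete_integral_closure_def)
  have cc: "c \<in> carrier K" using c R_closed(1) by auto
  define G where "G = {d [^] (n::nat) | n. True}"
  have G: "G \<subseteq> carrier K" "G \<noteq> {}" using dc by (auto simp: G_def)
  note m = module_over_span[OF G]
  have "c \<otimes> d [^] n \<in> R" for n :: nat using c(1) c(3)[of n] cc by (cases n) auto
  hence bG: "bounded G" unfolding bounded_def G_def using c by (intro bexI[of _ c]) auto
  have "d [^] (1::nat) \<in> G" unfolding G_def by blast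
  thus "d \<in> R \<cdot> G" using span_subset[OF G(1)] dc by auto
  show "bounded_ring (R \<cdot> G)"
  proof (rule bounded_ring_span[OF G(1) _ bG])
    have "d [^] (0::nat) \<in> G" unfolding G_def by blast
    thus "\<one> \<in> G" by simp
    show "G \<cdot> G \<subseteq> R \<cdot> G"
    proof (rule ideal_prod_le[OF module_overD(1)[OF m]])
      fix a b assume "a \<in> G" "b \<in> G"
      then obtain n k :: nat where "a = d [^] n" "b = d [^] k" by (auto simp: G_def)
      hence "a \<otimes> b = d [^] (n + k)" using dc by (simp add: nat_pow_mult)
      hence "a \<otimes> b \<in> G" by (auto simp: G_def)
      thus "a \<otimes> b \<in> R \<cdot> G" using span_subset[OF G(1)] by blast
    qed
  qed
qed

text \<open>
  The product of two bounded overrings is a bounded overring containing both, so \<open>D\<close> is a directed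
  union of rings.
\<close>

lemma D_subring: "subring D K"
proof (rule subringI)
  show "D \<subseteq> carrier K" by (auto simp: complete_integral_closure_def)
  show "\<one> \<in> D" using bounded_ring_subset[OF bounded_ring_R] R_closed(3) by blast
  show "\<ominus> h \<in> D" if h: "h \<in> D" for h
  proof -
    obtain A where A: "bounded_ring A" "h \<in> A" by (rule complete_integral_closureE[OF h])
    thus ?thesis using subringE(5)[OF bounded_ringD(1)[OF A(1)] A(2)] bounded_ring_subset[OF A(1)] by blast
  qed
  fix x y assume x: "x \<in> D" and y: "y \<in> D"
  obtain A where A: "bounded_ring A" "x \<in> A" by (rule complete_integral_closureE[OF x])
  obtain B where B: "bounded_ring B" "y \<in> B" by (rule complete_integral_closureE[OF y])
  note p = bounded_ring_prod[OF A(1) B(1)]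
  have xy: "x \<in> A \<cdot> B" "y \<in> A \<cdot> B" using A B p(2,3) by auto
  note q = subringE(6,7)[OF bounded_ringD(1)[OF p(1)] xy]
  show "x \<otimes> y \<in> D" "x \<oplus> y \<in> D" using q bounded_ring_subset[OF p(1)] by blast+
qed

lemma R_subset_D: "R \<subseteq> D"
  by (rule bounded_ring_subset[OF bounded_ring_R])

lemma nonzero_in_ring:
  assumes I: "fractional_ideal K R I" "I \<noteq> {\<zero>}"
  shows "\<exists>x\<in>I. x \<noteq> \<zero>"
  using I module_overD(3) unfolding fractional_ideal_iff by blast

lemma colon_bounded:
  assumes A: "bounded A" and B: "x \<in> B" "x \<noteq> \<zero>" "x \<in> carrier K"
  shows "bounded (A \<oslash> B)"
proof -
  obtain d where d: "d \<in> R" "d \<noteq> \<zero>" "\<And>y. y \<in> A \<Longrightarrow> d \<otimes> y \<in> R" using A by (auto simp: bounded_def)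
  obtain c where c: "c \<in> R" "c \<noteq> \<zero>" "c \<otimes> x \<in> R" using bounded_element[OF B(3)] by auto
  have cd: "c \<in> carrier K" "d \<in> carrier K" using c(1) d(1) R_closed(1) by auto
  have "c \<otimes> x \<otimes> d \<otimes> y \<in> R" if y: "y \<in> A \<oslash> B" for y
  proof -
    have yx: "y \<otimes> x \<in> A" "y \<in> carrier K" using y B by (auto simp: colon_def)
    have "c \<otimes> x \<otimes> d \<otimes> y = c \<otimes> (d \<otimes> (y \<otimes> x))" using cd B(3) yx(2) by (simp add: m_ac)
    thus ?thesis using R_closed(6)[OF c(1) d(3)[OF yx(1)]] by simp
  qed
  moreover have "c \<otimes> x \<otimes> d \<in> R" using R_closed(6) c(3) d(1) by blast
  moreover have "c \<otimes> x \<otimes> d \<noteq> \<zero>" using c(2) d(2) B(2,3) cd by (simp add: integral_iff)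
  ultimately show ?thesis unfolding bounded_def by blast
qed

lemma endo_ring:
  assumes I: "fractional_ideal K R I" "I \<noteq> {\<zero>}"
  shows "bounded_ring (I \<oslash> I)"
proof -
  have m: "module_over R I" "bounded I" using I fractional_ideal_iff by auto
  obtain x where x: "x \<in> I" "x \<noteq> \<zero>" using nonzero_in_ring[OF I] by blast
  have xc: "x \<in> carrier K" using x module_overD(2)[OF m(1)] by blast
  have "R \<subseteq> I \<oslash> I" using module_overD(7)[OF m(1)] R_closed(1) by (auto simp: colon_def)
  thus ?thesis unfolding bounded_ring_def
    using subring_colon[OF module_overD(1)[OF m(1)]] colon_bounded[OF m(2) x xc] by blast
qed

end

section \<open>Stable ideals and the quadratic nature of the closure\<close>

context quotient_field
begin

text \<open>
  Stability of \<open>I\<close> as the statement that the trace ideal \<open>I(E:I)\<close> of \<open>I\<close> in \<open>E = (I:I)\<close> is not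
  proper; it makes sense for every fractional ideal.
\<close>

definition stable_module :: "'a set \<Rightarrow> bool" where
  "stable_module I \<longleftrightarrow> \<one> \<in> I \<cdot> ((I \<oslash> I) \<oslash> I)"

definition finitely_stable :: bool where
  "finitely_stable \<longleftrightarrow> (\<forall>G. finite G \<and> G \<subseteq> carrier K \<and> \<not> G \<subseteq> {\<zero>} \<longrightarrow> stable_module (R \<cdot> G))"

lemma span_nonzero:
  assumes "G \<subseteq> carrier K" "\<not> G \<subseteq> {\<zero>}" shows "R \<cdot> G \<noteq> {\<zero>}" "G \<noteq> {}"
  using span_subset[OF assms(1)] assms(2) by auto

lemma span_zero: "G \<subseteq> {\<zero>} \<Longrightarrow> R \<cdot> G \<subseteq> {\<zero>}"
  by (rule ideal_prod_le) (use R_closed(1) in \<open>auto intro!: group_inI\<close>)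

lemma trace_ideal:
  assumes I: "fractional_ideal K R I" "I \<noteq> {\<zero>}"
  defines "E \<equiv> I \<oslash> I"
  defines "T \<equiv> I \<cdot> (E \<oslash> I)"
  shows "module_over E T" "T \<subseteq> E" "\<exists>t\<in>T. t \<noteq> \<zero>" "subring E K" "R \<subseteq> E" "module_over E (E \<oslash> I)"
    "I \<subseteq> carrier K" "bounded_ring E"
proof -
  have m: "module_over R I" "bounded I" using I fractional_ideal_iff by auto
  note i = module_overD[OF m(1)]
  show E: "bounded_ring E" unfolding E_def by (rule endo_ring[OF I])
  note e = bounded_ringD[OF E]
  show "subring E K" "R \<subseteq> E" "I \<subseteq> carrier K" using e i by auto
  have IE: "module_over E I" unfolding E_def by (rule module_colon_self[OF i(1)])
  show J: "module_over E (E \<oslash> I)"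
    by (rule module_colon[OF subring_module[OF e(1)] i(2) e(5)]) auto
  show "module_over E T" unfolding T_def
    by (rule module_prod[OF IE _ _ e(5)]) (use module_overD(2,3)[OF J] in auto)
  show "T \<subseteq> E" unfolding T_def by (rule prod_colon_le[OF subring_group_in[OF e(1)] i(2)])
  obtain x where x: "x \<in> I" "x \<noteq> \<zero>" using nonzero_in_ring[OF I] by blast
  obtain c where c: "c \<in> R" "c \<noteq> \<zero>" "\<forall>y\<in>I. c \<otimes> y \<in> R" using m(2) unfolding bounded_def by blast
  have cx: "c \<in> carrier K" "x \<in> carrier K" using c(1) x(1) R_closed(1) i(2) by auto
  have "c \<in> E \<oslash> I" using c(3) e(2) cx(1) by (auto simp: colon_def)
  hence "x \<otimes> c \<in> T" unfolding T_def by (rule ideal_prod.prod[OF x(1)])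
  thus "\<exists>t\<in>T. t \<noteq> \<zero>" using x(2) c(2) cx by (metis integral_iff)
qed

lemma stable_trace_eq:
  assumes I: "fractional_ideal K R I" "I \<noteq> {\<zero>}" and st: "stable_module I"
  shows "I \<cdot> ((I \<oslash> I) \<oslash> I) = I \<oslash> I"
  using subset_module_if_one[OF trace_ideal(1)[OF I] _ colon_subset] trace_ideal(2)[OF I] st
  unfolding stable_module_def by blast

text \<open>
  If \<open>I\<close> is generated by \<open>G\<close>, then \<open>IT = I\<close> reads \<open>G \<subseteq> TG\<close>, which is the hypothesis of Nakayama's
  lemma over the ring \<open>(I:I)\<close>.
\<close>

lemma stable_if_trace_fixes_span:
  assumes G: "finite G" "G \<subseteq> carrier K" "\<not> G \<subseteq> {\<zero>}"
  defines "I \<equiv> R \<cdot> G"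
  assumes T: "I \<cdot> (I \<cdot> ((I \<oslash> I) \<oslash> I)) = I"
  shows "stable_module I"
proof -
  have I: "fractional_ideal K R I" "I \<noteq> {\<zero>}"
    unfolding I_def using fractional_ideal_span[OF G(1,2)] span_nonzero[OF G(2,3)] by auto
  define T where "T = I \<cdot> ((I \<oslash> I) \<oslash> I)"
  note t = trace_ideal[OF I, folded T_def]
  have tR: "module_over R T" by (rule module_over_mono[OF t(1,5)])
  note tc = module_overD(2)[OF tR]
  obtain g where g: "g \<in> G" "g \<noteq> \<zero>" using G by auto
  have "G \<subseteq> I" unfolding I_def by (rule span_subset[OF G(2)])
  also have "I = I \<cdot> T" using T by (simp add: T_def)
  also have "\<dots> = T \<cdot> (R \<cdot> G)" unfolding I_def[symmetric] by (rule ideal_prod_comm[OF t(7) tc])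
  also have "\<dots> = (T \<cdot> R) \<cdot> G" by (rule ideal_prod_assoc[OF tc R_closed(1) G(2), symmetric])
  also have "T \<cdot> R = T" by (rule module_prod_id'[OF tR R_closed(3,1)])
  finally have "\<one> \<in> T" by (intro nakayama[OF t(4,1,2) G(1,2) g])
  thus ?thesis by (simp add: stable_module_def T_def)
qed

text \<open>
  The conductor \<open>(E:A)\<close> of a bounded ring \<open>A\<close> containing \<open>I\<close> serves as the ideal \<open>W\<close> in
  \<open>invertible_module_is_ring\<close>; it is nonzero because \<open>A\<close> is bounded.
\<close>

lemma stable_module_is_ring:
  assumes I: "fractional_ideal K R I" "\<one> \<in> I" "stable_module I"
    and A: "bounded_ring A" "I \<subseteq> A" and d: "dimension_le_one (I \<oslash> I)"
  shows "I \<subseteq> I \<oslash> I"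
proof -
  have I0: "I \<noteq> {\<zero>}" using I(2) by auto
  define E where "E = I \<oslash> I"
  note t = trace_ideal[OF I(1) I0, folded E_def]
  note a = bounded_ringD[OF A(1)] and e = subringE[OF t(4)]
  have ig: "group_in I" using I(1) fractional_ideal_iff module_overD(1) by blast
  define W where "W = E \<inter> (E \<oslash> A)"
  have wm: "module_over E (E \<oslash> A)" by (rule module_colon[OF subring_module[OF t(4)] a(5) e(1)]) auto
  show ?thesis unfolding E_def[symmetric]
  proof (rule invertible_module_is_ring)
    show "subring E K" by (rule t(4))
    show "dimension_le_one E" using d by (simp add: E_def)
    show "module_over E I" unfolding E_def by (rule module_colon_self[OF ig])
    show "\<one> \<in> I" by (rule I(2))
    show "\<one> \<in> I \<cdot> (E \<oslash> I)" using I(3) by (simp add: stable_module_def E_def)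
    show "module_over E W"
      by (rule module_overI[OF _ _ _ _ t(4)]) (use module_overD(2-4,7)[OF wm] e(1,2,6,7) in \<open>auto simp: W_def\<close>)
    show "W \<subseteq> E" by (simp add: W_def)
    obtain c where c: "c \<in> R" "c \<noteq> \<zero>" "\<forall>y\<in>A. c \<otimes> y \<in> R" using a(3) unfolding bounded_def by blast
    have "c \<in> W" using c t(5) R_closed(1) by (auto simp: W_def colon_def)
    thus "W \<noteq> {\<zero>}" using c(2) by blast
    fix i w assume i: "i \<in> I" and w: "w \<in> W"
    have iA: "i \<in> A" using i A(2) by auto
    have ic: "i \<in> carrier K" "w \<in> carrier K" using iA a(5) w e(1) by (auto simp: W_def)
    have "w \<otimes> i \<in> E" using w iA by (auto simp: W_def colon_def)
    moreover have "w \<otimes> i \<otimes> z \<in> E" if z: "z \<in> A" for z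
    proof -
      have "w \<otimes> i \<otimes> z = w \<otimes> (i \<otimes> z)" using ic z a(5) by (auto intro!: m_assoc)
      moreover have "i \<otimes> z \<in> A" by (rule subringE(6)[OF a(1) iA z])
      ultimately show ?thesis using w by (auto simp: W_def colon_def)
    qed
    ultimately show "w \<otimes> i \<in> W" using ic by (auto simp: W_def colon_def)
  qed
qed

text \<open>
  The characteristic polynomial of multiplication by \<open>y\<close> on \<open>R + Rx\<close>: from \<open>y = r + sx\<close> and
  \<open>yx = p + qx\<close> one obtains \<open>(y - r)(y - q) = sp\<close>.
\<close>

lemma endo_quadratic:
  assumes x: "x \<in> carrier K"
  shows "quadratic_over R ((R \<cdot> {\<one>, x}) \<oslash> (R \<cdot> {\<one>, x}))"
  unfolding quadratic_over_def
proof
  define I where "I = R \<cdot> {\<one>, x}"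
  have sub: "{\<one>, x} \<subseteq> I" unfolding I_def using x by (intro span_subset) auto
  fix y assume "y \<in> (R \<cdot> {\<one>, x}) \<oslash> (R \<cdot> {\<one>, x})"
  hence y: "y \<in> carrier K" "\<And>z. z \<in> I \<Longrightarrow> y \<otimes> z \<in> I" by (auto simp: colon_def I_def)
  have "y \<otimes> \<one> \<in> I" "y \<otimes> x \<in> I" using y(2) sub by blast+
  hence "y \<in> I" "y \<otimes> x \<in> I" using y(1) by auto
  then obtain r s p q where rs: "r \<in> R" "s \<in> R" "y = r \<oplus> s \<otimes> x"
    and pq: "p \<in> R" "q \<in> R" "y \<otimes> x = p \<oplus> q \<otimes> x"
    unfolding I_def using span_insert_one[OF x] by metis
  have c: "r \<in> carrier K" "s \<in> carrier K" "p \<in> carrier K" "q \<in> carrier K"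
    using rs(1,2) pq(1,2) R_closed(1) by auto
  have sx: "s \<otimes> x = y \<ominus> r" unfolding rs(3) using c x by algebra
  have "y \<otimes> y = y \<otimes> (r \<oplus> s \<otimes> x)" using rs(3) by simp
  also have "\<dots> = r \<otimes> y \<oplus> s \<otimes> (y \<otimes> x)" using c x y(1) by algebra
  also have "\<dots> = r \<otimes> y \<oplus> s \<otimes> p \<oplus> q \<otimes> (s \<otimes> x)" unfolding pq(3) using c x y(1) by algebra
  also have "\<dots> = (r \<oplus> q) \<otimes> y \<oplus> (s \<otimes> p \<ominus> q \<otimes> r)" unfolding sx using c x y(1) by algebra
  finally show "\<exists>a\<in>R. \<exists>b\<in>R. y \<otimes> y = a \<otimes> y \<oplus> b"
    using rs(1,2) pq(1,2) R_closed(6,7) group_inD(5)[OF subring_group_in[OF R_subring]] by metis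
qed

text \<open>
  The span \<open>I\<close> of \<open>G\<close> is stable and lies in the bounded ring \<open>A\<close>, and \<open>(I:I)\<close> inherits dimension one from
  \<open>R\<close> once it is quadratic over \<open>R\<close>. So \<open>I\<close> is a ring.
\<close>

lemma finite_span_is_ring:
  assumes d: "dimension_le_one R" and s: "finitely_stable"
    and G: "finite G" "\<one> \<in> G" "G \<subseteq> A" and A: "bounded_ring A"
    and q: "quadratic_over R ((R \<cdot> G) \<oslash> (R \<cdot> G))" and xy: "x \<in> G" "y \<in> G"
  shows "x \<otimes> y \<in> R \<cdot> G"
proof -
  note a = bounded_ringD[OF A]
  define I where "I = R \<cdot> G"
  have Gc: "G \<subseteq> carrier K" "G \<noteq> {}" "\<not> G \<subseteq> {\<zero>}" using G(2,3) a(5) by auto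
  have I: "fractional_ideal K R I" "I \<noteq> {\<zero>}"
    unfolding I_def using fractional_ideal_span[OF G(1) Gc(1,2)] span_nonzero[OF Gc(1,3)] by auto
  have sub: "G \<subseteq> I" unfolding I_def by (rule span_subset[OF Gc(1)])
  have "I \<subseteq> I \<oslash> I"
  proof (rule stable_module_is_ring[OF I(1) _ _ A])
    show "\<one> \<in> I" using sub G(2) by blast
    show "stable_module I" using s G(1) Gc unfolding finitely_stable_def I_def by blast
    show "I \<subseteq> A" unfolding I_def by (rule span_least[OF a(4) G(3)])
    show "dimension_le_one (I \<oslash> I)"
      by (rule quadratic_dimension[OF R_subring _ d]) (use trace_ideal(4,5)[OF I] q in \<open>auto simp: I_def\<close>)
  qed
  hence "x \<in> I \<oslash> I" using sub xy(1) by blast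
  thus ?thesis using sub xy(2) by (auto simp: colon_def I_def)
qed

text \<open>
  Apply \<open>finite_span_is_ring\<close> to \<open>R + Rx\<close> inside \<open>R[x]\<close>.
\<close>

lemma closure_quadratic:
  assumes d: "dimension_le_one R" and s: "finitely_stable"
  shows "quadratic_over R D"
  unfolding quadratic_over_def
proof
  fix x assume x: "x \<in> D"
  obtain A where A: "bounded_ring A" "x \<in> A" by (rule complete_integral_closureE[OF x])
  note a = bounded_ringD[OF A(1)]
  have xc: "x \<in> carrier K" using A a by auto
  have "x \<otimes> x \<in> R \<cdot> {\<one>, x}"
    by (rule finite_span_is_ring[OF d s _ _ _ A(1) endo_quadratic[OF xc]]) (use A(2) a(6) in auto)
  then obtain p q where pq: "p \<in> R" "q \<in> R" "x \<otimes> x = p \<oplus> q \<otimes> x"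
    using span_insert_one[OF xc] by metis
  have "x \<otimes> x = q \<otimes> x \<oplus> p" unfolding pq(3) using pq(1,2) xc R_closed(1) by (auto intro!: a_comm)
  thus "\<exists>a\<in>R. \<exists>b\<in>R. x \<otimes> x = a \<otimes> x \<oplus> b" using pq(1,2) by blast
qed

lemma bounded_ring_element:
  assumes q: "quadratic_over R D" and x: "x \<in> D"
  shows "bounded_ring (R \<cdot> {\<one>, x})"
proof -
  have xc: "x \<in> carrier K" using x subringE(1)[OF D_subring] by blast
  have G: "finite {\<one>, x}" "{\<one>, x} \<subseteq> carrier K" "{\<one>, x} \<noteq> {}" using xc by auto
  note m = module_over_span[OF G(2,3)]
  note mm = module_overD[OF m]
  have sub: "{\<one>, x} \<subseteq> R \<cdot> {\<one>, x}" by (rule span_subset[OF G(2)])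
  show ?thesis
  proof (rule bounded_ring_span[OF G(2) _ bounded_finite[OF G(1,2)]])
    obtain a b where ab: "a \<in> R" "b \<in> R" "x \<otimes> x = a \<otimes> x \<oplus> b" using quadratic_overD[OF q x] by blast
    have xx: "x \<otimes> x \<in> R \<cdot> {\<one>, x}"
    proof -
      have "b \<otimes> \<one> \<in> R \<cdot> {\<one>, x}" "a \<otimes> x \<in> R \<cdot> {\<one>, x}" using mm(7) ab(1,2) sub by blast+
      moreover have "b \<otimes> \<one> = b" using ab(2) R_closed(1) by auto
      ultimately show ?thesis unfolding ab(3) using mm(4) by metis
    qed
    show "{\<one>, x} \<cdot> {\<one>, x} \<subseteq> R \<cdot> {\<one>, x}"
      by (rule ideal_prod_le[OF mm(1)]) (use xx sub xc in auto)
  qed simp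
qed

text \<open>
  The rings \<open>R + Rx\<close> for \<open>x\<close> in a finite set multiply to a ring generated as a module by products
  of the chosen generators.
\<close>

lemma finite_subset_bounded_ring:
  assumes q: "quadratic_over R D" and F: "finite F" "F \<subseteq> D"
  shows "\<exists>G. finite G \<and> G \<subseteq> carrier K \<and> F \<subseteq> R \<cdot> G \<and> bounded_ring (R \<cdot> G)"
  using F
proof (induction rule: finite_induct)
  case empty
  have "module_over R R" by (rule subring_module[OF R_subring]) auto
  hence "R \<cdot> {\<one>} = R"
  proof (intro equalityI)
    show "R \<cdot> {\<one>} \<subseteq> R" using R_closed(3) by (intro span_least \<open>module_over R R\<close>) auto
    show "R \<subseteq> R \<cdot> {\<one>}" by (rule subset_prod_left[OF R_closed(1)]) simp
  qed
  thus ?case using bounded_ring_R by (intro exI[of _ "{\<one>}"]) auto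
next
  case (insert x F)
  then obtain G where G: "finite G" "G \<subseteq> carrier K" "F \<subseteq> R \<cdot> G" "bounded_ring (R \<cdot> G)" by blast
  have x: "x \<in> D" "x \<in> carrier K" using insert.prems subringE(1)[OF D_subring] by auto
  define H where "H = {\<one>, x}"
  have H: "finite H" "H \<subseteq> carrier K" "H \<noteq> {}" "x \<in> H" using x by (auto simp: H_def)
  have bH: "bounded_ring (R \<cdot> H)" unfolding H_def by (rule bounded_ring_element[OF q x(1)])
  define P where "P = (\<lambda>(g, h). g \<otimes> h) ` (G \<times> H)"
  have P: "finite P" "P \<subseteq> carrier K" unfolding P_def using G(1,2) H(1,2) by auto
  have "G \<noteq> {}"
  proof
    assume "G = {}"
    hence "R \<cdot> G \<subseteq> {\<zero>}" by (intro span_zero) auto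
    thus False using bounded_ringD(6)[OF G(4)] by auto
  qed
  hence "P \<noteq> {}" using H(3) by (auto simp: P_def)
  note m = module_over_span[OF P(2) this]
  note AB = bounded_ring_prod[OF G(4) bH]
  have RH: "R \<cdot> H \<subseteq> carrier K" using bounded_ringD(5)[OF bH] .
  have "G \<cdot> H \<subseteq> R \<cdot> P"
    by (rule ideal_prod_le[OF module_overD(1)[OF m]]) (use span_subset[OF P(2)] in \<open>auto simp: P_def\<close>)
  hence "R \<cdot> (R \<cdot> (G \<cdot> H)) \<subseteq> R \<cdot> P" by (intro span_least[OF m])
  moreover have "R \<cdot> (R \<cdot> (G \<cdot> H)) = (R \<cdot> G) \<cdot> (R \<cdot> H)"
    by (simp add: ideal_prod_assoc[OF R_closed(1) G(2) RH] ideal_prod_left_comm[OF G(2) R_closed(1) H(2)])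
  moreover have "R \<cdot> P \<subseteq> (R \<cdot> G) \<cdot> (R \<cdot> H)"
  proof (rule span_least[OF bounded_ringD(4)[OF AB(1)]])
    show "P \<subseteq> (R \<cdot> G) \<cdot> (R \<cdot> H)"
      using span_subset[OF G(2)] span_subset[OF H(2)] by (auto simp: P_def intro!: ideal_prod.prod)
  qed
  ultimately have eq: "R \<cdot> P = (R \<cdot> G) \<cdot> (R \<cdot> H)" by blast
  have "insert x F \<subseteq> R \<cdot> P" unfolding eq using AB(2,3) G(3) span_subset[OF H(2)] H(4) by blast
  thus ?case using P AB(1) eq by (intro exI[of _ P]) auto
qed

lemma closure_dimension:
  assumes "dimension_le_one R" "finitely_stable"
  shows "dimension_le_one D"
  by (rule quadratic_dimension[OF R_subring R_subset_D assms(1) closure_quadratic[OF assms] D_subring])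

lemma quadratic_over_subset: "quadratic_over R B \<Longrightarrow> A \<subseteq> B \<Longrightarrow> quadratic_over R A"
  by (auto simp: quadratic_over_def)

text \<open>
  The endomorphism ring of \<open>R + Rx + Ry\<close> is a subring of \<open>D\<close> and inherits quadraticity from it, so
  \<open>finite_span_is_ring\<close> applies.
\<close>

lemma closure_product:
  assumes d: "dimension_le_one R" and s: "finitely_stable" and xy: "x \<in> D" "y \<in> D"
  shows "\<exists>a\<in>R. \<exists>b\<in>R. \<exists>c\<in>R. x \<otimes> y = a \<oplus> b \<otimes> x \<oplus> c \<otimes> y"
proof -
  note q = closure_quadratic[OF d s]
  have c: "x \<in> carrier K" "y \<in> carrier K" using xy subringE(1)[OF D_subring] by auto
  obtain A0 where A0: "bounded_ring A0" "x \<in> A0" by (rule complete_integral_closureE[OF xy(1)])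
  obtain B0 where B0: "bounded_ring B0" "y \<in> B0" by (rule complete_integral_closureE[OF xy(2)])
  define A where "A = A0 \<cdot> B0"
  have A: "bounded_ring A" "x \<in> A" "y \<in> A" unfolding A_def using bounded_ring_prod[OF A0(1) B0(1)] A0 B0 by auto
  note a = bounded_ringD[OF A(1)]
  define I where "I = R \<cdot> {\<one>, x, y}"
  have G: "finite {\<one>, x, y}" "{\<one>, x, y} \<subseteq> carrier K" "\<not> {\<one>, x, y} \<subseteq> {\<zero>}" using c by auto
  have I: "fractional_ideal K R I" "I \<noteq> {\<zero>}"
    unfolding I_def using fractional_ideal_span[OF G(1,2)] span_nonzero[OF G(2,3)] by auto
  have "I \<oslash> I \<subseteq> D" by (rule bounded_ring_subset[OF trace_ideal(8)[OF I]])
  hence qI: "quadratic_over R (I \<oslash> I)" by (rule quadratic_over_subset[OF q])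
  have "x \<otimes> y \<in> R \<cdot> {\<one>, x, y}"
    by (rule finite_span_is_ring[OF d s _ _ _ A(1) qI[unfolded I_def]]) (use A(2,3) a(6) in auto)
  thus ?thesis by (rule span_insert_one_two[OF c])
qed

text \<open>
  An inverse of \<open>I\<close> over \<open>(I:I)\<close> remains one over the larger ring \<open>D\<close>.
\<close>

lemma stable_extends_invertible:
  assumes I: "fractional_ideal K R I" "I \<noteq> {\<zero>}" "stable_module I"
  shows "\<one> \<in> I \<cdot> (D \<oslash> I)"
proof -
  have "(I \<oslash> I) \<oslash> I \<subseteq> D \<oslash> I" by (rule colon_mono[OF bounded_ring_subset[OF trace_ideal(8)[OF I(1,2)]]])
  hence "I \<cdot> ((I \<oslash> I) \<oslash> I) \<subseteq> I \<cdot> (D \<oslash> I)" by (intro ideal_prod_mono) auto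
  thus ?thesis using I(3) unfolding stable_module_def by blast
qed

text \<open>
  The idempotent trace ideal \<open>T\<close> satisfies \<open>TD = D\<close>, because \<open>D\<close> is Mori and finitely generated ideals
  are stable. Then \<open>1 \<in> T\<close> follows, because finitely many elements of \<open>D\<close> lie in an overring that is
  finitely generated as a module.
\<close>

theorem stable_if_trace_fixes:
  assumes d: "dimension_le_one R" and M: "mori K D"
    and cl: "\<And>I. fractional_ideal K R I \<Longrightarrow> I \<noteq> {\<zero>} \<Longrightarrow> I \<cdot> (I \<cdot> ((I \<oslash> I) \<oslash> I)) = I"
    and I: "fractional_ideal K R I" "I \<noteq> {\<zero>}"
  shows "stable_module I"
proof -
  have s: finitely_stable unfolding finitely_stable_def
    using stable_if_trace_fixes_span cl fractional_ideal_span span_nonzero by metis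
  define E where "E = I \<oslash> I"
  define J where "J = E \<oslash> I"
  define T where "T = I \<cdot> J"
  note t = trace_ideal[OF I, folded E_def, folded J_def, folded T_def]
  have tR: "module_over R T" by (rule module_over_mono[OF t(1,5)])
  note tc = module_overD(2)[OF tR] and Dc = subringE(1)[OF D_subring]
  have jc: "J \<subseteq> carrier K" unfolding J_def by (rule colon_subset)
  have IT: "I \<cdot> T = I" using cl[OF I] by (simp add: T_def J_def E_def)
  have TT: "T \<cdot> T = T"
  proof -
    have "T \<cdot> T = (J \<cdot> I) \<cdot> T" unfolding T_def using ideal_prod_comm[OF t(7) jc] by simp
    also have "\<dots> = J \<cdot> (I \<cdot> T)" by (rule ideal_prod_assoc[OF jc t(7) tc])
    also have "\<dots> = J \<cdot> I" by (simp add: IT)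
    also have "\<dots> = T" unfolding T_def by (rule ideal_prod_comm[OF jc t(7)])
    finally show ?thesis .
  qed
  obtain u where u: "u \<in> T" "u \<noteq> \<zero>" using t(3) by blast
  have "T \<subseteq> D" using t(2) bounded_ring_subset[OF t(8)] by blast
  then obtain G where G: "G \<subseteq> T" "finite G" "u \<in> G" "D \<oslash> G \<subseteq> D \<oslash> T"
    using mori_finite_subset[OF D_subring M _ u] by blast
  have Gc: "G \<subseteq> carrier K" "\<not> G \<subseteq> {\<zero>}" using G(1,3) u tc by auto
  have N: "fractional_ideal K R (R \<cdot> G)" "R \<cdot> G \<noteq> {\<zero>}" "stable_module (R \<cdot> G)"
    using fractional_ideal_span[OF G(2) Gc(1)] span_nonzero[OF Gc] s G(2) Gc unfolding finitely_stable_def by auto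
  \<comment> \<open>By the choice of \<open>G\<close> the inverse of \<open>RG\<close> over \<open>D\<close> also multiplies all of \<open>T\<close> into \<open>D\<close>.\<close>
  define H where "H = D \<oslash> (R \<cdot> G)"
  have H: "H \<subseteq> D \<oslash> T" unfolding H_def
    using colon_antimono[OF span_subset[OF Gc(1)], of D] G(4) by blast
  have hc: "H \<subseteq> carrier K" unfolding H_def by (rule colon_subset)
  have "R \<cdot> G \<subseteq> T" by (rule span_least[OF tR G(1)])
  hence "(R \<cdot> G) \<cdot> H \<subseteq> T \<cdot> H" by (intro ideal_prod_mono) auto
  hence "\<one> \<in> T \<cdot> H" using stable_extends_invertible[OF N] unfolding H_def by blast
  \<comment> \<open>Idempotency frees one factor \<open>T\<close>, so \<open>1\<close> lies in \<open>T(TH)\<close>, a part of \<open>TD\<close>.\<close>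
  also have "T \<cdot> H = T \<cdot> (T \<cdot> H)" using ideal_prod_assoc[OF tc tc hc] TT by simp
  also have "T \<cdot> H \<subseteq> D"
  proof -
    have "T \<cdot> H \<subseteq> T \<cdot> (D \<oslash> T)" using H by (intro ideal_prod_mono) auto
    thus ?thesis using prod_colon_le[OF subring_group_in[OF D_subring] tc] by blast
  qed
  hence "T \<cdot> (T \<cdot> H) \<subseteq> D \<cdot> T" using ideal_prod_comm[OF tc Dc] ideal_prod_mono[of T T "T \<cdot> H" D] by auto
  finally have "\<one> \<in> D \<cdot> T" .
  then obtain F where F: "F \<subseteq> D" "finite F" "\<one> \<in> F \<cdot> T" using ideal_prod_finite by blast
  obtain G' where G': "finite G'" "G' \<subseteq> carrier K" "F \<subseteq> R \<cdot> G'" "bounded_ring (R \<cdot> G')"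
    using finite_subset_bounded_ring[OF closure_quadratic[OF d s] F(2,1)] by blast
  \<comment> \<open>From \<open>1 \<in> TA\<close> the ring \<open>A\<close> satisfies \<open>A = TA\<close>, where \<open>A\<close> is generated by the finite set \<open>G'\<close>.\<close>
  define A where "A = R \<cdot> G'"
  have A: "bounded_ring A" using G'(4) by (simp add: A_def)
  note a = bounded_ringD[OF A]
  have "F \<cdot> T \<subseteq> A \<cdot> T" by (rule ideal_prod_mono) (use G'(3) in \<open>auto simp: A_def\<close>)
  hence 1: "\<one> \<in> A \<cdot> T" using F(3) by blast
  have "module_over A (A \<cdot> T)"
    by (rule module_prod[OF subring_module[OF a(1)] tc _ a(5)]) (use u in auto)
  hence "A \<subseteq> A \<cdot> T" by (rule subset_module_if_one[OF _ 1 a(5)])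
  also have "A \<cdot> T = T \<cdot> (R \<cdot> G')" unfolding A_def[symmetric] by (rule ideal_prod_comm[OF a(5) tc])
  also have "\<dots> = (T \<cdot> R) \<cdot> G'" by (rule ideal_prod_assoc[OF tc R_closed(1) G'(2), symmetric])
  also have "T \<cdot> R = T" by (rule module_prod_id'[OF tR R_closed(3,1)])
  finally have "G' \<subseteq> T \<cdot> G'" using span_subset[OF G'(2)] unfolding A_def by blast
  moreover have "\<not> G' \<subseteq> {\<zero>}"
  proof
    assume "G' \<subseteq> {\<zero>}"
    hence "\<one> \<in> {\<zero>}" using span_zero[of G'] a(6) unfolding A_def by blast
    thus False by simp
  qed
  then obtain g where "g \<in> G'" "g \<noteq> \<zero>" by auto
  ultimately have "\<one> \<in> T" using nakayama[OF t(4,1,2) G'(1,2)] by blast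
  thus ?thesis by (simp add: stable_module_def T_def J_def E_def)
qed

end

section \<open>Dimension of stable Mori domains\<close>

context quotient_field
begin

lemma fractional_ideal_integral:
  assumes "module_over R I" "I \<subseteq> R" shows "fractional_ideal K R I"
  unfolding fractional_ideal_iff using assms bounded_mono[OF bounded_R] by blast

text \<open>
  With \<open>I\<^sub>k = P + Rx\<^sup>k\<close>, \<open>E\<^sub>k = (I\<^sub>k:I\<^sub>k)\<close>, \<open>J\<^sub>k = (E\<^sub>k:I\<^sub>k)\<close> and \<open>0 \<noteq> b \<in> P\<close>, all sets \<open>b\<^sup>2J\<^sub>k\<close> lie in \<open>R\<close>, as \<open>b\<close>
  belongs to every \<open>I\<^sub>k\<close> and \<open>J\<^sub>kI\<^sub>kI\<^sub>k \<subseteq> I\<^sub>k\<close>. A finite part of their union decides which elements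
  multiply the union into \<open>R\<close>; it only meets \<open>J\<^sub>k\<close> for \<open>k \<le> L\<close>, and \<open>x\<^bsup>2L\<^esup>\<close> is in \<open>I\<^sub>kI\<^sub>k\<close> for these \<open>k\<close>.
\<close>

theorem stable_mori_dimension:
  assumes M: "mori K R"
    and st: "\<And>I. fractional_ideal K R I \<Longrightarrow> I \<noteq> {\<zero>} \<Longrightarrow> stable_module I"
  shows "dimension_le_one R"
  unfolding dimension_le_one_def
proof (intro allI impI)
  fix P N assume "prime_in R P \<and> prime_in R N \<and> P \<noteq> {\<zero>} \<and> P \<subseteq> N"
  hence PN: "prime_in R P" "prime_in R N" "P \<noteq> {\<zero>}" "P \<subseteq> N" by auto
  note p = prime_inD[OF PN(1)] and n = prime_inD[OF PN(2)]
  note pm = module_overD[OF p(1)] and nm = module_overD[OF n(1)]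
  show "P = N"
  proof (rule ccontr)
    assume "P \<noteq> N"
    then obtain x where x: "x \<in> N" "x \<notin> P" using PN(4) by blast
    have xR: "x \<in> R" "x \<in> carrier K" using x n(2) R_closed(1) by auto
    note pow = prime_in_power[OF R_subring PN(1) xR(1) x(2)]
    obtain b where b: "b \<in> P" "b \<noteq> \<zero>" using PN(3) pm(3) by blast
    have bc: "b \<in> carrier K" using b pm(2) by auto
    define I where "I k = adjoin R P (x [^] (k::nat))" for k
    define J where "J k = (I k \<oslash> I k) \<oslash> I k" for k
    have xk: "x [^] (k::nat) \<in> carrier K" "x [^] k \<in> R" for k using pow R_closed(1) by auto
    have I: "module_over R (I k)" "P \<subseteq> I k" "x [^] k \<in> I k" "I k \<subseteq> R" for k
      unfolding I_def using module_adjoin[OF R_subring p(1) xk(1)]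
        adjoin_subset[OF R_subring p(2) subring_module[OF R_subring] xk(2)] by auto
    have Ifr: "fractional_ideal K R (I k)" "I k \<noteq> {\<zero>}" for k
      using fractional_ideal_integral[OF I(1,4)] I(2)[of k] b by auto
    note t = trace_ideal[OF Ifr]
    have jc: "J k \<subseteq> carrier K" for k unfolding J_def by (rule colon_subset)
    have JII: "j \<otimes> u \<otimes> v \<in> I k" if "j \<in> J k" "u \<in> I k" "v \<in> I k" for j u v k
      using that by (auto simp: J_def colon_def)
    define a where "a = b \<otimes> b"
    have a: "a \<in> carrier K" "a \<noteq> \<zero>" unfolding a_def using b(2) bc by (auto simp: integral_iff)
    define A where "A = (\<Union>k. (\<lambda>j. a \<otimes> j) ` J k)"
    have AR: "A \<subseteq> R"
    proof
      fix z assume "z \<in> A"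
      then obtain k j where j: "j \<in> J k" "z = a \<otimes> j" by (auto simp: A_def)
      have bI: "b \<in> I k" using b I(2) by blast
      have "j \<in> carrier K" using j(1) jc by blast
      hence "z = j \<otimes> b \<otimes> b" unfolding j(2) a_def using bc by (simp add: m_ac)
      thus "z \<in> R" using JII[OF j(1) bI bI] I(4) by blast
    qed
    \<comment> \<open>The Mori property needs a nonzero element of the union.\<close>
    have "\<one> \<in> J 0" unfolding J_def using I(4)[of 0] t(5)[of 0] R_closed(1) by (auto simp: colon_def subset_iff)
    hence aA: "a \<in> A" unfolding A_def using a(1) by (auto intro!: image_eqI[of _ _ \<one>])
    obtain G where G: "G \<subseteq> A" "finite G" "R \<oslash> G \<subseteq> R \<oslash> A"
      using mori_finite_subset[OF R_subring M AR aA a(2)] by blast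
    have "\<exists>f. \<forall>g\<in>G. g \<in> (\<lambda>j. a \<otimes> j) ` J (f g)" using G(1) unfolding A_def by (intro bchoice) blast
    then obtain f where f: "\<And>g. g \<in> G \<Longrightarrow> g \<in> (\<lambda>j. a \<otimes> j) ` J (f g)" by blast
    define L where "L = Max (insert 0 (f ` G))"
    have L: "f g \<le> L" if "g \<in> G" for g unfolding L_def using G(2) that by (intro Max_ge) auto
    \<comment> \<open>The factor \<open>inv a\<close> undoes the multiplication by \<open>a\<close> that placed the sets \<open>J k\<close> in \<open>R\<close>.\<close>
    define y where "y = x [^] (2 * L) \<otimes> inv a"
    have au: "a \<in> Units K" using a field_Units by auto
    have ia: "inv a \<in> carrier K" using au by simp
    have yc: "y \<in> carrier K" unfolding y_def using xk ia by auto
    have ya: "y \<otimes> (a \<otimes> j) = x [^] (2 * L) \<otimes> j" if "j \<in> carrier K" for j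
    proof -
      have "y \<otimes> (a \<otimes> j) = x [^] (2 * L) \<otimes> ((inv a \<otimes> a) \<otimes> j)"
        unfolding y_def using xk(1) ia a(1) that by (simp add: m_assoc)
      thus ?thesis using au that by simp
    qed
    have "y \<otimes> g \<in> R" if g: "g \<in> G" for g
    proof -
      obtain j where j: "j \<in> J (f g)" "g = a \<otimes> j" using f[OF g] by blast
      have jK: "j \<in> carrier K" using j(1) jc by blast
      have e: "2 * L = (2 * L - 2 * f g) + f g + f g" using L[OF g] by simp
      have "y \<otimes> g = x [^] (2 * L) \<otimes> j" unfolding j(2) by (rule ya[OF jK])
      also have "x [^] (2 * L) = x [^] (2 * L - 2 * f g) \<otimes> x [^] f g \<otimes> x [^] f g"
        by (subst e) (simp add: nat_pow_mult xR(2))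
      also have "\<dots> \<otimes> j = x [^] (2 * L - 2 * f g) \<otimes> (j \<otimes> x [^] f g \<otimes> x [^] f g)"
        using xk(1) jK by (simp add: m_ac)
      also have "\<dots> \<in> R" using R_closed(6)[OF xk(2)] JII[OF j(1) I(3) I(3)] I(4) by blast
      finally show ?thesis .
    qed
    hence "y \<in> R \<oslash> G" using yc by (auto simp: colon_def)
    hence "y \<in> R \<oslash> A" using G(3) by blast
    have xJ: "x [^] (2 * L) \<otimes> j \<in> R" if j: "j \<in> J k" for j k
    proof -
      have "a \<otimes> j \<in> A" using j by (auto simp: A_def)
      hence "y \<otimes> (a \<otimes> j) \<in> R" using \<open>y \<in> R \<oslash> A\<close> by (auto simp: colon_def)
      moreover have "j \<in> carrier K" using j jc by blast
      ultimately show ?thesis using ya by simp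
    qed
    \<comment> \<open>One more than the exponent of \<open>x\<close>, so that \<open>x [^] (2 * L) \<in> I m\<close> cancels to a unit modulo \<open>P\<close>.\<close>
    define m where "m = Suc (2 * L)"
    note im = module_overD[OF I(1)[of m]]
    have "I m \<cdot> J m \<subseteq> I m \<oslash> {x [^] (2 * L)}"
    proof (rule ideal_prod_le)
      show "group_in (I m \<oslash> {x [^] (2 * L)})" by (rule colon_group[OF im(1)]) (use xk in auto)
      fix i j assume i: "i \<in> I m" and j: "j \<in> J m"
      have c: "i \<in> carrier K" "j \<in> carrier K" using i j im(2) jc by auto
      have "i \<otimes> j \<otimes> x [^] (2 * L) = (x [^] (2 * L) \<otimes> j) \<otimes> i" using c xk(1) by (simp add: m_ac)
      also have "\<dots> \<in> I m" by (rule im(7)[OF xJ[OF j] i])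
      finally show "i \<otimes> j \<in> I m \<oslash> {x [^] (2 * L)}" using c by (auto simp: colon_def)
    qed
    hence "\<one> \<otimes> x [^] (2 * L) \<in> I m"
      using st[OF Ifr(1,2)[of m]] by (auto simp: stable_module_def J_def colon_def)
    hence "x [^] (2 * L) \<in> I m" using xk(1) by simp
    then obtain q e where q: "x [^] (2 * L) = q \<oplus> e \<otimes> x [^] m" "q \<in> P" "e \<in> R"
      by (auto simp: I_def adjoin_def)
    have c: "q \<in> carrier K" "e \<in> carrier K" using q(2,3) pm(2) R_closed(1) by auto
    have pw: "x [^] m = x [^] (2 * L) \<otimes> x" by (simp add: m_def)
    have "x [^] (2 * L) \<otimes> (\<one> \<ominus> e \<otimes> x) = x [^] (2 * L) \<ominus> e \<otimes> x [^] m"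
      unfolding pw using c xk(1)[of "2 * L"] xR(2) by algebra
    also have "\<dots> = q" unfolding q(1) using c xk(1)[of m] by algebra
    finally have "x [^] (2 * L) \<otimes> (\<one> \<ominus> e \<otimes> x) \<in> P" using q(2) by simp
    moreover have ex: "e \<otimes> x \<in> R" by (rule R_closed(6)[OF q(3) xR(1)])
    moreover have "\<one> \<ominus> e \<otimes> x \<in> R" by (rule group_inD(5)[OF subring_group_in[OF R_subring] R_closed(3) ex])
    ultimately have "\<one> \<ominus> e \<otimes> x \<in> P" using p(4) pow by blast
    hence "\<one> \<ominus> e \<otimes> x \<in> N" using PN(4) by blast
    moreover have "e \<otimes> x \<in> N" by (rule nm(7)[OF q(3) x(1)])
    moreover have "\<one> = (\<one> \<ominus> e \<otimes> x) \<oplus> e \<otimes> x" using c xR(2) by algebra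
    ultimately have "\<one> \<in> N" using nm(4) by metis
    thus False using n(3) by blast
  qed
qed

end

section \<open>Invertibility of all ideals\<close>

context ambient_field
begin

definition invertible_in :: "'a set \<Rightarrow> 'a set \<Rightarrow> bool" where
  "invertible_in E A \<longleftrightarrow> \<one> \<in> A \<cdot> (E \<oslash> A)"

text \<open>
  A maximal noninvertible ideal \<open>P\<close> is prime. For \<open>ab \<in> P\<close> with \<open>a, b \<notin> P\<close>, the ideal
  \<open>B = P + Ea\<close> is invertible with inverse \<open>H\<close>, and \<open>PH\<close> is an ideal that contains \<open>P\<close> and \<open>b\<close>. So
  \<open>PH\<close> is invertible too, and with it \<open>P\<close>. Zorn's lemma applies because an equation witnessing that a
  union of a chain is invertible already holds in a member of the chain.
\<close>

lemma invertible_if_primes_invertible: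
  assumes E: "subring E K"
    and pr: "\<And>Q. prime_in E Q \<Longrightarrow> Q \<noteq> {\<zero>} \<Longrightarrow> invertible_in E Q"
    and A: "module_over E A" "A \<subseteq> E" "A \<noteq> {\<zero>}"
  shows "invertible_in E A"
proof (rule ccontr)
  assume nA: "\<not> invertible_in E A"
  note e = subringE[OF E]
  define F where "F = {A. module_over E A \<and> A \<subseteq> E \<and> A \<noteq> {\<zero>} \<and> \<not> invertible_in E A}"
  have "\<exists>M\<in>F. \<forall>B\<in>F. M \<subseteq> B \<longrightarrow> B = M"
  proof (rule subset_Zorn_nonempty)
    show "F \<noteq> {}" using A nA unfolding F_def by blast
    fix C assume C: "C \<noteq> {}" "subset.chain F C"
    hence CF: "C \<subseteq> F" by (auto simp: subset.chain_def)
    have m: "module_over E (\<Union>C)"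
      by (rule module_over_Union_chain[OF E C(1)]) (use CF C(2) in \<open>auto simp: F_def subset_chain_def\<close>)
    have sub: "\<Union>C \<subseteq> E" using CF unfolding F_def by blast
    obtain B where B: "B \<in> C" using C(1) by blast
    hence Bm: "module_over E B" "B \<noteq> {\<zero>}" using CF by (auto simp: F_def)
    hence "\<exists>b\<in>B. b \<noteq> \<zero>" using module_overD(3) by blast
    hence ne: "\<Union>C \<noteq> {\<zero>}" using B by blast
    have "\<not> invertible_in E (\<Union>C)"
    proof
      assume "invertible_in E (\<Union>C)"
      then obtain G where G: "G \<subseteq> \<Union>C" "finite G" "\<one> \<in> G \<cdot> (E \<oslash> \<Union>C)"
        unfolding invertible_in_def using ideal_prod_finite by blast
      obtain B where B: "B \<in> C" "G \<subseteq> B" using finite_subset_Union_chain[OF G(2,1) C(1) C(2)] by blast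
      have "G \<cdot> (E \<oslash> \<Union>C) \<subseteq> B \<cdot> (E \<oslash> B)"
        using B by (intro ideal_prod_mono colon_antimono) auto
      hence "invertible_in E B" using G(3) unfolding invertible_in_def by blast
      thus False using B CF by (auto simp: F_def)
    qed
    thus "\<Union>C \<in> F" using m sub ne by (simp add: F_def)
  qed
  then obtain P where P: "P \<in> F" and max: "\<And>B. B \<in> F \<Longrightarrow> P \<subseteq> B \<Longrightarrow> B = P" by blast
  have Pm: "module_over E P" "P \<subseteq> E" "P \<noteq> {\<zero>}" "\<not> invertible_in E P" using P by (auto simp: F_def)
  note p = module_overD[OF Pm(1)]
  obtain p0 where p0: "p0 \<in> P" "p0 \<noteq> \<zero>" using Pm(3) p(3) by blast
  have one: "\<one> \<in> E \<oslash> B" if "B \<subseteq> E" for B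
  proof -
    have "\<one> \<otimes> z \<in> E" if "z \<in> B" for z using that \<open>B \<subseteq> E\<close> e(1) by (auto simp: subset_iff)
    thus ?thesis by (auto simp: colon_def)
  qed
  have bigger: "invertible_in E B" if "module_over E B" "B \<subseteq> E" "P \<subseteq> B" "B \<noteq> P" for B
    using max[of B] that p0 unfolding F_def by blast
  have "\<one> \<notin> P"
  proof
    assume "\<one> \<in> P"
    hence "\<one> \<otimes> \<one> \<in> P \<cdot> (E \<oslash> P)" by (rule ideal_prod.prod) (rule one[OF Pm(2)])
    thus False using Pm(4) by (simp add: invertible_in_def)
  qed
  moreover have "a \<in> P \<or> b \<in> P" if ab: "a \<in> E" "b \<in> E" "a \<otimes> b \<in> P" for a b
  proof (rule ccontr)
    assume n: "\<not> ?thesis"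
    have abc: "a \<in> carrier K" "b \<in> carrier K" using ab e(1) by auto
    define B where "B = adjoin E P a"
    note ad = module_adjoin[OF E Pm(1) abc(1), folded B_def]
    have BE: "B \<subseteq> E" unfolding B_def
      by (rule adjoin_subset[OF E Pm(2) subring_module[OF E] ab(1)]) auto
    have Bi: "invertible_in E B" by (rule bigger[OF ad(1) BE ad(2)]) (use ad(3) n in blast)
    define H where "H = E \<oslash> B"
    have hc: "H \<subseteq> carrier K" unfolding H_def by (rule colon_subset)
    have h1: "\<one> \<in> H" unfolding H_def by (rule one[OF BE])
    define C where "C = P \<cdot> H"
    have Cm: "module_over E C" unfolding C_def
      by (rule module_prod[OF Pm(1) hc _ e(1)]) (use h1 in auto)
    have "C \<subseteq> B \<cdot> H" unfolding C_def by (rule ideal_prod_mono[OF ad(2)]) auto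
    also have "\<dots> \<subseteq> E" unfolding H_def
      by (rule prod_colon_le[OF subring_group_in[OF E] module_overD(2)[OF ad(1)]])
    finally have CE: "C \<subseteq> E" .
    have PC: "P \<subseteq> C" unfolding C_def by (rule subset_prod_left[OF p(2) h1])
    have "B \<cdot> H \<subseteq> C \<oslash> {b}"
    proof (rule ideal_prod_le)
      show "group_in (C \<oslash> {b})" by (rule colon_group[OF module_overD(1)[OF Cm]]) (use abc in auto)
      fix i h assume i: "i \<in> B" and h: "h \<in> H"
      obtain q d where q: "i = q \<oplus> d \<otimes> a" "q \<in> P" "d \<in> E" using i by (auto simp: B_def adjoin_def)
      have c: "q \<in> carrier K" "d \<in> carrier K" "h \<in> carrier K" using q(2,3) h p(2) e(1) hc by auto
      have "b \<otimes> i = b \<otimes> q \<oplus> d \<otimes> (a \<otimes> b)" unfolding q(1) using c abc by algebra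
      hence "b \<otimes> i \<in> P" using p(4)[OF p(7)[OF ab(2) q(2)] p(7)[OF q(3) ab(3)]] by simp
      hence "(b \<otimes> i) \<otimes> h \<in> C" unfolding C_def by (rule ideal_prod.prod[OF _ h])
      moreover have ic: "i \<in> carrier K" using i module_overD(2)[OF ad(1)] by blast
      moreover have "i \<otimes> h \<otimes> b = (b \<otimes> i) \<otimes> h" using ic c abc by (simp add: m_ac)
      ultimately show "i \<otimes> h \<in> C \<oslash> {b}" using c by (auto simp: colon_def)
    qed
    hence "\<one> \<otimes> b \<in> C" using Bi unfolding invertible_in_def H_def colon_def by blast
    hence "b \<in> C" using abc by simp
    hence "C \<noteq> P" using n by blast
    hence Ci: "invertible_in E C" by (rule bigger[OF Cm CE PC])
    have cc: "C \<subseteq> carrier K" by (rule module_overD(2)[OF Cm])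
    define L where "L = E \<oslash> C"
    have lc: "L \<subseteq> carrier K" unfolding L_def by (rule colon_subset)
    have hl: "H \<cdot> L \<subseteq> carrier K" by (rule ideal_prod_subset_carrier[OF hc lc])
    have eq: "C \<cdot> L = P \<cdot> (H \<cdot> L)" unfolding C_def by (rule ideal_prod_assoc[OF p(2) hc lc])
    have CL: "C \<cdot> L \<subseteq> E" unfolding L_def by (rule prod_colon_le[OF subring_group_in[OF E] cc])
    have "H \<cdot> L \<subseteq> E \<oslash> P"
      using le_colon_iff[OF subring_group_in[OF E] hl, of P] CL eq ideal_prod_comm[OF p(2) hl] by simp
    hence "P \<cdot> (H \<cdot> L) \<subseteq> P \<cdot> (E \<oslash> P)" by (intro ideal_prod_mono) auto
    hence "invertible_in E P" using Ci eq unfolding invertible_in_def L_def by auto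
    thus False using Pm(4) by blast
  qed
  ultimately have "prime_in E P" unfolding prime_in_def using Pm by blast
  thus False using pr Pm(3,4) by blast
qed

text \<open>
  The union of an ascending chain is invertible, hence finitely generated, hence a member of the
  chain.
\<close>

lemma mori_if_ideals_invertible:
  assumes E: "subring E K"
    and inv: "\<And>A. module_over E A \<Longrightarrow> A \<subseteq> E \<Longrightarrow> A \<noteq> {\<zero>} \<Longrightarrow> invertible_in E A"
  shows "mori K E"
  unfolding mori_def
proof (intro allI impI)
  fix I :: "nat \<Rightarrow> 'a set"
  assume *: "\<forall>n. ideal (I n) (K\<lparr>carrier := E\<rparr>) \<and> divisorial K E (I n) \<and> I n \<subseteq> I (Suc n)"
  have I: "module_over E (I n)" "I n \<subseteq> E" "I n \<noteq> {\<zero>}" for n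
    using * ideal_iff_module_over[OF E] unfolding divisorial_def by blast+
  have mono: "I m \<subseteq> I n" if "m \<le> n" for m n using lift_Suc_mono_le[of I, OF _ that] * by blast
  define U where "U = (\<Union>n. I n)"
  have "module_over E U" unfolding U_def
  proof (rule module_over_Union_chain[OF E])
    fix A B assume "A \<in> range I" "B \<in> range I"
    then obtain m n where "A = I m" "B = I n" by blast
    thus "A \<subseteq> B \<or> B \<subseteq> A" using mono[of m n] mono[of n m] nat_le_linear[of m n] by blast
  qed (use I in auto)
  moreover have "U \<subseteq> E" unfolding U_def using I by blast
  moreover have "U \<noteq> {\<zero>}"
  proof -
    have "\<exists>u\<in>I 0. u \<noteq> \<zero>" using I(1,3)[of 0] module_overD(3) by blast
    thus ?thesis unfolding U_def by blast
  qed
  ultimately have "invertible_in E U" by (rule inv)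
  then obtain G where G: "G \<subseteq> U" "finite G" "\<one> \<in> G \<cdot> (E \<oslash> U)"
    unfolding invertible_in_def using ideal_prod_finite by blast
  have "\<exists>f. \<forall>g\<in>G. g \<in> I (f g)" using G(1) unfolding U_def by (intro bchoice) blast
  then obtain f where f: "\<And>g. g \<in> G \<Longrightarrow> g \<in> I (f g)" by blast
  define N where "N = Max (insert 0 (f ` G))"
  have GN: "G \<subseteq> I N"
  proof
    fix g assume g: "g \<in> G"
    have "f g \<le> N" unfolding N_def using G(2) g by (intro Max_ge) auto
    thus "g \<in> I N" using f[OF g] mono by blast
  qed
  note m = module_overD[OF I(1)[of N]]
  have "U \<subseteq> I N"
  proof
    fix x assume x: "x \<in> U"
    hence xc: "x \<in> carrier K" using \<open>U \<subseteq> E\<close> subringE(1)[OF E] by blast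
    have "G \<cdot> (E \<oslash> U) \<subseteq> I N \<oslash> {x}"
    proof (rule ideal_prod_le)
      show "group_in (I N \<oslash> {x})" by (rule colon_group[OF m(1)]) (use xc in auto)
      fix g h assume g: "g \<in> G" and h: "h \<in> E \<oslash> U"
      have c: "g \<in> carrier K" "h \<in> carrier K" using g GN m(2) h by (auto simp: colon_def)
      have "h \<otimes> x \<in> E" using h x by (auto simp: colon_def)
      hence "(h \<otimes> x) \<otimes> g \<in> I N" using m(7) g GN by blast
      moreover have "g \<otimes> h \<otimes> x = (h \<otimes> x) \<otimes> g" using c xc by (simp add: m_ac)
      ultimately show "g \<otimes> h \<in> I N \<oslash> {x}" using c by (auto simp: colon_def)
    qed
    hence "\<one> \<otimes> x \<in> I N" using G(3) by (auto simp: colon_def)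
    thus "x \<in> I N" using xc by simp
  qed
  hence "\<forall>n\<ge>N. I n = I N" using mono unfolding U_def by blast
  thus "\<exists>N. \<forall>n\<ge>N. I n = I N" by blast
qed

end

section \<open>The complete integral closure of a stable domain\<close>

locale stable_one_dimensional = quotient_field +
  assumes dimR: "dimension_le_one R"
    and stab: "\<And>I. fractional_ideal K R I \<Longrightarrow> I \<noteq> {\<zero>} \<Longrightarrow> stable_module I"
begin

lemma fs: finitely_stable
  unfolding finitely_stable_def using stab fractional_ideal_span span_nonzero by metis

end

text \<open>
  A nonzero prime \<open>Q\<close> of \<open>D\<close>, with contraction \<open>M\<close> to \<open>R\<close> and \<open>B = MD\<close>. Modulo \<open>B\<close> the ring \<open>D\<close> is an
  algebra over the field \<open>R/M\<close> in which every subspace containing \<open>1\<close> is a subring; the lemmas of this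
  locale describe such algebras in terms of representatives.
\<close>

locale closure_prime = stable_one_dimensional +
  fixes Q
  assumes Q: "prime_in D Q" "Q \<noteq> {\<zero>}"
begin

definition M where "M = Q \<inter> R"

definition B where "B = M \<cdot> D"

lemmas Qd = prime_inD[OF Q(1)]
lemmas Qm = module_overD[OF Qd(1)]
lemmas D_closed = subringE[OF D_subring]

lemma D_carrier: "x \<in> D \<Longrightarrow> x \<in> carrier K"
  using D_closed(1) by blast

lemma M_prime: "prime_in R M"
  unfolding M_def by (rule prime_in_contract[OF R_subring R_subset_D Q(1) D_closed(1)])

lemma M_nonzero: "M \<noteq> {\<zero>}"
  unfolding M_def
  by (rule contract_nonzero[OF R_subring R_subset_D closure_quadratic[OF dimR fs] D_subring Qd(1,2) Q(2)])

lemma M_contract: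
  assumes "prime_in D N" "M \<subseteq> N" shows "N \<inter> R = M"
proof -
  have "prime_in R (N \<inter> R)" by (rule prime_in_contract[OF R_subring R_subset_D assms(1) D_closed(1)])
  moreover have "M \<subseteq> N \<inter> R" using assms(2) by (auto simp: M_def)
  ultimately show ?thesis using dimR M_prime M_nonzero unfolding dimension_le_one_def by blast
qed

lemma B_module: "module_over D B"
proof -
  have "module_over D (D \<cdot> M)"
    by (rule module_prod[OF subring_module[OF D_subring]])
      (use module_overD(2,3)[OF prime_inD(1)[OF M_prime]] D_closed(1) in auto)
  moreover have "D \<cdot> M = M \<cdot> D"
    by (rule ideal_prod_comm[OF D_closed(1) module_overD(2)[OF prime_inD(1)[OF M_prime]]])
  ultimately show ?thesis by (simp add: B_def)
qed

lemmas Bm = module_overD[OF B_module]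

lemma M_subset_B: "M \<subseteq> B"
  unfolding B_def by (rule subset_prod_left[OF module_overD(2)[OF prime_inD(1)[OF M_prime]] D_closed(3)])

lemma B_subset:
  assumes "prime_in D N" "M \<subseteq> N" shows "B \<subseteq> N"
  unfolding B_def
proof (rule ideal_prod_le)
  note n = module_overD[OF prime_inD(1)[OF assms(1)]]
  show "group_in N" by (rule n(1))
  show "a \<otimes> b \<in> N" if "a \<in> M" "b \<in> D" for a b
    by (rule n(8)[OF that(2) _ D_closed(1)]) (use that(1) assms(2) in blast)
qed

text \<open>
  The shadow, visible at the primes above \<open>M\<close>, of being idempotent modulo \<open>B\<close>.
\<close>

definition idempotent_mod :: "'a \<Rightarrow> bool" where
  "idempotent_mod e \<longleftrightarrow> e \<in> Q \<and> (\<forall>N. prime_in D N \<and> M \<subseteq> N \<longrightarrow> e \<in> N \<or> \<one> \<ominus> e \<in> N)"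

lemma not_both:
  assumes "prime_in D N" "e \<in> N" "\<one> \<ominus> e \<in> N" shows False
proof -
  note n = prime_inD[OF assms(1)]
  have "e \<in> carrier K" using assms(2) n(2) D_carrier by blast
  hence "\<one> = (\<one> \<ominus> e) \<oplus> e" by algebra
  thus False using module_overD(4)[OF n(1) assms(3,2)] n(3) by simp
qed

text \<open>
  In \<open>z\<^sup>2 = az + b\<close> with \<open>z \<in> Q - N\<close> the coefficient \<open>b\<close> lies in \<open>M\<close> and \<open>a\<close> does not, since otherwise
  \<open>z\<^sup>2 \<in> N\<close>. So \<open>z/a\<close>, formed modulo \<open>M\<close>, is idempotent.
\<close>

lemma exists_idempotent:
  assumes N: "prime_in D N" "M \<subseteq> N" "N \<noteq> Q"
  shows "\<exists>e. idempotent_mod e \<and> e \<notin> N"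
proof -
  note n = prime_inD[OF N(1)] and nm = module_overD[OF prime_inD(1)[OF N(1)]]
  have "\<not> Q \<subseteq> N" using closure_dimension[OF dimR fs] Q N unfolding dimension_le_one_def by blast
  then obtain z where z: "z \<in> Q" "z \<notin> N" by blast
  have zD: "z \<in> D" using z Qd(2) by blast
  obtain a b where ab: "a \<in> R" "b \<in> R" "z \<otimes> z = a \<otimes> z \<oplus> b"
    using quadratic_overD[OF closure_quadratic[OF dimR fs] zD] by blast
  have c: "z \<in> carrier K" "a \<in> carrier K" "b \<in> carrier K" using zD D_carrier ab(1,2) R_closed(1) by auto
  have aD: "a \<in> D" "b \<in> D" using ab R_subset_D by auto
  have "b = z \<otimes> z \<ominus> a \<otimes> z" unfolding ab(3) using c by algebra
  hence "b \<in> Q" using Qm(6)[OF Qm(7)[OF zD z(1)] Qm(7)[OF aD(1) z(1)]] by simp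
  hence bM: "b \<in> M" using ab by (simp add: M_def)
  have "a \<notin> M"
  proof
    assume "a \<in> M"
    hence "a \<in> N" "b \<in> N" using bM N(2) by auto
    hence "z \<otimes> z \<in> N" unfolding ab(3) using nm(4)[OF nm(8)[OF zD _ D_closed(1)]] zD c m_comm by metis
    thus False using n(4)[OF zD zD] z(2) by blast
  qed
  then obtain a' where a': "a' \<in> R" "\<one> \<ominus> a \<otimes> a' \<in> M"
    using inverse_modulo_prime[OF R_subring dimR M_prime M_nonzero ab(1)] by blast
  have a'c: "a' \<in> carrier K" "a' \<in> D" using a'(1) R_closed(1) R_subset_D by auto
  define e where "e = a' \<otimes> z"
  have eQ: "e \<in> Q" unfolding e_def by (rule Qm(7)[OF a'c(2) z(1)])
  have "a' \<notin> N"
  proof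
    assume "a' \<in> N"
    hence "a \<otimes> a' \<in> N" by (rule nm(7)[OF aD(1)])
    moreover have "\<one> \<ominus> a \<otimes> a' \<in> N" using a'(2) N(2) by blast
    ultimately show False using not_both[OF N(1)] by blast
  qed
  hence eN: "e \<notin> N" unfolding e_def using n(4)[OF a'c(2) zD] z(2) by blast
  have eD: "e \<in> D" "\<one> \<ominus> e \<in> D"
    using eQ Qd(2) group_inD(5)[OF subring_group_in[OF D_subring] D_closed(3)] by auto
  have "e \<otimes> (\<one> \<ominus> e) = a' \<otimes> z \<ominus> a' \<otimes> a' \<otimes> (z \<otimes> z)"
    unfolding e_def using c a'c(1) by algebra
  also have "\<dots> = (a' \<otimes> z) \<otimes> (\<one> \<ominus> a \<otimes> a') \<ominus> (a' \<otimes> a') \<otimes> b"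
    unfolding ab(3) using c a'c(1) by algebra
  finally have ee: "e \<otimes> (\<one> \<ominus> e) = e \<otimes> (\<one> \<ominus> a \<otimes> a') \<ominus> (a' \<otimes> a') \<otimes> b" by (simp add: e_def)
  have "e \<otimes> (\<one> \<ominus> e) \<in> B" unfolding ee
    using Bm(6)[OF Bm(7)[OF eD(1)] Bm(7)] a'(2) bM M_subset_B D_closed(6)[OF a'c(2,2)] by blast
  hence "e \<in> N' \<or> \<one> \<ominus> e \<in> N'" if "prime_in D N'" "M \<subseteq> N'" for N'
    using prime_inD(4)[OF that(1) eD] B_subset[OF that] by blast
  thus ?thesis using eQ eN unfolding idempotent_mod_def by blast
qed

lemma idempotent_join:
  assumes e: "idempotent_mod e" and f: "idempotent_mod f"
  defines "g \<equiv> e \<oplus> f \<ominus> e \<otimes> f"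
  shows "idempotent_mod g"
    and "\<And>N. prime_in D N \<Longrightarrow> \<one> \<ominus> e \<in> N \<or> \<one> \<ominus> f \<in> N \<Longrightarrow> \<one> \<ominus> g \<in> N"
proof -
  have Q': "e \<in> Q" "f \<in> Q" using e f by (auto simp: idempotent_mod_def)
  hence D': "e \<in> D" "f \<in> D" using Qd(2) by auto
  have c: "e \<in> carrier K" "f \<in> carrier K" using D' D_carrier by auto
  have D1: "\<one> \<ominus> e \<in> D" "\<one> \<ominus> f \<in> D"
    using D' group_inD(5)[OF subring_group_in[OF D_subring] D_closed(3)] by auto
  have g1: "\<one> \<ominus> g = (\<one> \<ominus> e) \<otimes> (\<one> \<ominus> f)" unfolding g_def using c by algebra
  show 1: "\<one> \<ominus> g \<in> N" if N: "prime_in D N" and "\<one> \<ominus> e \<in> N \<or> \<one> \<ominus> f \<in> N" for N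
    using that(2) module_overD(7)[OF prime_inD(1)[OF N] D1(1)]
      module_overD(8)[OF prime_inD(1)[OF N] D1(2) _ D_closed(1)] unfolding g1 by blast
  have gin: "g \<in> N" if "module_over D N" "e \<in> N" "f \<in> N" for N
    unfolding g_def using module_overD(6)[OF that(1) module_overD(4)[OF that] module_overD(7)[OF that(1) D'(1) that(3)]] .
  show "idempotent_mod g" unfolding idempotent_mod_def
  proof (intro conjI allI impI)
    show "g \<in> Q" by (rule gin[OF Qd(1) Q'])
    fix N assume N: "prime_in D N \<and> M \<subseteq> N"
    show "g \<in> N \<or> \<one> \<ominus> g \<in> N"
    proof (cases "e \<in> N \<and> f \<in> N")
      case True thus ?thesis using gin[OF prime_inD(1)] N by blast
    next
      case False thus ?thesis using 1 N e f unfolding idempotent_mod_def by blast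
    qed
  qed
qed

text \<open>
  Otherwise joining idempotents builds \<open>e\<^sub>1, e\<^sub>2, e\<^sub>3 \<in> Q\<close> and primes \<open>N\<^sub>1, N\<^sub>2, N\<^sub>3\<close> above \<open>M\<close> such that \<open>e\<^sub>i\<close> is
  \<open>1\<close> modulo \<open>N\<^sub>j\<close> for \<open>j \<le> i\<close> and \<open>0\<close> modulo \<open>N\<^sub>j\<close> for \<open>j > i\<close>. Modulo \<open>(Q, N\<^sub>1, N\<^sub>2, N\<^sub>3)\<close> the elements
  \<open>e\<^sub>2\<close> and \<open>y = e\<^sub>3 - e\<^sub>1\<close> become \<open>(0, 1, 1, 0)\<close> and \<open>(0, 0, 1, 1)\<close>. Their product \<open>(0, 0, 1, 0)\<close> is no
  combination of these and \<open>(1, 1, 1, 1)\<close>, against \<open>closure_product\<close>. In effect there are at most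
  three primes above \<open>M\<close>.
\<close>

lemma exists_separator:
  "\<exists>e\<in>Q. \<forall>N. prime_in D N \<and> M \<subseteq> N \<and> N \<noteq> Q \<longrightarrow> e \<notin> N"
proof (rule ccontr)
  assume "\<not> ?thesis"
  hence ex: "\<exists>N. prime_in D N \<and> M \<subseteq> N \<and> N \<noteq> Q \<and> e \<in> N" if "e \<in> Q" for e using that by blast
  obtain N1 where N1: "prime_in D N1" "M \<subseteq> N1" "N1 \<noteq> Q" using ex[OF Qm(3)] by blast
  obtain e1 where e1: "idempotent_mod e1" "e1 \<notin> N1" using exists_idempotent[OF N1] by blast
  have e1Q: "e1 \<in> Q" using e1(1) by (simp add: idempotent_mod_def)
  obtain N2 where N2: "prime_in D N2" "M \<subseteq> N2" "N2 \<noteq> Q" "e1 \<in> N2" using ex[OF e1Q] by blast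
  obtain f where f: "idempotent_mod f" "f \<notin> N2" using exists_idempotent[OF N2(1-3)] by blast
  define e2 where "e2 = e1 \<oplus> f \<ominus> e1 \<otimes> f"
  note e2 = idempotent_join[OF e1(1) f(1), folded e2_def]
  have e2Q: "e2 \<in> Q" using e2(1) by (simp add: idempotent_mod_def)
  obtain N3 where N3: "prime_in D N3" "M \<subseteq> N3" "N3 \<noteq> Q" "e2 \<in> N3" using ex[OF e2Q] by blast
  obtain g where g: "idempotent_mod g" "g \<notin> N3" using exists_idempotent[OF N3(1-3)] by blast
  define e3 where "e3 = e2 \<oplus> g \<ominus> e2 \<otimes> g"
  note e3 = idempotent_join[OF e2(1) g(1), folded e3_def]
  have e3Q: "e3 \<in> Q" using e3(1) by (simp add: idempotent_mod_def)
  have n11: "\<one> \<ominus> e1 \<in> N1" using e1 N1(1,2) by (auto simp: idempotent_mod_def)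
  have n21: "\<one> \<ominus> e2 \<in> N1" by (rule e2(2)[OF N1(1)]) (simp add: n11)
  have n31: "\<one> \<ominus> e3 \<in> N1" by (rule e3(2)[OF N1(1)]) (simp add: n21)
  have nf2: "\<one> \<ominus> f \<in> N2" using f N2(1,2) by (auto simp: idempotent_mod_def)
  have n22: "\<one> \<ominus> e2 \<in> N2" by (rule e2(2)[OF N2(1)]) (simp add: nf2)
  have n32: "\<one> \<ominus> e3 \<in> N2" by (rule e3(2)[OF N2(1)]) (simp add: n22)
  have ng3: "\<one> \<ominus> g \<in> N3" using g N3(1,2) by (auto simp: idempotent_mod_def)
  have n33: "\<one> \<ominus> e3 \<in> N3" by (rule e3(2)[OF N3(1)]) (simp add: ng3)
  have e1N3: "e1 \<in> N3"
  proof (rule ccontr)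
    assume "e1 \<notin> N3"
    hence "\<one> \<ominus> e1 \<in> N3" using e1(1) N3(1,2) by (auto simp: idempotent_mod_def)
    hence "\<one> \<ominus> e2 \<in> N3" by (intro e2(2)[OF N3(1)]) simp
    thus False using not_both[OF N3(1,4)] by blast
  qed
  have eD: "e1 \<in> D" "e2 \<in> D" "e3 \<in> D" using e1Q e2Q e3Q Qd(2) by auto
  hence ec: "e1 \<in> carrier K" "e2 \<in> carrier K" "e3 \<in> carrier K" using D_carrier by auto
  define y where "y = e3 \<ominus> e1"
  have yQ: "y \<in> Q" unfolding y_def by (rule Qm(6)[OF e3Q e1Q])
  have yD: "y \<in> D" using yQ Qd(2) by blast
  have yc: "y \<in> carrier K" using yD D_carrier by blast
  obtain r s t where rst: "r \<in> R" "s \<in> R" "t \<in> R" "e2 \<otimes> y = r \<oplus> s \<otimes> e2 \<oplus> t \<otimes> y"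
    using closure_product[OF dimR fs eD(2) yD] by blast
  have rD: "r \<in> D" "s \<in> D" "t \<in> D" using rst R_subset_D by auto
  have rc: "r \<in> carrier K" "s \<in> carrier K" "t \<in> carrier K" using rD D_carrier by auto
  have r': "r = e2 \<otimes> y \<ominus> s \<otimes> e2 \<ominus> t \<otimes> y" unfolding rst(4) using rc ec yc by algebra
  have s': "s \<otimes> e2 = e2 \<otimes> y \<ominus> r \<ominus> t \<otimes> y" unfolding rst(4) using rc ec yc by algebra
  have t': "t \<otimes> y = e2 \<otimes> y \<ominus> r \<ominus> s \<otimes> e2" unfolding rst(4) using rc ec yc by algebra
  \<comment> \<open>The coefficients \<open>r\<close>, \<open>s\<close> and \<open>t\<close> vanish modulo \<open>M\<close>, as seen at \<open>Q\<close>, \<open>N1\<close> and \<open>N3\<close>; \<open>N2\<close> gives the contradiction.\<close>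
  have "r \<in> Q" by (subst r') (rule Qm(6)[OF Qm(6)[OF Qm(7)[OF eD(2) yQ] Qm(7)[OF rD(2) e2Q]] Qm(7)[OF rD(3) yQ]])
  hence rM: "r \<in> M" using rst(1) by (simp add: M_def)
  note m1 = module_overD[OF prime_inD(1)[OF N1(1)]]
  note m2 = module_overD[OF prime_inD(1)[OF N2(1)]]
  note m3 = module_overD[OF prime_inD(1)[OF N3(1)]]
  have rN: "r \<in> N1" "r \<in> N2" "r \<in> N3" using rM N1(2) N2(2) N3(2) by auto
  have y1: "y \<in> N1"
  proof -
    have "y = (\<one> \<ominus> e1) \<ominus> (\<one> \<ominus> e3)" unfolding y_def using ec by algebra
    thus ?thesis using m1(6)[OF n11 n31] by simp
  qed
  have "s \<otimes> e2 \<in> N1"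
    by (subst s') (rule m1(6)[OF m1(6)[OF m1(7)[OF eD(2) y1] rN(1)] m1(7)[OF rD(3) y1]])
  hence "s \<in> N1" using prime_inD(4)[OF N1(1) rD(2) eD(2)] not_both[OF N1(1) _ n21] by blast
  hence sM: "s \<in> M" using M_contract[OF N1(1,2)] rst(2) by blast
  have y3: "y \<notin> N3"
  proof
    assume y: "y \<in> N3"
    have "\<one> = (\<one> \<ominus> e3) \<oplus> (y \<oplus> e1)" unfolding y_def using ec by algebra
    hence "\<one> \<in> N3" using m3(4)[OF n33 m3(4)[OF y e1N3]] by simp
    thus False using prime_inD(3)[OF N3(1)] by blast
  qed
  have "t \<otimes> y \<in> N3"
    by (subst t') (rule m3(6)[OF m3(6)[OF m3(8)[OF yD N3(4) D_closed(1)] rN(3)] m3(7)[OF rD(2) N3(4)]])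
  hence "t \<in> N3" using prime_inD(4)[OF N3(1) rD(3) yD] y3 by blast
  hence tM: "t \<in> M" using M_contract[OF N3(1,2)] rst(3) by blast
  have sN: "s \<in> N2" "t \<in> N2" using sM tM N2(2) by auto
  have "e2 \<otimes> y \<in> N2" unfolding rst(4)
    by (rule m2(4)[OF m2(4)[OF rN(2) m2(8)[OF eD(2) sN(1) D_closed(1)]] m2(8)[OF yD sN(2) D_closed(1)]])
  hence "y \<in> N2" using prime_inD(4)[OF N2(1) eD(2) yD] not_both[OF N2(1) _ n22] by blast
  moreover have "\<one> = (\<one> \<ominus> e3) \<oplus> (y \<oplus> e1)" unfolding y_def using ec by algebra
  ultimately have "\<one> \<in> N2" using m2(4)[OF n32 m2(4)[OF _ N2(4)]] by metis
  thus False using prime_inD(3)[OF N2(1)] by blast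
qed

text \<open>
  The part of \<open>D\<close> that is contained in the localization of \<open>C\<close> at \<open>Q\<close>.
\<close>

definition locally_in :: "'a set \<Rightarrow> 'a set" where
  "locally_in C = {y \<in> D. \<exists>u\<in>D. u \<notin> Q \<and> u \<otimes> y \<in> C}"

lemma locally_inI: "y \<in> D \<Longrightarrow> u \<in> D \<Longrightarrow> u \<notin> Q \<Longrightarrow> u \<otimes> y \<in> C \<Longrightarrow> y \<in> locally_in C"
  by (auto simp: locally_in_def)

lemma locally_in_mult:
  assumes C: "module_over D C" and y: "y \<in> locally_in C" and z: "z \<in> D"
  shows "y \<otimes> z \<in> locally_in C"
proof -
  obtain u where u: "y \<in> D" "u \<in> D" "u \<notin> Q" "u \<otimes> y \<in> C" using y by (auto simp: locally_in_def)
  have c: "u \<in> carrier K" "y \<in> carrier K" "z \<in> carrier K" using u z D_carrier by auto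
  have "u \<otimes> (y \<otimes> z) = z \<otimes> (u \<otimes> y)" using c by (simp add: m_ac)
  hence "u \<otimes> (y \<otimes> z) \<in> C" using module_overD(7)[OF C z u(4)] by simp
  thus ?thesis using locally_inI[OF D_closed(6)[OF u(1) z] u(2,3)] by blast
qed

lemma locally_in_cancel:
  assumes "u \<in> D" "u \<notin> Q" "y \<in> D" "u \<otimes> y \<in> locally_in C"
  shows "y \<in> locally_in C"
proof -
  obtain v where v: "v \<in> D" "v \<notin> Q" "v \<otimes> (u \<otimes> y) \<in> C" using assms(4) by (auto simp: locally_in_def)
  have "v \<otimes> (u \<otimes> y) = (v \<otimes> u) \<otimes> y" using v(1) assms(1,3) D_carrier by (simp add: m_assoc)
  thus ?thesis using v(3) locally_inI[OF assms(3) D_closed(6)[OF v(1) assms(1)]] Qd(4)[OF v(1) assms(1)] v(2) assms(2)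
    by auto
qed

text \<open>
  In \<open>x\<^sup>2 = ax + b\<close> with \<open>x \<in> Q\<close> the coefficient \<open>b\<close> is in \<open>M\<close>. If \<open>a\<close> were not in \<open>M\<close>, then \<open>x - a\<close> would be
  a unit at \<open>Q\<close> and \<open>(x - a)x = b\<close> would put \<open>x\<close> into \<open>B\<close> locally.
\<close>

lemma square_in_B:
  assumes x: "x \<in> Q" "x \<notin> locally_in B" shows "x \<otimes> x \<in> B"
proof -
  have xD: "x \<in> D" using x Qd(2) by blast
  obtain a b where ab: "a \<in> R" "b \<in> R" "x \<otimes> x = a \<otimes> x \<oplus> b"
    using quadratic_overD[OF closure_quadratic[OF dimR fs] xD] by blast
  have aD: "a \<in> D" "b \<in> D" using ab R_subset_D by auto
  have c: "x \<in> carrier K" "a \<in> carrier K" "b \<in> carrier K" using xD aD D_carrier by auto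
  have "b = x \<otimes> x \<ominus> a \<otimes> x" unfolding ab(3) using c by algebra
  hence "b \<in> Q" using Qm(6)[OF Qm(7)[OF xD x(1)] Qm(7)[OF aD(1) x(1)]] by simp
  hence bM: "b \<in> B" using ab M_subset_B by (auto simp: M_def)
  have "a \<in> M"
  proof (rule ccontr)
    assume "a \<notin> M"
    hence aQ: "a \<notin> Q" using ab(1) by (simp add: M_def)
    have "a = x \<ominus> (x \<ominus> a)" using c by algebra
    hence u: "x \<ominus> a \<notin> Q" using Qm(6)[OF x(1)] aQ by metis
    have uD: "x \<ominus> a \<in> D" by (rule group_inD(5)[OF subring_group_in[OF D_subring] xD aD(1)])
    have "(x \<ominus> a) \<otimes> x = x \<otimes> x \<ominus> a \<otimes> x" using c by algebra
    also have "\<dots> = b" unfolding ab(3) using c by algebra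
    finally show False using x(2) locally_inI[OF xD uD u] bM by simp
  qed
  hence "a \<otimes> x \<in> B" unfolding B_def by (rule ideal_prod.prod[OF _ xD])
  thus ?thesis unfolding ab(3) using Bm(4) bM by blast
qed

text \<open>
  The square of \<open>Q\<close> vanishes modulo \<open>B\<close> locally at \<open>Q\<close>. If neither factor is locally in \<open>B\<close>, then
  \<open>x\<^sup>2\<close> and \<open>y\<^sup>2\<close> are in \<open>B\<close>. In \<open>xy = r + sx + ty\<close>, multiplication by \<open>x\<close> shows \<open>txy \<in> B\<close> and
  multiplication by \<open>y\<close> shows \<open>sxy \<in> B\<close>; so \<open>xy\<close> is locally in \<open>B\<close> unless \<open>s, t \<in> M\<close>, and then it is in
  \<open>B\<close> outright.
\<close>

lemma product_locally_in_B:
  assumes x: "x \<in> Q" and y: "y \<in> Q" shows "x \<otimes> y \<in> locally_in B"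
proof (cases "x \<in> locally_in B \<or> y \<in> locally_in B")
  case True
  have D': "x \<in> D" "y \<in> D" using x y Qd(2) by auto
  have "x \<otimes> y = y \<otimes> x" using D' D_carrier by (simp add: m_comm)
  thus ?thesis using True locally_in_mult[OF B_module] D' by metis
next
  case False
  note sq = square_in_B[OF x] square_in_B[OF y]
  have xx: "x \<otimes> x \<in> B" and yy: "y \<otimes> y \<in> B" using sq False by auto
  have D': "x \<in> D" "y \<in> D" using x y Qd(2) by auto
  have c: "x \<in> carrier K" "y \<in> carrier K" using D' D_carrier by auto
  have xyD: "x \<otimes> y \<in> D" by (rule D_closed(6)[OF D'])
  obtain r s t where rst: "r \<in> R" "s \<in> R" "t \<in> R" "x \<otimes> y = r \<oplus> s \<otimes> x \<oplus> t \<otimes> y"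
    using closure_product[OF dimR fs D'] by blast
  have rD: "r \<in> D" "s \<in> D" "t \<in> D" using rst R_subset_D by auto
  have rc: "r \<in> carrier K" "s \<in> carrier K" "t \<in> carrier K" using rD D_carrier by auto
  have "r = x \<otimes> y \<ominus> s \<otimes> x \<ominus> t \<otimes> y" unfolding rst(4) using rc c by algebra
  hence "r \<in> Q" using Qm(6)[OF Qm(6)[OF Qm(7)[OF D'(1) y] Qm(7)[OF rD(2) x]] Qm(7)[OF rD(3) y]] by simp
  hence rM: "r \<in> M" using rst(1) by (simp add: M_def)
  hence rB: "r \<in> B" using M_subset_B by blast
  consider "t \<notin> M" | "s \<notin> M" | "s \<in> M" "t \<in> M" by blast
  thus ?thesis
  proof cases
    case 1
    have "t \<otimes> (x \<otimes> y) = x \<otimes> (t \<otimes> y)" using c rc by (simp add: m_ac)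
    also have "t \<otimes> y = x \<otimes> y \<ominus> r \<ominus> s \<otimes> x" unfolding rst(4) using rc c by algebra
    also have "x \<otimes> \<dots> = y \<otimes> (x \<otimes> x) \<ominus> x \<otimes> r \<ominus> s \<otimes> (x \<otimes> x)" using rc c by algebra
    also have "\<dots> \<in> B" by (rule Bm(6)[OF Bm(6)[OF Bm(7)[OF D'(2) xx] Bm(7)[OF D'(1) rB]] Bm(7)[OF rD(2) xx]])
    finally show ?thesis using locally_inI[OF xyD rD(3)] 1 rst(3) by (auto simp: M_def)
  next
    case 2
    have "s \<otimes> (x \<otimes> y) = y \<otimes> (s \<otimes> x)" using c rc by (simp add: m_ac)
    also have "s \<otimes> x = x \<otimes> y \<ominus> r \<ominus> t \<otimes> y" unfolding rst(4) using rc c by algebra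
    also have "y \<otimes> \<dots> = x \<otimes> (y \<otimes> y) \<ominus> y \<otimes> r \<ominus> t \<otimes> (y \<otimes> y)" using rc c by algebra
    also have "\<dots> \<in> B" by (rule Bm(6)[OF Bm(6)[OF Bm(7)[OF D'(1) yy] Bm(7)[OF D'(2) rB]] Bm(7)[OF rD(3) yy]])
    finally show ?thesis using locally_inI[OF xyD rD(2)] 2 rst(2) by (auto simp: M_def)
  next
    case 3
    have "s \<otimes> x \<in> B" "t \<otimes> y \<in> B" unfolding B_def using 3 D' by (auto intro: ideal_prod.prod)
    hence "x \<otimes> y \<in> B" unfolding rst(4) using Bm(4)[OF Bm(4)[OF rB]] by blast
    moreover have "\<one> \<otimes> (x \<otimes> y) = x \<otimes> y" using c by simp
    ultimately show ?thesis using locally_inI[OF xyD D_closed(3) Qd(3)] by simp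
  qed
qed

text \<open>
  Since \<open>Rx + Ry\<close> is stable, \<open>1 = hx + ky\<close> with \<open>h\<close> and \<open>k\<close> multiplying both \<open>x\<close> and \<open>y\<close> into \<open>D\<close>; take
  \<open>u = hx\<close>. At each prime one of \<open>u\<close>, \<open>1 - u\<close> is a unit, so locally one of \<open>x\<close>, \<open>y\<close> divides the other.
\<close>

lemma comparison:
  assumes xy: "x \<in> D" "y \<in> D" "x \<noteq> \<zero>"
  shows "\<exists>u\<in>D. \<exists>b\<in>D. \<exists>c\<in>D. u \<otimes> y = b \<otimes> x \<and> (\<one> \<ominus> u) \<otimes> x = c \<otimes> y"
proof -
  have c: "x \<in> carrier K" "y \<in> carrier K" using xy D_carrier by auto
  have G: "finite {x, y}" "{x, y} \<subseteq> carrier K" "{x, y} \<noteq> {}" "\<not> {x, y} \<subseteq> {\<zero>}" using c xy(3) by auto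
  define I where "I = R \<cdot> {x, y}"
  have sub: "{x, y} \<subseteq> I" unfolding I_def by (rule span_subset[OF G(2)])
  have I: "fractional_ideal K R I" "I \<noteq> {\<zero>}"
    unfolding I_def using fractional_ideal_span[OF G(1-3)] span_nonzero[OF G(2,4)] by auto
  define H where "H = D \<oslash> I"
  have ic: "I \<subseteq> carrier K" using I fractional_ideal_iff module_overD(2) by blast
  have Hm: "module_over D H" unfolding H_def
    by (rule module_colon[OF subring_module[OF D_subring] ic D_closed(1)]) auto
  note hm = module_overD[OF Hm]
  have HR: "H \<cdot> R = H" by (rule module_prod_id'[OF module_over_mono[OF Hm R_subset_D] R_closed(3,1)])
  have "\<one> \<in> I \<cdot> H" using stable_extends_invertible[OF I stab[OF I]] by (simp add: H_def)
  also have "I \<cdot> H = H \<cdot> I" by (rule ideal_prod_comm[OF ic hm(2)])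
  also have "\<dots> = (H \<cdot> R) \<cdot> {x, y}" unfolding I_def
    by (rule ideal_prod_assoc[OF hm(2) R_closed(1) G(2), symmetric])
  finally have 1: "\<one> \<in> H \<cdot> insert x {y}" by (simp add: HR)
  have "\<exists>h\<in>H. \<exists>m\<in>H \<cdot> {y}. \<one> = h \<otimes> x \<oplus> m"
    by (rule ideal_prod_insert[OF hm(1) _ _ c(1) 1]) (use c in auto)
  then obtain h m where h: "h \<in> H" "m \<in> H \<cdot> {y}" "\<one> = h \<otimes> x \<oplus> m" by blast
  obtain k where k: "k \<in> H" "m = k \<otimes> y" using ideal_prod_singleton[OF hm(1) c(2) h(2)] by blast
  have hk: "h \<in> carrier K" "k \<in> carrier K" using h k hm(2) by auto
  have inD: "h \<otimes> x \<in> D" "h \<otimes> y \<in> D" "k \<otimes> x \<in> D" using h(1) k(1) sub by (auto simp: H_def colon_def)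
  have "(h \<otimes> x) \<otimes> y = (h \<otimes> y) \<otimes> x" using hk c by (simp add: m_ac)
  moreover have "(\<one> \<ominus> h \<otimes> x) = k \<otimes> y" unfolding h(3) k(2) using hk c by algebra
  hence "(\<one> \<ominus> h \<otimes> x) \<otimes> x = (k \<otimes> x) \<otimes> y" using hk c by (simp add: m_ac)
  ultimately show ?thesis using inD by blast
qed

text \<open>
  If \<open>Q\<close> is in \<open>B\<close> locally, take \<open>x = 0\<close>; otherwise any \<open>x \<in> Q\<close> that is not locally in \<open>B\<close> will do. If
  such an \<open>x\<close> did not divide some \<open>y \<in> Q\<close> locally, then up to a unit \<open>x = cy\<close> with \<open>c \<in> Q\<close>, and
  \<open>product_locally_in_B\<close> would put \<open>x\<close> into \<open>B\<close> locally.
\<close>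

lemma exists_local_generator:
  "\<exists>x\<in>Q. Q \<subseteq> locally_in (adjoin D B x)"
proof (cases "Q \<subseteq> locally_in B")
  case True
  have "B \<subseteq> adjoin D B \<zero>" by (rule module_adjoin(2)[OF D_subring B_module]) simp
  hence "locally_in B \<subseteq> locally_in (adjoin D B \<zero>)" by (auto simp: locally_in_def)
  thus ?thesis using True Qm(3) by blast
next
  case False
  then obtain x where x: "x \<in> Q" "x \<notin> locally_in B" by blast
  have xD: "x \<in> D" using x Qd(2) by blast
  have xc: "x \<in> carrier K" using xD D_carrier by blast
  have x0: "x \<noteq> \<zero>"
  proof
    assume "x = \<zero>"
    hence "\<one> \<otimes> x \<in> B" using Bm(3) by simp
    thus False using x(2) locally_inI[OF xD D_closed(3) Qd(3)] by blast
  qed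
  note ad = module_adjoin[OF D_subring B_module xc]
  have "y \<in> locally_in (adjoin D B x)" if y: "y \<in> Q" for y
  proof -
    have yD: "y \<in> D" using y Qd(2) by blast
    obtain u b c where ubc: "u \<in> D" "b \<in> D" "c \<in> D" "u \<otimes> y = b \<otimes> x" "(\<one> \<ominus> u) \<otimes> x = c \<otimes> y"
      using comparison[OF xD yD x0] by blast
    have u1: "\<one> \<ominus> u \<in> D" by (rule group_inD(5)[OF subring_group_in[OF D_subring] D_closed(3) ubc(1)])
    show ?thesis
    proof (cases "u \<in> Q")
      case False
      have "u \<otimes> y \<in> adjoin D B x" unfolding ubc(4) by (rule module_overD(7)[OF ad(1) ubc(2) ad(3)])
      thus ?thesis using locally_inI[OF yD ubc(1) False] by blast
    next
      case True
      hence u1Q: "\<one> \<ominus> u \<notin> Q" using not_both[OF Q(1)] by blast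
      have "c \<notin> Q"
      proof
        assume "c \<in> Q"
        hence "c \<otimes> y \<in> locally_in B" by (rule product_locally_in_B[OF _ y])
        hence "(\<one> \<ominus> u) \<otimes> x \<in> locally_in B" by (simp add: ubc(5))
        thus False using locally_in_cancel[OF u1 u1Q xD] x(2) by blast
      qed
      moreover have "c \<otimes> y \<in> adjoin D B x" unfolding ubc(5)[symmetric]
        by (rule module_overD(7)[OF ad(1) u1 ad(3)])
      ultimately show ?thesis using locally_inI[OF yD ubc(3)] by blast
    qed
  qed
  thus ?thesis using x(1) by blast
qed

text \<open>
  The ideal \<open>C = ND\<close> equals \<open>Q\<close> because it does so locally: at \<open>Q\<close> by the choice of \<open>x\<close>, at other
  primes above \<open>M\<close> because they do not contain \<open>e\<close>, and at all remaining primes because they do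
  not contain \<open>M\<close>. As \<open>N\<close> is a stable fractional ideal of \<open>R\<close>, it is invertible in \<open>D\<close>.
\<close>

lemma prime_invertible: "invertible_in D Q"
proof -
  obtain x where x: "x \<in> Q" "Q \<subseteq> locally_in (adjoin D B x)" using exists_local_generator by blast
  obtain e where e: "e \<in> Q" "\<And>N. prime_in D N \<Longrightarrow> M \<subseteq> N \<Longrightarrow> N \<noteq> Q \<Longrightarrow> e \<notin> N"
    using exists_separator by blast
  have xe: "x \<in> D" "e \<in> D" using x(1) e(1) Qd(2) by auto
  have xec: "x \<in> carrier K" "e \<in> carrier K" using xe D_carrier by auto
  have Mm: "module_over R M" "M \<subseteq> R" using prime_inD[OF M_prime] by auto
  note m = module_overD[OF Mm(1)]
  define N1 where "N1 = adjoin R M x"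
  note n1 = module_adjoin[OF R_subring Mm(1) xec(1), folded N1_def]
  define N where "N = adjoin R N1 e"
  note n = module_adjoin[OF R_subring n1(1) xec(2), folded N_def]
  have QR: "module_over R Q" by (rule module_over_mono[OF Qd(1) R_subset_D])
  have "N1 \<subseteq> Q" unfolding N1_def by (rule adjoin_subset[OF R_subring _ QR x(1)]) (simp add: M_def)
  hence NQ: "N \<subseteq> Q" unfolding N_def by (intro adjoin_subset[OF R_subring _ QR e(1)])
  have nc: "N \<subseteq> carrier K" by (rule module_overD(2)[OF n(1)])
  have Nb: "bounded N"
  proof -
    have "bounded {\<one>, x, e}" by (rule bounded_finite) (use xec in auto)
    hence "bounded (R \<cdot> {\<one>, x, e})" using bounded_prod[OF bounded_R R_closed(1)] xec by auto
    moreover have "N \<subseteq> R \<cdot> {\<one>, x, e}"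
    proof -
      have g: "{\<one>, x, e} \<subseteq> carrier K" "{\<one>, x, e} \<noteq> {}" using xec by auto
      note s = module_over_span[OF g] span_subset[OF g(1)]
      have "R \<subseteq> R \<cdot> {\<one>, x, e}" by (rule subset_prod_left[OF R_closed(1)]) simp
      hence "M \<subseteq> R \<cdot> {\<one>, x, e}" using Mm(2) by blast
      hence "N1 \<subseteq> R \<cdot> {\<one>, x, e}" unfolding N1_def
        by (intro adjoin_subset[OF R_subring _ s(1)]) (use s(2) in auto)
      thus ?thesis unfolding N_def by (intro adjoin_subset[OF R_subring _ s(1)]) (use s(2) in auto)
    qed
    ultimately show ?thesis by (rule bounded_mono)
  qed
  have MN: "M \<subseteq> N" using n1(2) n(2) by blast
  have N: "fractional_ideal K R N" "N \<noteq> {\<zero>}"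
    using fractional_ideal_iff n(1) Nb MN M_nonzero m(3) by auto
  have Ninv: "\<one> \<in> N \<cdot> (D \<oslash> N)" by (rule stable_extends_invertible[OF N stab[OF N]])
  define C where "C = N \<cdot> D"
  have Cm: "module_over D C"
  proof -
    have "module_over D (D \<cdot> N)"
      by (rule module_prod[OF subring_module[OF D_subring] nc _ D_closed(1)]) (use n(3) in auto)
    thus ?thesis unfolding C_def using ideal_prod_comm[OF D_closed(1) nc] by simp
  qed
  have NC: "N \<subseteq> C" unfolding C_def by (rule subset_prod_left[OF nc D_closed(3)])
  have BC: "B \<subseteq> C" unfolding B_def C_def by (rule ideal_prod_mono[OF MN]) auto
  have "x \<in> C" using n1(3) n(2) NC by blast
  hence adC: "adjoin D B x \<subseteq> C" by (rule adjoin_subset[OF D_subring BC Cm])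
  have "Q \<subseteq> C"
  proof
    fix y assume y: "y \<in> Q"
    have yD: "y \<in> D" using y Qd(2) by blast
    have yc: "y \<in> carrier K" using yD D_carrier by blast
    \<comment> \<open>A prime containing the denominator ideal of \<open>y\<close> would contain \<open>M\<close> and \<open>e\<close>, so it would be \<open>Q\<close>.\<close>
    define U where "U = D \<inter> (C \<oslash> {y})"
    have cm: "module_over D (C \<oslash> {y})" by (rule module_colon[OF Cm _ D_closed(1)]) (use yc in auto)
    have Um: "module_over D U"
      by (rule module_overI[OF _ _ _ _ D_subring])
        (use module_overD(2-4,7)[OF cm] D_closed(1,2,6,7) in \<open>auto simp: U_def\<close>)
    have "\<one> \<in> U"
    proof (rule ccontr)
      assume "\<one> \<notin> U"
      then obtain N' where N': "prime_in D N'" "U \<subseteq> N'"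
        using exists_prime[OF D_subring Um] unfolding U_def by blast
      have "C \<inter> D \<subseteq> U" using module_overD(8)[OF Cm yD _ D_closed(1)] D_closed(1) by (auto simp: U_def colon_def)
      hence CN: "C \<inter> D \<subseteq> N'" using N'(2) by blast
      have "M \<subseteq> N'" using MN NC Mm(2) R_subset_D CN by blast
      moreover have "e \<in> N'" using n(3) NC xe CN by blast
      ultimately have "N' = Q" using e(2) N'(1) by blast
      moreover obtain u where u: "u \<in> D" "u \<notin> Q" "u \<otimes> y \<in> adjoin D B x"
        using x(2) y unfolding locally_in_def by blast
      have "u \<in> U" using u adC D_carrier by (auto simp: U_def colon_def)
      ultimately show False using N'(2) u(2) by blast
    qed
    hence "\<one> \<otimes> y \<in> C" by (auto simp: U_def colon_def)
    thus "y \<in> C" using yc by simp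
  qed
  have "D \<oslash> N \<subseteq> D \<oslash> C"
  proof -
    define H where "H = D \<oslash> N"
    have hc: "H \<subseteq> carrier K" unfolding H_def by (rule colon_subset)
    have HN: "H \<cdot> N \<subseteq> D" unfolding H_def by (rule colon_prod_le[OF subring_group_in[OF D_subring]])
    have "H \<cdot> C = (H \<cdot> N) \<cdot> D" unfolding C_def by (rule ideal_prod_assoc[OF hc nc D_closed(1), symmetric])
    also have "\<dots> \<subseteq> D \<cdot> D" by (rule ideal_prod_mono[OF HN]) auto
    also have "D \<cdot> D = D" by (rule module_prod_id[OF subring_module[OF D_subring] D_closed(3)]) auto
    finally show ?thesis unfolding H_def[symmetric]
      using le_colon_iff[OF subring_group_in[OF D_subring] hc] by blast
  qed
  also have "\<dots> \<subseteq> D \<oslash> Q" by (rule colon_antimono[OF \<open>Q \<subseteq> C\<close>])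
  finally have "N \<cdot> (D \<oslash> N) \<subseteq> Q \<cdot> (D \<oslash> Q)" using NQ by (intro ideal_prod_mono)
  thus ?thesis using Ninv unfolding invertible_in_def by blast
qed

end

context stable_one_dimensional
begin

theorem closure_mori: "mori K D"
proof (rule mori_if_ideals_invertible[OF D_subring])
  fix A assume A: "module_over D A" "A \<subseteq> D" "A \<noteq> {\<zero>}"
  show "invertible_in D A"
  proof (rule invertible_if_primes_invertible[OF D_subring _ A])
    fix Q assume "prime_in D Q" "Q \<noteq> {\<zero>}"
    then interpret closure_prime K R Q by unfold_locales
    show "invertible_in D Q" by (rule prime_invertible)
  qed
qed

end

section \<open>Multiples of fractional ideals\<close>

context ambient_field
begin

lemma l_coset_iff: "x \<in> c <# A \<longleftrightarrow> (\<exists>a\<in>A. x = c \<otimes> a)"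
  by (auto simp: l_coset_def)

lemma l_cosetI: "a \<in> A \<Longrightarrow> c \<otimes> a \<in> c <# A"
  by (auto simp: l_coset_iff)

lemma l_coset_subset: "c \<in> carrier K \<Longrightarrow> A \<subseteq> carrier K \<Longrightarrow> c <# A \<subseteq> carrier K"
  by (auto simp: l_coset_iff subset_iff)

lemma l_coset_mult:
  assumes "c \<in> carrier K" "d \<in> carrier K" "A \<subseteq> carrier K"
  shows "c <# (d <# A) = (c \<otimes> d) <# A"
proof -
  have *: "c \<otimes> (d \<otimes> a) = (c \<otimes> d) \<otimes> a" if "a \<in> A" for a using that assms by (auto simp: m_assoc)
  show ?thesis unfolding l_coset_def using * by auto
qed

lemma l_coset_one: "A \<subseteq> carrier K \<Longrightarrow> \<one> <# A = A"
  by (force simp: l_coset_iff)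

lemma nonzero_inverse:
  assumes "c \<in> carrier K" "c \<noteq> \<zero>"
  shows "inv c \<in> carrier K" "inv c \<noteq> \<zero>" "inv c \<otimes> c = \<one>" "c \<otimes> inv c = \<one>"
proof -
  have u: "c \<in> Units K" using assms field_Units by auto
  show 1: "inv c \<in> carrier K" "inv c \<otimes> c = \<one>" "c \<otimes> inv c = \<one>" using u by auto
  show "inv c \<noteq> \<zero>" using 1 assms by auto
qed

lemma l_coset_inverse:
  assumes "c \<in> carrier K" "c \<noteq> \<zero>" "A \<subseteq> carrier K"
  shows "inv c <# (c <# A) = A"
  using l_coset_mult[OF _ assms(1,3)] nonzero_inverse[OF assms(1,2)] l_coset_one[OF assms(3)] by simp

lemma l_coset_group:
  assumes c: "c \<in> carrier K" and A: "group_in A" shows "group_in (c <# A)"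
proof (rule group_inI)
  note a = group_inD[OF A]
  show "c <# A \<subseteq> carrier K" by (rule l_coset_subset[OF c a(1)])
  show "\<zero> \<in> c <# A" using l_cosetI[OF a(2), of c] c by simp
  show "x \<oplus> y \<in> c <# A" if xy: "x \<in> c <# A" "y \<in> c <# A" for x y
  proof -
    obtain u v where uv: "u \<in> A" "v \<in> A" "x = c \<otimes> u" "y = c \<otimes> v" using xy by (auto simp: l_coset_iff)
    have "x \<oplus> y = c \<otimes> (u \<oplus> v)" unfolding uv(3,4) using uv(1,2) a(1) c by (auto intro!: r_distr[symmetric])
    thus ?thesis using l_cosetI[OF a(3)[OF uv(1,2)]] by simp
  qed
  show "\<ominus> x \<in> c <# A" if x: "x \<in> c <# A" for x
  proof -
    obtain u where u: "u \<in> A" "x = c \<otimes> u" using x by (auto simp: l_coset_iff)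
    have "\<ominus> x = c \<otimes> (\<ominus> u)" unfolding u(2) using u(1) a(1) c by (auto simp: r_minus)
    thus ?thesis using l_cosetI[OF a(4)[OF u(1)], of c] by simp
  qed
qed

lemma l_coset_module:
  assumes c: "c \<in> carrier K" and A: "module_over E A" and E: "E \<subseteq> carrier K"
  shows "module_over E (c <# A)"
  unfolding module_over_def
proof (intro conjI ballI)
  note a = module_overD[OF A]
  show "group_in (c <# A)" by (rule l_coset_group[OF c a(1)])
  fix e x assume e: "e \<in> E" and "x \<in> c <# A"
  then obtain u where u: "u \<in> A" "x = c \<otimes> u" by (auto simp: l_coset_iff)
  have "u \<in> carrier K" "e \<in> carrier K" using u(1) a(2) e E by auto
  hence "e \<otimes> x = c \<otimes> (e \<otimes> u)" unfolding u(2) using c by (simp add: m_lcomm)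
  thus "e \<otimes> x \<in> c <# A" using l_cosetI[OF a(7)[OF e u(1)]] by simp
qed

lemma l_coset_prod:
  assumes c: "c \<in> carrier K" and A: "group_in A" and B: "B \<subseteq> carrier K" "B \<noteq> {}"
  shows "(c <# A) \<cdot> B = c <# (A \<cdot> B)"
proof
  note a = group_inD[OF A]
  have g: "group_in (A \<cdot> B)" by (rule ideal_prod_group_left[OF A B])
  show "(c <# A) \<cdot> B \<subseteq> c <# (A \<cdot> B)"
  proof (rule ideal_prod_le[OF l_coset_group[OF c g]])
    fix x y assume "x \<in> c <# A" and y: "y \<in> B"
    then obtain u where u: "u \<in> A" "x = c \<otimes> u" by (auto simp: l_coset_iff)
    have "u \<in> carrier K" "y \<in> carrier K" using u(1) a(1) y B(1) by auto
    hence "x \<otimes> y = c \<otimes> (u \<otimes> y)" unfolding u(2) using c by (simp add: m_assoc)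
    thus "x \<otimes> y \<in> c <# (A \<cdot> B)" using l_cosetI[OF ideal_prod.prod[OF u(1) y]] by simp
  qed
  have g': "group_in ((c <# A) \<cdot> B)" by (rule ideal_prod_group_left[OF l_coset_group[OF c A] B])
  have sub: "A \<cdot> B \<subseteq> ((c <# A) \<cdot> B) \<oslash> {c}"
  proof (rule ideal_prod_le)
    show "group_in (((c <# A) \<cdot> B) \<oslash> {c})" by (rule colon_group[OF g']) (use c in auto)
    fix x y assume x: "x \<in> A" and y: "y \<in> B"
    have xy: "x \<in> carrier K" "y \<in> carrier K" using x y a(1) B(1) by auto
    have "x \<otimes> y \<otimes> c = (c \<otimes> x) \<otimes> y" using xy c by (simp add: m_ac)
    also have "\<dots> \<in> (c <# A) \<cdot> B" by (rule ideal_prod.prod[OF l_cosetI[OF x] y])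
    finally show "x \<otimes> y \<in> ((c <# A) \<cdot> B) \<oslash> {c}" using xy by (auto simp: colon_def)
  qed
  show "c <# (A \<cdot> B) \<subseteq> (c <# A) \<cdot> B"
  proof
    fix z assume "z \<in> c <# (A \<cdot> B)"
    then obtain w where w: "w \<in> A \<cdot> B" "z = c \<otimes> w" by (auto simp: l_coset_iff)
    have "w \<in> carrier K" "w \<otimes> c \<in> (c <# A) \<cdot> B" using w(1) sub by (auto simp: colon_def)
    thus "z \<in> (c <# A) \<cdot> B" using w(2) c by (simp add: m_comm)
  qed
qed

lemma colon_l_coset_self:
  assumes c: "c \<in> carrier K" "c \<noteq> \<zero>" and A: "A \<subseteq> carrier K"
  shows "(c <# A) \<oslash> (c <# A) = A \<oslash> A"
proof -
  have "y \<otimes> (c \<otimes> x) \<in> c <# A \<longleftrightarrow> y \<otimes> x \<in> A" if y: "y \<in> carrier K" and x: "x \<in> A" for y x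
  proof
    have xc: "x \<in> carrier K" using x A by blast
    have eq: "y \<otimes> (c \<otimes> x) = c \<otimes> (y \<otimes> x)" using y xc c(1) by (simp add: m_lcomm)
    show "y \<otimes> x \<in> A \<Longrightarrow> y \<otimes> (c \<otimes> x) \<in> c <# A" unfolding eq by (rule l_cosetI)
    assume "y \<otimes> (c \<otimes> x) \<in> c <# A"
    then obtain a where a: "a \<in> A" "c \<otimes> (y \<otimes> x) = c \<otimes> a" unfolding eq by (auto simp: l_coset_iff)
    have "a \<in> carrier K" using a(1) A by blast
    hence "y \<otimes> x = a" using a(2) m_lcancel[OF c(2,1)] y xc by simp
    thus "y \<otimes> x \<in> A" using a(1) by simp
  qed
  note * = this
  have "(\<forall>z\<in>c <# A. y \<otimes> z \<in> c <# A) \<longleftrightarrow> (\<forall>x\<in>A. y \<otimes> x \<in> A)" if y: "y \<in> carrier K" for y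
  proof -
    have "(\<forall>z\<in>c <# A. y \<otimes> z \<in> c <# A) \<longleftrightarrow> (\<forall>x\<in>A. y \<otimes> (c \<otimes> x) \<in> c <# A)"
      by (simp add: l_coset_def)
    thus ?thesis using *[OF y] by simp
  qed
  thus ?thesis unfolding colon_def by blast
qed

end

context quotient_field
begin

lemma fractional_l_coset:
  assumes c: "c \<in> carrier K" "c \<noteq> \<zero>" and I: "fractional_ideal K R I" "I \<noteq> {\<zero>}"
  shows "fractional_ideal K R (c <# I)" "c <# I \<noteq> {\<zero>}"
proof -
  have m: "module_over R I" "bounded I" using I(1) fractional_ideal_iff by auto
  note i = module_overD[OF m(1)]
  obtain d where d: "d \<in> R" "d \<noteq> \<zero>" "\<forall>x\<in>I. d \<otimes> x \<in> R" using m(2) unfolding bounded_def by blast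
  obtain b where b: "b \<in> R" "b \<noteq> \<zero>" "b \<otimes> c \<in> R" using bounded_element[OF c(1)] by blast
  have bd: "b \<in> carrier K" "d \<in> carrier K" using b(1) d(1) R_closed(1) by auto
  have "b \<otimes> d \<otimes> z \<in> R" if z: "z \<in> c <# I" for z
  proof -
    obtain u where u: "u \<in> I" "z = c \<otimes> u" using z by (auto simp: l_coset_iff)
    have "u \<in> carrier K" using u(1) i(2) by blast
    hence "b \<otimes> d \<otimes> z = (b \<otimes> c) \<otimes> (d \<otimes> u)" unfolding u(2) using bd c(1) by (simp add: m_ac)
    thus ?thesis using R_closed(6)[OF b(3)] d(3) u(1) by simp
  qed
  moreover have "b \<otimes> d \<in> R" "b \<otimes> d \<noteq> \<zero>" using R_closed(6)[OF b(1) d(1)] b(2) d(2) bd by (auto simp: integral_iff)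
  ultimately have "bounded (c <# I)" unfolding bounded_def by blast
  thus "fractional_ideal K R (c <# I)"
    unfolding fractional_ideal_iff using l_coset_module[OF c(1) m(1) R_closed(1)] by blast
  obtain x where x: "x \<in> I" "x \<noteq> \<zero>" using nonzero_in_ring[OF I] by blast
  have "c \<otimes> x \<noteq> \<zero>" using x i(2) c by (auto simp: integral_iff)
  thus "c <# I \<noteq> {\<zero>}" using l_cosetI[OF x(1), of c] by auto
qed

lemma fractional_prod:
  assumes I: "fractional_ideal K R I" "I \<noteq> {\<zero>}" and J: "fractional_ideal K R J" "J \<noteq> {\<zero>}"
  shows "fractional_ideal K R (I \<cdot> J)" "I \<cdot> J \<noteq> {\<zero>}"
proof -
  have m: "module_over R I" "bounded I" "module_over R J" "bounded J" using I(1) J(1) fractional_ideal_iff by auto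
  note i = module_overD[OF m(1)] and j = module_overD[OF m(3)]
  show "fractional_ideal K R (I \<cdot> J)" unfolding fractional_ideal_iff
    using module_prod[OF m(1) j(2) _ R_closed(1)] bounded_prod[OF m(2) i(2) m(4) j(2)] j(3) by blast
  obtain x y where xy: "x \<in> I" "x \<noteq> \<zero>" "y \<in> J" "y \<noteq> \<zero>" using nonzero_in_ring[OF I] nonzero_in_ring[OF J] by blast
  have "x \<otimes> y \<noteq> \<zero>" using xy i(2) j(2) by (metis integral_iff subsetD)
  thus "I \<cdot> J \<noteq> {\<zero>}" using ideal_prod.prod[OF xy(1,3)] by auto
qed

lemma fractional_carrier: "fractional_ideal K R I \<Longrightarrow> I \<subseteq> carrier K"
  unfolding fractional_ideal_iff using module_overD(2) by blast

lemma stable_ideal_iff: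
  assumes I: "module_over R I" "I \<subseteq> R" "I \<noteq> {\<zero>}"
  shows "stable_ideal K I \<longleftrightarrow> stable_module I"
proof -
  have If: "fractional_ideal K R I" by (rule fractional_ideal_integral[OF I(1,2)])
  define E where "E = I \<oslash> I"
  define J where "J = E \<oslash> I"
  note t = trace_ideal[OF If I(3), folded E_def, folded J_def]
  note e = subringE[OF t(4)] and i = module_overD[OF I(1)] and j = module_overD[OF t(6)]
  have eg: "group_in E" by (rule subring_group_in[OF t(4)])
  show ?thesis
  proof
    assume "stable_ideal K I"
    then obtain H where H: "fractional_ideal K E H" "I \<cdot> H = E"
      unfolding stable_ideal_def Units_def fractional_ideals_def E_def by auto
    have hc: "H \<subseteq> carrier K" using H(1) group_inD(1) unfolding fractional_ideal_def by blast
    have "H \<subseteq> J" unfolding J_def using le_colon_iff[OF eg hc] ideal_prod_comm[OF t(7) hc] H(2) by simp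
    hence "I \<cdot> H \<subseteq> I \<cdot> J" by (intro ideal_prod_mono) auto
    thus "stable_module I" using H(2) e(3) by (auto simp: stable_module_def J_def E_def)
  next
    assume st: "stable_module I"
    have EIJ: "I \<cdot> J = E" unfolding J_def E_def by (rule stable_trace_eq[OF If I(3) st])
    have "\<one> \<otimes> x \<in> E" if "x \<in> I" for x using that I(2) t(5) e(1) by (auto simp: subset_iff)
    hence o: "\<forall>x\<in>I. \<one> \<otimes> x \<in> E" by blast
    have fI: "fractional_ideal K E I" unfolding fractional_ideal_def
    proof (intro conjI)
      show "group_in I" by (rule i(1))
      show "\<forall>r\<in>E. \<forall>x\<in>I. r \<otimes> x \<in> I" by (auto simp: E_def colon_def)
      show "\<exists>d\<in>E - {\<zero>}. \<forall>x\<in>I. d \<otimes> x \<in> E" using o e(3) by (intro bexI[of _ \<one>]) auto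
    qed
    have oJ: "\<one> \<in> J" using o by (auto simp: J_def colon_def)
    have fJ: "fractional_ideal K E J" unfolding fractional_ideal_def
    proof (intro conjI)
      show "group_in J" by (rule j(1))
      show "\<forall>r\<in>E. \<forall>x\<in>J. r \<otimes> x \<in> J" using j(7) by blast
      obtain x where x: "x \<in> I" "x \<noteq> \<zero>" using nonzero_in_ring[OF If I(3)] by blast
      have "x \<otimes> y \<in> E" if "y \<in> J" for y using ideal_prod.prod[OF x(1) that, of K] EIJ by simp
      moreover have "x \<in> E" using x(1) I(2) t(5) by blast
      ultimately show "\<exists>d\<in>E - {\<zero>}. \<forall>x\<in>J. d \<otimes> x \<in> E" using x(2) by blast
    qed
    have "J \<noteq> {\<zero>}" using oJ by auto
    moreover have "J \<cdot> I = E" using EIJ ideal_prod_comm[OF t(7) j(2)] by simp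
    ultimately show "stable_ideal K I"
      unfolding stable_ideal_def Units_def fractional_ideals_def E_def[symmetric] using fI fJ I(3) EIJ by auto
  qed
qed

text \<open>
  Multiplying \<open>I\<close> by \<open>c\<close> multiplies its inverse by \<open>1/c\<close> and preserves its endomorphism ring, so
  stability is a property of the ideal class.
\<close>

lemma stable_module_l_coset:
  assumes c: "c \<in> carrier K" "c \<noteq> \<zero>" and I: "fractional_ideal K R I"
    and st: "stable_module (c <# I)"
  shows "stable_module I"
proof -
  note ic = fractional_carrier[OF I]
  define E where "E = I \<oslash> I"
  have ig: "group_in I" using I fractional_ideal_iff module_overD(1) by blast
  have eg: "group_in E" unfolding E_def by (rule colon_group[OF ig ic])
  have jg: "group_in (E \<oslash> I)" by (rule colon_group[OF eg ic])
  have "(c <# I) \<cdot> (E \<oslash> (c <# I)) \<subseteq> I \<cdot> (E \<oslash> I)"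
  proof (rule ideal_prod_le)
    show "group_in (I \<cdot> (E \<oslash> I))"
      by (rule ideal_prod_group_left[OF ig colon_subset]) (use group_inD(2)[OF jg] in auto)
    fix a h assume "a \<in> c <# I" and h: "h \<in> E \<oslash> (c <# I)"
    then obtain u where u: "u \<in> I" "a = c \<otimes> u" by (auto simp: l_coset_iff)
    have hc: "h \<in> carrier K" using h by (simp add: colon_def)
    have "h \<otimes> c \<otimes> v \<in> E" if v: "v \<in> I" for v
    proof -
      have "h \<otimes> (c \<otimes> v) \<in> E" using h l_cosetI[OF v] by (auto simp: colon_def)
      moreover have "v \<in> carrier K" using v ic by blast
      ultimately show ?thesis using hc c(1) by (simp add: m_assoc)
    qed
    hence "h \<otimes> c \<in> E \<oslash> I" using hc c by (auto simp: colon_def)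
    hence "u \<otimes> (h \<otimes> c) \<in> I \<cdot> (E \<oslash> I)" by (rule ideal_prod.prod[OF u(1)])
    moreover have "u \<in> carrier K" using u(1) ic by blast
    hence "a \<otimes> h = u \<otimes> (h \<otimes> c)" unfolding u(2) using hc c(1) by (simp add: m_ac)
    ultimately show "a \<otimes> h \<in> I \<cdot> (E \<oslash> I)" by simp
  qed
  thus ?thesis using st unfolding stable_module_def colon_l_coset_self[OF c ic] E_def by blast
qed

lemma integral_multiple:
  assumes I: "fractional_ideal K R I" "I \<noteq> {\<zero>}"
  shows "\<exists>c\<in>carrier K. c \<noteq> \<zero> \<and> module_over R (c <# I) \<and> c <# I \<subseteq> R \<and> c <# I \<noteq> {\<zero>}"
proof -
  obtain c where c: "c \<in> R" "c \<noteq> \<zero>" "\<forall>x\<in>I. c \<otimes> x \<in> R"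
    using I(1) unfolding fractional_ideal_iff bounded_def by blast
  have cc: "c \<in> carrier K" using c(1) R_closed(1) by blast
  have "c <# I \<subseteq> R" using c(3) by (auto simp: l_coset_iff)
  thus ?thesis using cc c(2) fractional_l_coset[OF cc c(2) I] unfolding fractional_ideal_iff by blast
qed

lemma stable_domain_iff:
  "stable_domain K R \<longleftrightarrow> (\<forall>I. fractional_ideal K R I \<and> I \<noteq> {\<zero>} \<longrightarrow> stable_module I)"
proof
  assume L: "stable_domain K R"
  show "\<forall>I. fractional_ideal K R I \<and> I \<noteq> {\<zero>} \<longrightarrow> stable_module I"
  proof (intro allI impI)
    fix I assume I: "fractional_ideal K R I \<and> I \<noteq> {\<zero>}"
    then obtain c where c: "c \<in> carrier K" "c \<noteq> \<zero>" "module_over R (c <# I)" "c <# I \<subseteq> R" "c <# I \<noteq> {\<zero>}"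
      using integral_multiple by blast
    have "stable_ideal K (c <# I)"
      using L c(3-5) ideal_iff_module_over[OF R_subring] unfolding stable_domain_def by blast
    hence "stable_module (c <# I)" using stable_ideal_iff[OF c(3-5)] by blast
    thus "stable_module I" using stable_module_l_coset[OF c(1,2)] I by blast
  qed
next
  assume Rt: "\<forall>I. fractional_ideal K R I \<and> I \<noteq> {\<zero>} \<longrightarrow> stable_module I"
  show "stable_domain K R" unfolding stable_domain_def
  proof (intro allI impI)
    fix I assume "ideal I (K\<lparr>carrier := R\<rparr>) \<and> I \<noteq> {\<zero>}"
    hence I: "module_over R I" "I \<subseteq> R" "I \<noteq> {\<zero>}" using ideal_iff_module_over[OF R_subring] by auto
    show "stable_ideal K I"
      using stable_ideal_iff[OF I] Rt fractional_ideal_integral[OF I(1,2)] I(3) by blast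
  qed
qed

section \<open>The class semigroup\<close>

definition ideal_class :: "'a set \<Rightarrow> 'a set set" where
  "ideal_class I = {c <# I | c. c \<in> carrier K - {\<zero>}}"

lemma coset_eq_ideal_class:
  assumes "fractional_ideal K R I"
  shows "principal_fractional_ideals K R #>\<^bsub>fractional_ideals K R\<^esub> I = ideal_class I"
proof -
  have m: "module_over R I" using assms fractional_ideal_iff by blast
  have "(c <# R) \<cdot> I = c <# I" if "c \<in> carrier K" for c
    using l_coset_prod[OF that subring_group_in[OF R_subring] module_overD(2)[OF m]] module_overD(3)[OF m]
      module_prod_id[OF m R_closed(3)] by auto
  thus ?thesis
    unfolding r_coset_def principal_fractional_ideals_def fractional_ideals_def ideal_class_def by auto
qed

lemma carrier_class_semigroup:
  "carrier (class_semigroup K R) = {ideal_class I | I. fractional_ideal K R I \<and> I \<noteq> {\<zero>}}"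
proof -
  have "carrier (class_semigroup K R) =
    {principal_fractional_ideals K R #>\<^bsub>fractional_ideals K R\<^esub> I | I. fractional_ideal K R I \<and> I \<noteq> {\<zero>}}"
    unfolding class_semigroup_def FactGroup_def RCOSETS_def by (auto simp: fractional_ideals_def)
  also have "\<dots> = {ideal_class I | I. fractional_ideal K R I \<and> I \<noteq> {\<zero>}}"
    using coset_eq_ideal_class by (metis (no_types, lifting))
  finally show ?thesis .
qed

lemma mult_ideal_class:
  assumes I: "fractional_ideal K R I" "I \<noteq> {\<zero>}" and J: "fractional_ideal K R J" "J \<noteq> {\<zero>}"
  shows "ideal_class I \<otimes>\<^bsub>class_semigroup K R\<^esub> ideal_class J = ideal_class (I \<cdot> J)"
proof -
  have m: "module_over R I" "module_over R J" using I J fractional_ideal_iff by auto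
  note i = module_overD[OF m(1)] and j = module_overD[OF m(2)]
  have eq: "(c <# I) \<cdot> (d <# J) = (c \<otimes> d) <# (I \<cdot> J)" if cd: "c \<in> carrier K" "d \<in> carrier K" for c d
  proof -
    have dJ: "d <# J \<subseteq> carrier K" "d <# J \<noteq> {}" using l_coset_subset[OF cd(2) j(2)] l_cosetI[OF j(3)] by auto
    have "I \<cdot> (d <# J) = (d <# J) \<cdot> I" by (rule ideal_prod_comm[OF i(2) dJ(1)])
    also have "\<dots> = d <# (J \<cdot> I)" by (rule l_coset_prod[OF cd(2) j(1) i(2)]) (use i(3) in auto)
    also have "J \<cdot> I = I \<cdot> J" by (rule ideal_prod_comm[OF j(2) i(2)])
    finally have "I \<cdot> (d <# J) = d <# (I \<cdot> J)" .
    hence "(c <# I) \<cdot> (d <# J) = c <# (d <# (I \<cdot> J))" using l_coset_prod[OF cd(1) i(1) dJ] by simp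
    also have "\<dots> = (c \<otimes> d) <# (I \<cdot> J)" by (rule l_coset_mult[OF cd ideal_prod_subset_carrier[OF i(2) j(2)]])
    finally show ?thesis .
  qed
  have mult: "A \<otimes>\<^bsub>class_semigroup K R\<^esub> B = {a \<cdot> b | a b. a \<in> A \<and> b \<in> B}" for A B
    unfolding class_semigroup_def FactGroup_def set_mult_def by (auto simp: fractional_ideals_def)
  show ?thesis
  proof
    show "ideal_class I \<otimes>\<^bsub>class_semigroup K R\<^esub> ideal_class J \<subseteq> ideal_class (I \<cdot> J)"
    proof
      fix A assume "A \<in> ideal_class I \<otimes>\<^bsub>class_semigroup K R\<^esub> ideal_class J"
      then obtain c d where cd: "c \<in> carrier K" "c \<noteq> \<zero>" "d \<in> carrier K" "d \<noteq> \<zero>" "A = (c <# I) \<cdot> (d <# J)"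
        unfolding mult by (auto simp: ideal_class_def)
      have "A = (c \<otimes> d) <# (I \<cdot> J)" unfolding cd(5) by (rule eq[OF cd(1,3)])
      moreover have "c \<otimes> d \<in> carrier K - {\<zero>}" using cd by (auto simp: integral_iff)
      ultimately show "A \<in> ideal_class (I \<cdot> J)" unfolding ideal_class_def by blast
    qed
    show "ideal_class (I \<cdot> J) \<subseteq> ideal_class I \<otimes>\<^bsub>class_semigroup K R\<^esub> ideal_class J"
    proof
      fix A assume "A \<in> ideal_class (I \<cdot> J)"
      then obtain c where c: "c \<in> carrier K" "c \<noteq> \<zero>" "A = c <# (I \<cdot> J)" by (auto simp: ideal_class_def)
      have "A = (c <# I) \<cdot> (\<one> <# J)" unfolding c(3) using eq[OF c(1), of \<one>] c(1) by simp
      moreover have "c <# I \<in> ideal_class I" "\<one> <# J \<in> ideal_class J" using c by (auto simp: ideal_class_def)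
      ultimately show "A \<in> ideal_class I \<otimes>\<^bsub>class_semigroup K R\<^esub> ideal_class J" unfolding mult by blast
    qed
  qed
qed

lemma ideal_class_eq:
  assumes I: "fractional_ideal K R I" and J: "fractional_ideal K R J"
  shows "ideal_class I = ideal_class J \<longleftrightarrow> (\<exists>c\<in>carrier K. c \<noteq> \<zero> \<and> I = c <# J)"
proof
  note ic = fractional_carrier[OF I] and jc = fractional_carrier[OF J]
  assume eq: "ideal_class I = ideal_class J"
  have "\<one> <# I \<in> ideal_class I" by (auto simp: ideal_class_def)
  hence "I \<in> ideal_class J" using eq l_coset_one[OF ic] by simp
  thus "\<exists>c\<in>carrier K. c \<noteq> \<zero> \<and> I = c <# J" by (auto simp: ideal_class_def)
next
  note ic = fractional_carrier[OF I] and jc = fractional_carrier[OF J]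
  have sub: "ideal_class (c <# A) \<subseteq> ideal_class A" if "c \<in> carrier K" "c \<noteq> \<zero>" "A \<subseteq> carrier K" for c A
  proof
    fix B assume "B \<in> ideal_class (c <# A)"
    then obtain d where d: "d \<in> carrier K" "d \<noteq> \<zero>" "B = d <# (c <# A)" by (auto simp: ideal_class_def)
    have "B = (d \<otimes> c) <# A" unfolding d(3) by (rule l_coset_mult[OF d(1) that(1,3)])
    moreover have "d \<otimes> c \<in> carrier K - {\<zero>}" using d that by (auto simp: integral_iff)
    ultimately show "B \<in> ideal_class A" unfolding ideal_class_def by blast
  qed
  assume "\<exists>c\<in>carrier K. c \<noteq> \<zero> \<and> I = c <# J"
  then obtain c where c: "c \<in> carrier K" "c \<noteq> \<zero>" "I = c <# J" by blast
  have "J = inv c <# I" unfolding c(3) by (rule l_coset_inverse[OF c(1,2) jc, symmetric])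
  thus "ideal_class I = ideal_class J"
    using sub[OF c(1,2) jc] sub[OF nonzero_inverse(1,2)[OF c(1,2)] ic] c(3) by auto
qed

text \<open>
  A Clifford inverse \<open>A'\<close> of \<open>I\<close> satisfies \<open>(IA')I = I\<close>, so \<open>IA' \<subseteq> E\<close> and \<open>A' \<subseteq> (E:I)\<close>. Hence replacing \<open>A'\<close>
  by \<open>(E:I)\<close> can only enlarge the product \<open>I(IA') = I\<close>, while \<open>I(I(E:I)) \<subseteq> IE = I\<close>.
\<close>

lemma clifford_regular_imp_trace_fixes:
  assumes cl: "clifford_regular K R" and I: "fractional_ideal K R I" "I \<noteq> {\<zero>}"
  shows "I \<cdot> (I \<cdot> ((I \<oslash> I) \<oslash> I)) = I"
proof -
  have "\<exists>x\<in>carrier (class_semigroup K R). (ideal_class I \<otimes>\<^bsub>class_semigroup K R\<^esub> ideal_class I)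
    \<otimes>\<^bsub>class_semigroup K R\<^esub> x = ideal_class I"
    using cl I unfolding clifford_regular_def clifford_semigroup_def carrier_class_semigroup by blast
  then obtain A where A: "fractional_ideal K R A" "A \<noteq> {\<zero>}"
    "(ideal_class I \<otimes>\<^bsub>class_semigroup K R\<^esub> ideal_class I) \<otimes>\<^bsub>class_semigroup K R\<^esub> ideal_class A = ideal_class I"
    unfolding carrier_class_semigroup by blast
  note II = fractional_prod[OF I I] and IIA = fractional_prod[OF fractional_prod[OF I I] A(1,2)]
  have "ideal_class I = ideal_class ((I \<cdot> I) \<cdot> A)"
    using A(3) mult_ideal_class[OF I I] mult_ideal_class[OF II A(1,2)] by simp
  then obtain c where c: "c \<in> carrier K" "c \<noteq> \<zero>" "I = c <# ((I \<cdot> I) \<cdot> A)"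
    using ideal_class_eq[OF I(1) IIA(1)] by blast
  define E where "E = I \<oslash> I"
  note t = trace_ideal[OF I, folded E_def]
  have ac: "A \<subseteq> carrier K" and ag: "group_in A"
    using fractional_carrier[OF A(1)] A(1) module_overD(1) unfolding fractional_ideal_iff by auto
  define A' where "A' = c <# A"
  have a'c: "A' \<subseteq> carrier K" unfolding A'_def by (rule l_coset_subset[OF c(1) ac])
  have iic: "I \<cdot> I \<subseteq> carrier K" by (rule fractional_carrier[OF II(1)])
  have ig: "group_in I" using I(1) module_overD(1) unfolding fractional_ideal_iff by blast
  have ine: "I \<cdot> I \<noteq> {}" using II(1) module_overD(3) unfolding fractional_ideal_iff by blast
  have "(I \<cdot> I) \<cdot> A = A \<cdot> (I \<cdot> I)" by (rule ideal_prod_comm[OF iic ac])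
  hence "I = A' \<cdot> (I \<cdot> I)" unfolding A'_def using l_coset_prod[OF c(1) ag iic ine] c(3) by simp
  also have "\<dots> = I \<cdot> (A' \<cdot> I)" by (rule ideal_prod_left_comm[OF a'c t(7) t(7)])
  also have "A' \<cdot> I = I \<cdot> A'" by (rule ideal_prod_comm[OF a'c t(7)])
  finally have eq: "I = I \<cdot> (I \<cdot> A')" .
  have ia: "I \<cdot> A' \<subseteq> carrier K" by (rule ideal_prod_subset_carrier[OF t(7) a'c])
  have "I \<cdot> A' \<subseteq> E" unfolding E_def
    using le_colon_iff[OF ig ia, of I] eq ideal_prod_comm[OF t(7) ia] by simp
  hence "A' \<subseteq> E \<oslash> I"
    using le_colon_iff[OF subring_group_in[OF t(4)] a'c, of I] ideal_prod_comm[OF a'c t(7)] by simp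
  hence "I \<cdot> (I \<cdot> A') \<subseteq> I \<cdot> (I \<cdot> (E \<oslash> I))" by (intro ideal_prod_mono) auto
  hence 1: "I \<subseteq> I \<cdot> (I \<cdot> (E \<oslash> I))" using eq by simp
  have "I \<cdot> (I \<cdot> (E \<oslash> I)) \<subseteq> I \<cdot> E" by (rule ideal_prod_mono[OF _ t(2)]) auto
  also have "\<dots> = I" unfolding E_def
    by (rule module_prod_id'[OF module_colon_self[OF ig]]) (use subringE(1,3)[OF t(4)] in \<open>auto simp: E_def\<close>)
  finally show ?thesis using 1 by (simp add: E_def)
qed

lemma stable_imp_clifford_regular:
  assumes st: "\<And>I. fractional_ideal K R I \<Longrightarrow> I \<noteq> {\<zero>} \<Longrightarrow> stable_module I"
  shows "clifford_regular K R"
  unfolding clifford_regular_def clifford_semigroup_def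
proof
  fix x assume "x \<in> carrier (class_semigroup K R)"
  then obtain I where I: "fractional_ideal K R I" "I \<noteq> {\<zero>}" and x: "x = ideal_class I"
    unfolding carrier_class_semigroup by blast
  define E where "E = I \<oslash> I"
  define J where "J = E \<oslash> I"
  note t = trace_ideal[OF I, folded E_def, folded J_def]
  note e = bounded_ringD[OF t(8)]
  have ig: "group_in I" using I(1) module_overD(1) unfolding fractional_ideal_iff by blast
  obtain y where y: "y \<in> I" "y \<noteq> \<zero>" using nonzero_in_ring[OF I] by blast
  have yc: "y \<in> carrier K" using y t(7) by blast
  have "bounded J" unfolding J_def by (rule colon_bounded[OF e(3) y yc])
  hence J: "fractional_ideal K R J" unfolding fractional_ideal_iff using module_over_mono[OF t(6) t(5)] by blast
  have jc: "J \<subseteq> carrier K" by (rule fractional_carrier[OF J])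
  have 1: "\<one> \<in> I \<cdot> J" using st[OF I] by (simp add: stable_module_def J_def E_def)
  have J0: "J \<noteq> {\<zero>}"
  proof
    assume "J = {\<zero>}"
    hence "I \<cdot> J \<subseteq> {\<zero>}" using t(7) by (intro ideal_prod_le) (auto intro!: group_inI)
    hence "\<one> \<in> {\<zero>}" using 1 by blast
    thus False by simp
  qed
  have IJ: "I \<cdot> J = E" unfolding J_def E_def by (rule stable_trace_eq[OF I st[OF I]])
  have "(I \<cdot> I) \<cdot> J = I \<cdot> E" using ideal_prod_assoc[OF t(7) t(7) jc] IJ by simp
  also have "I \<cdot> E = I" unfolding E_def
    by (rule module_prod_id'[OF module_colon_self[OF ig]]) (use e(5,6) in \<open>auto simp: E_def\<close>)
  finally have "ideal_class ((I \<cdot> I) \<cdot> J) = ideal_class I" by simp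
  hence "(x \<otimes>\<^bsub>class_semigroup K R\<^esub> x) \<otimes>\<^bsub>class_semigroup K R\<^esub> ideal_class J = x"
    unfolding x mult_ideal_class[OF I I] mult_ideal_class[OF fractional_prod[OF I I] J J0] .
  moreover have "ideal_class J \<in> carrier (class_semigroup K R)"
    unfolding carrier_class_semigroup using J J0 by blast
  ultimately show "\<exists>a\<in>carrier (class_semigroup K R).
    (x \<otimes>\<^bsub>class_semigroup K R\<^esub> x) \<otimes>\<^bsub>class_semigroup K R\<^esub> a = x" by blast
qed

lemma boole_regular_imp_clifford_regular:
  "boole_regular K R \<Longrightarrow> clifford_regular K R"
  unfolding boole_regular_def clifford_regular_def boolean_semigroup_def clifford_semigroup_def by metis

lemma boole_regular_iff:
  "boole_regular K R \<longleftrightarrow>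
    (\<forall>I. fractional_ideal K R I \<and> I \<noteq> {\<zero>} \<longrightarrow> (\<exists>c\<in>carrier K. c \<noteq> \<zero> \<and> I = c <# (I \<cdot> I)))"
proof -
  have "boole_regular K R \<longleftrightarrow> (\<forall>I. fractional_ideal K R I \<and> I \<noteq> {\<zero>} \<longrightarrow>
    ideal_class I = ideal_class I \<otimes>\<^bsub>class_semigroup K R\<^esub> ideal_class I)"
    unfolding boole_regular_def boolean_semigroup_def carrier_class_semigroup by auto
  thus ?thesis using mult_ideal_class ideal_class_eq fractional_prod by metis
qed

text \<open>
  If \<open>I = cI\<^sup>2\<close>, then \<open>J = cI\<close> is idempotent and invertible over \<open>(J:J) = (I:I)\<close>; cancelling \<open>J\<close> from
  \<open>J\<^sup>2 = J\<close> gives \<open>J = (I:I)\<close>.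
\<close>

lemma stable_boole_principal:
  assumes st: "\<And>I. fractional_ideal K R I \<Longrightarrow> I \<noteq> {\<zero>} \<Longrightarrow> stable_module I"
    and I: "fractional_ideal K R I" "I \<noteq> {\<zero>}" and c: "c \<in> carrier K" "c \<noteq> \<zero>" "I = c <# (I \<cdot> I)"
  shows "\<exists>d\<in>carrier K. I = d <# (I \<oslash> I)"
proof -
  note ic = fractional_carrier[OF I(1)]
  have ig: "group_in I" using I(1) module_overD(1) unfolding fractional_ideal_iff by blast
  define J where "J = c <# I"
  note J = fractional_l_coset[OF c(1,2) I, folded J_def]
  define E where "E = J \<oslash> J"
  define H where "H = E \<oslash> J"
  note t = trace_ideal[OF J, folded E_def, folded H_def]
  note e = subringE[OF t(4)]
  have EI: "E = I \<oslash> I" unfolding E_def J_def by (rule colon_l_coset_self[OF c(1,2) ic])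
  have jg: "group_in J" using J(1) module_overD(1) unfolding fractional_ideal_iff by blast
  have jm: "module_over E J" unfolding E_def by (rule module_colon_self[OF jg])
  have hc: "H \<subseteq> carrier K" unfolding H_def by (rule colon_subset)
  have ine: "I \<noteq> {}" using group_inD(2)[OF ig] by blast
  have "I \<cdot> J = J \<cdot> I" by (rule ideal_prod_comm[OF ic t(7)])
  also have "\<dots> = c <# (I \<cdot> I)" unfolding J_def by (rule l_coset_prod[OF c(1) ig ic ine])
  also have "\<dots> = I" using c(3) by simp
  finally have "I \<cdot> J = I" .
  moreover have "J \<cdot> J = c <# (I \<cdot> J)" unfolding J_def
    by (rule l_coset_prod[OF c(1) ig]) (use t(7) l_cosetI[OF group_inD(2)[OF ig]] in \<open>auto simp: J_def\<close>)
  ultimately have JJ: "J \<cdot> J = J" by (simp add: J_def)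
  have "J \<cdot> H = J \<cdot> (J \<cdot> H)" using ideal_prod_assoc[OF t(7) t(7) hc] JJ by simp
  also have "\<dots> \<subseteq> J \<cdot> E" by (rule ideal_prod_mono[OF _ t(2)]) auto
  also have "\<dots> = J" by (rule module_prod_id'[OF jm e(3,1)])
  finally have 1: "\<one> \<in> J" using st[OF J] by (auto simp: stable_module_def H_def E_def)
  have "J = E"
  proof
    show "J \<subseteq> E" unfolding E_def using le_colon_iff[OF jg t(7), of J] JJ by simp
    show "E \<subseteq> J" by (rule subset_module_if_one[OF jm 1 e(1)])
  qed
  hence "inv c <# (I \<oslash> I) = I" using l_coset_inverse[OF c(1,2) ic] EI by (simp add: J_def)
  thus ?thesis using nonzero_inverse(1)[OF c(1,2)] by metis
qed

lemma strongly_stable_principal: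
  assumes "strongly_stable_domain K R" and I: "fractional_ideal K R I" "I \<noteq> {\<zero>}"
  shows "\<exists>d\<in>carrier K. d \<noteq> \<zero> \<and> I = d <# (I \<oslash> I)"
proof -
  note ic = fractional_carrier[OF I(1)]
  obtain c where c: "c \<in> carrier K" "c \<noteq> \<zero>" "module_over R (c <# I)" "c <# I \<subseteq> R" "c <# I \<noteq> {\<zero>}"
    using integral_multiple[OF I] by blast
  obtain d where d: "d \<in> carrier K" "c <# I = d <# ((c <# I) \<oslash> (c <# I))"
    using assms(1) c(3-5) ideal_iff_module_over[OF R_subring] unfolding strongly_stable_domain_def by blast
  have d': "c <# I = d <# (I \<oslash> I)" using d(2) colon_l_coset_self[OF c(1,2) ic] by simp
  have "I = inv c <# (d <# (I \<oslash> I))" using l_coset_inverse[OF c(1,2) ic] d' by simp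
  also have "\<dots> = (inv c \<otimes> d) <# (I \<oslash> I)"
    by (rule l_coset_mult[OF nonzero_inverse(1)[OF c(1,2)] d(1) colon_subset])
  finally have eq: "I = (inv c \<otimes> d) <# (I \<oslash> I)" .
  have "d \<noteq> \<zero>"
  proof
    assume "d = \<zero>"
    hence "c <# I \<subseteq> {\<zero>}" unfolding d' using colon_subset by (auto simp: l_coset_iff subset_iff)
    moreover have "\<zero> \<in> c <# I" using module_overD(3)[OF c(3)] .
    ultimately show False using c(5) by blast
  qed
  hence "inv c \<otimes> d \<noteq> \<zero>" using nonzero_inverse[OF c(1,2)] d(1) by (simp add: integral_iff)
  thus ?thesis using eq nonzero_inverse(1)[OF c(1,2)] d(1) by (intro bexI[of _ "inv c \<otimes> d"]) auto
qed

lemma principal_stable: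
  assumes I: "fractional_ideal K R I" "I \<noteq> {\<zero>}"
    and d: "d \<in> carrier K" "d \<noteq> \<zero>" "I = d <# (I \<oslash> I)"
  shows "stable_module I" "I = inv d <# (I \<cdot> I)"
proof -
  define E where "E = I \<oslash> I"
  note t = trace_ideal[OF I, folded E_def]
  note e = subringE[OF t(4)] and di = nonzero_inverse[OF d(1,2)]
  have Id: "I = d <# E" using d(3) by (simp add: E_def)
  have ig: "group_in I" using I(1) module_overD(1) unfolding fractional_ideal_iff by blast
  have im: "module_over E I" unfolding E_def by (rule module_colon_self[OF ig])
  have "d \<otimes> \<one> \<in> I" by (subst Id) (rule l_cosetI[OF e(3)])
  hence dI: "d \<in> I" using d(1) by simp
  have "inv d \<otimes> x \<in> E" if x: "x \<in> I" for x
  proof -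
    obtain z where z: "z \<in> E" "x = d \<otimes> z" using x Id by (auto simp: l_coset_iff)
    have "z \<in> carrier K" using z(1) e(1) by blast
    hence "inv d \<otimes> x = (inv d \<otimes> d) \<otimes> z" unfolding z(2) using di(1) d(1) by (simp only: m_assoc)
    also have "\<dots> = z" using di(3) \<open>z \<in> carrier K\<close> by simp
    finally show ?thesis using z(1) by simp
  qed
  hence "inv d \<in> E \<oslash> I" using di(1) by (auto simp: colon_def)
  hence "d \<otimes> inv d \<in> I \<cdot> (E \<oslash> I)" by (rule ideal_prod.prod[OF dI])
  thus "stable_module I" using di(4) by (simp add: stable_module_def E_def)
  have ine: "I \<noteq> {}" using dI by blast
  have "(d <# E) \<cdot> I = d <# (E \<cdot> I)" by (rule l_coset_prod[OF d(1) subring_group_in[OF t(4)] t(7) ine])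
  hence "I \<cdot> I = d <# I" using module_prod_id[OF im e(3)] Id by simp
  thus "I = inv d <# (I \<cdot> I)" using l_coset_inverse[OF d(1,2) t(7)] by simp
qed

lemma strongly_stable_iff:
  "strongly_stable_domain K R \<longleftrightarrow> stable_domain K R \<and> boole_regular K R"
proof
  assume s: "strongly_stable_domain K R"
  have "stable_module I" "\<exists>c\<in>carrier K. c \<noteq> \<zero> \<and> I = c <# (I \<cdot> I)"
    if I: "fractional_ideal K R I" "I \<noteq> {\<zero>}" for I
  proof -
    obtain d where d: "d \<in> carrier K" "d \<noteq> \<zero>" "I = d <# (I \<oslash> I)" using strongly_stable_principal[OF s I] by blast
    show "stable_module I" by (rule principal_stable(1)[OF I d])
    show "\<exists>c\<in>carrier K. c \<noteq> \<zero> \<and> I = c <# (I \<cdot> I)"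
      using principal_stable(2)[OF I d] nonzero_inverse(1,2)[OF d(1,2)] by blast
  qed
  thus "stable_domain K R \<and> boole_regular K R" unfolding stable_domain_iff boole_regular_iff by blast
next
  assume s: "stable_domain K R \<and> boole_regular K R"
  show "strongly_stable_domain K R" unfolding strongly_stable_domain_def
  proof (intro allI impI)
    fix I assume "ideal I (K\<lparr>carrier := R\<rparr>) \<and> I \<noteq> {\<zero>}"
    hence I: "module_over R I" "I \<subseteq> R" "I \<noteq> {\<zero>}" using ideal_iff_module_over[OF R_subring] by auto
    have If: "fractional_ideal K R I" by (rule fractional_ideal_integral[OF I(1,2)])
    obtain c where c: "c \<in> carrier K" "c \<noteq> \<zero>" "I = c <# (I \<cdot> I)"
      using s If I(3) unfolding boole_regular_iff by blast
    show "\<exists>c\<in>carrier K. I = c <# (I \<oslash> I)"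
      using stable_boole_principal[OF _ If I(3) c] s unfolding stable_domain_iff by blast
  qed
qed

section \<open>Krull dimension\<close>

lemma zero_prime: "prime_in R {\<zero>}"
  unfolding prime_in_def
proof (intro conjI ballI impI)
  show "module_over R {\<zero>}" by (rule module_overI[OF _ _ _ _ R_subring]) (use R_closed(1) in auto)
  show "{\<zero>} \<subseteq> R" using R_closed(2) by simp
  show "\<one> \<notin> {\<zero>}" by simp
  fix a b assume "a \<in> R" "b \<in> R" "a \<otimes> b \<in> {\<zero>}"
  thus "a \<in> {\<zero>} \<or> b \<in> {\<zero>}" using R_closed(1) integral_iff[of a b] by auto
qed

lemma exists_nonzero_prime:
  assumes "\<not> field (K\<lparr>carrier := R\<rparr>)"
  shows "\<exists>P. prime_in R P \<and> P \<noteq> {\<zero>}"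
proof -
  have "\<exists>x\<in>R - {\<zero>}. inv x \<notin> R"
  proof (rule ccontr)
    assume "\<not> ?thesis"
    hence "subfield R K" by (intro subfieldI' R_subring) auto
    thus False using assms subfield_iff(2) by blast
  qed
  then obtain x where x: "x \<in> R" "x \<noteq> \<zero>" "inv x \<notin> R" by blast
  have xc: "x \<in> carrier K" using x R_closed(1) by blast
  note ad = module_adjoin[OF R_subring prime_inD(1)[OF zero_prime] xc]
  have sub: "adjoin R {\<zero>} x \<subseteq> R"
    by (rule adjoin_subset[OF R_subring _ subring_module[OF R_subring] x(1)]) (use R_closed(2) in auto)
  have "\<one> \<notin> adjoin R {\<zero>} x"
  proof
    assume "\<one> \<in> adjoin R {\<zero>} x"
    then obtain r where r: "r \<in> R" "\<one> = \<zero> \<oplus> r \<otimes> x" by (auto simp: adjoin_def)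
    have rc: "r \<in> carrier K" using r(1) R_closed(1) by blast
    have "r \<otimes> x = \<one>" using r(2) rc xc by simp
    hence "r = inv x" using nonzero_inverse[OF xc x(2)] rc xc by (metis m_assoc l_one r_one)
    thus False using r(1) x(3) by simp
  qed
  then obtain P where "prime_in R P" "adjoin R {\<zero>} x \<subseteq> P" using exists_prime[OF R_subring ad(1) sub] by blast
  thus ?thesis using ad(3) x(2) by blast
qed

text \<open>
  Over a domain that is not a field, \<open>0\<close> is a prime and not the only one, which accounts for
  the difference between dimension one and dimension at most one.
\<close>

lemma krull_dim_one_iff:
  assumes nf: "\<not> field (K\<lparr>carrier := R\<rparr>)"
  shows "krull_dim (K\<lparr>carrier := R\<rparr>) = 1 \<longleftrightarrow> dimension_le_one R"
proof
  define C where "C = {enat n | n. \<exists>P. (\<forall>i\<le>n. prime_in R (P i)) \<and> (\<forall>i<n. P i \<subset> P (Suc i))}"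
  have kd: "krull_dim (K\<lparr>carrier := R\<rparr>) = Sup C"
    unfolding krull_dim_def primeideal_iff_prime_in[OF R_subring] C_def ..
  show "dimension_le_one R" if "krull_dim (K\<lparr>carrier := R\<rparr>) = 1"
  proof (rule ccontr)
    assume "\<not> dimension_le_one R"
    then obtain P N where PN: "prime_in R P" "prime_in R N" "P \<noteq> {\<zero>}" "P \<subset> N"
      unfolding dimension_le_one_def by blast
    define Z where "Z i = (if i = 0 then {\<zero>} else if i = 1 then P else N)" for i :: nat
    have "\<zero> \<in> P" using module_overD(3)[OF prime_inD(1)[OF PN(1)]] .
    hence "{\<zero>} \<subset> P" using PN(3) by blast
    hence "Z i \<subset> Z (Suc i)" if "i < 2" for i using that PN(4) by (auto simp: Z_def)
    moreover have "prime_in R (Z i)" for i using PN zero_prime by (simp add: Z_def)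
    ultimately have "enat 2 \<in> C" unfolding C_def by blast
    hence "enat 2 \<le> Sup C" by (rule Sup_upper)
    thus False using that kd by (simp add: one_enat_def)
  qed
  show "krull_dim (K\<lparr>carrier := R\<rparr>) = 1" if d: "dimension_le_one R"
  proof -
    have "c \<le> 1" if c: "c \<in> C" for c
    proof -
      obtain n P where P: "c = enat n" "\<And>i. i \<le> n \<Longrightarrow> prime_in R (P i)" "\<And>i. i < n \<Longrightarrow> P i \<subset> P (Suc i)"
        using c unfolding C_def by blast
      have "n \<le> 1"
      proof (rule ccontr)
        assume n: "\<not> n \<le> 1"
        have s: "P 0 \<subset> P 1" "P 1 \<subset> P 2" using P(3)[of 0] P(3)[of 1] n by (simp_all add: numeral_2_eq_2)
        have p: "prime_in R (P 0)" "prime_in R (P 1)" "prime_in R (P 2)" using P(2) n by auto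
        have "\<zero> \<in> P 0" using module_overD(3)[OF prime_inD(1)[OF p(1)]] .
        moreover have "\<not> P 1 \<subseteq> P 0" using s(1) by (metis psubset_eq subset_antisym)
        ultimately have "P 1 \<noteq> {\<zero>}" by auto
        thus False using d p s unfolding dimension_le_one_def by blast
      qed
      thus ?thesis using P(1) by (simp add: one_enat_def)
    qed
    hence "Sup C \<le> 1" by (rule Sup_least)
    moreover have "1 \<le> Sup C"
    proof -
      obtain P where P: "prime_in R P" "P \<noteq> {\<zero>}" using exists_nonzero_prime[OF nf] by blast
      define Z where "Z i = (if i = 0 then {\<zero>} else P)" for i :: nat
      have "\<zero> \<in> P" using module_overD(3)[OF prime_inD(1)[OF P(1)]] .
      hence "{\<zero>} \<subset> P" using P(2) by blast
      hence "Z i \<subset> Z (Suc i)" if "i < 1" for i using that by (simp add: Z_def)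
      moreover have "prime_in R (Z i)" for i using P zero_prime by (simp add: Z_def)
      ultimately have "enat 1 \<in> C" unfolding C_def by blast
      thus ?thesis using Sup_upper[of "enat 1" C] by (simp add: one_enat_def)
    qed
    ultimately show ?thesis using kd by simp
  qed
qed

section \<open>Clifford regularity and stability\<close>

theorem clifford_iff_stable:
  assumes nf: "\<not> field (K\<lparr>carrier := R\<rparr>)" and M: "mori K R"
  shows "krull_dim (K\<lparr>carrier := R\<rparr>) = 1 \<and> clifford_regular K R \<and> mori K D \<longleftrightarrow> stable_domain K R"
proof
  assume L: "krull_dim (K\<lparr>carrier := R\<rparr>) = 1 \<and> clifford_regular K R \<and> mori K D"
  have d: "dimension_le_one R" using krull_dim_one_iff[OF nf] L by blast
  show "stable_domain K R" unfolding stable_domain_iff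
    using stable_if_trace_fixes[OF d _ clifford_regular_imp_trace_fixes] L by blast
next
  assume "stable_domain K R"
  hence st: "\<And>I. fractional_ideal K R I \<Longrightarrow> I \<noteq> {\<zero>} \<Longrightarrow> stable_module I"
    unfolding stable_domain_iff by blast
  have d: "dimension_le_one R" by (rule stable_mori_dimension[OF M st])
  interpret stable_one_dimensional K R by unfold_locales (use d st in auto)
  show "krull_dim (K\<lparr>carrier := R\<rparr>) = 1 \<and> clifford_regular K R \<and> mori K D"
    using krull_dim_one_iff[OF nf] d stable_imp_clifford_regular[OF st] closure_mori by blast
qed

end

theorem theorem4p7:
  fixes K :: "('a, 'b) ring_scheme" and R :: "'a set"
  assumes "quotient_field K R"
    and "\<not> field (K\<lparr>carrier := R\<rparr>)"
    and "mori K R"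
  shows "((krull_dim (K\<lparr>carrier := R\<rparr>) = 1 \<and> clifford_regular K R \<and>
             mori K (complete_integral_closure K R))
           \<longleftrightarrow> stable_domain K R)
       \<and> ((krull_dim (K\<lparr>carrier := R\<rparr>) = 1 \<and> boole_regular K R \<and>
             mori K (complete_integral_closure K R))
           \<longleftrightarrow> strongly_stable_domain K R)"
proof -
  interpret quotient_field K R by (rule assms(1))
  note clifford = clifford_iff_stable[OF assms(2,3)]
  show ?thesis
    using clifford boole_regular_imp_clifford_regular strongly_stable_iff by blast
qed

end
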